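(* Let $m\in\mathbb{N}$, let $\theta_1<\theta_2<\dots<\theta_m<\theta_{m+1}=\theta_1+2\pi$ and let $h\colon\mathbb{R}\to\mathbb{R}$ be a continuous function satisfying $h(\theta)>0$ for $\theta_j<\theta<\theta_{j+1}$ and $j=1,\dots,m$. Let $f$ be an entire function, let $\rho(r)$ be a proximate order and let $\varepsilon(r)=1/\log^N(r)$ for some $N\in\mathbb{N}$. Suppose that $$\log|f(re^{i\theta})|=h(\theta)r^{\rho(r)}+O\!\left(r^{\rho(r)}\varepsilon(r)\right)$$ as $r\to\infty$, uniformly for all $\theta\in[\theta_1,\theta_{m+1}]$ satisfying $$|\theta-\theta_j|>\varepsilon(r)\quad\text{for } j=1,\dots,m+1.$$ Then $I(f)\cap J(f)$ has positive Lebesgue measure.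
   Context: $\log^N$ denotes the $N$-th iterate of the logarithm (so $\varepsilon(r)$ is defined for large $r$). A function $\rho(r)$ is a proximate order if it is positive and differentiable for large $r$, $\lim_{r\to\infty}\rho(r)=\rho$ for some $\rho\in(0,\infty)$, and $\lim_{r\to\infty}\rho'(r)\,r\log r=0$. For an entire function $f$, the Fatou set is the set of points of $\mathbb{C}$ at which the iterates $f^n$ form a normal family, the Julia set $J(f)$ is its complement in $\mathbb{C}$, and the escaping set is $I(f)=\{z\in\mathbb{C}\colon f^n(z)\to\infty \text{ as } n\to\infty\}$. Lebesgue measure is two-dimensional Lebesgue measure on $\mathbb{C}$. *)

theory Defs
  imports "HOL-Complex_Analysis.Complex_Analysis"
begin

text \<open>
  Normality in the sense of Montel, with the constant limit \<open>\<infinity>\<close> admitted. The limit \<open>l\<close> is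
  automatically holomorphic when the members of the family are. The dichotomy between a finite
  limit and \<open>\<infinity>\<close> is the appropriate one for families of holomorphic functions on a domain, so
  the notion is only to be used for connected open \<open>U\<close>. The sequence \<open>g\<close> is an arbitrary sequence
  of members of \<open>F\<close>, possibly with repetitions.
\<close>

definition normal_family_on :: "(complex \<Rightarrow> complex) set \<Rightarrow> complex set \<Rightarrow> bool" where
  "normal_family_on F U \<longleftrightarrow>
     (\<forall>g :: nat \<Rightarrow> complex \<Rightarrow> complex. range g \<subseteq> F \<longrightarrow>
        (\<exists>s :: nat \<Rightarrow> nat. strict_mono s \<and>
           ((\<exists>l. \<forall>K. compact K \<and> K \<subseteq> U \<longrightarrow> uniform_limit K (\<lambda>n. g (s n)) l sequentially) \<or>
            (\<forall>K. compact K \<and> K \<subseteq> U \<longrightarrow>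
               (\<forall>B :: real. \<forall>\<^sub>F n in sequentially. \<forall>z\<in>K. norm (g (s n) z) > B)))))"

definition Fatou_set :: "(complex \<Rightarrow> complex) \<Rightarrow> complex set" where
  "Fatou_set f =
     {z. \<exists>U. open U \<and> connected U \<and> z \<in> U \<and> normal_family_on (range (\<lambda>n :: nat. f ^^ n)) U}"

definition Julia_set :: "(complex \<Rightarrow> complex) \<Rightarrow> complex set" where
  "Julia_set f = - Fatou_set f"

definition escaping_set :: "(complex \<Rightarrow> complex) \<Rightarrow> complex set" where
  "escaping_set f = {z. filterlim (\<lambda>n :: nat. (f ^^ n) z) at_infinity sequentially}"

definition proximate_order :: "(real \<Rightarrow> real) \<Rightarrow> bool" where
  "proximate_order \<rho> \<longleftrightarrow>
     (\<forall>\<^sub>F r in at_top. \<rho> r > 0 \<and> \<rho> differentiable (at r)) \<and>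
     (\<exists>\<rho>0 > 0. (\<rho> \<longlongrightarrow> \<rho>0) at_top) \<and>
     ((\<lambda>r. deriv \<rho> r * r * ln r) \<longlongrightarrow> 0) at_top"

text \<open>
  \<open>1 / log\<^sup>N r\<close> with the \<open>N\<close>-th iterate (not power) of the logarithm; meaningful only for large \<open>r\<close>.
\<close>

definition iter_log_eps :: "nat \<Rightarrow> real \<Rightarrow> real" where
  "iter_log_eps N r = 1 / (ln ^^ N) r"

end

theory Submission
  imports Defs "HOL-Real_Asymp.Real_Asymp"
begin

text \<open>
  Work in logarithmic coordinates \<open>w = log z\<close>. There \<open>f\<close> becomes \<open>E w = f (exp w)\<close>, the exceptional
  rays become the horizontal lines \<open>Im w = \<theta>\<^sub>j + 2 \<pi> l\<close>, and the hypothesis says that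
  \<open>ln \<bar>E w\<bar>\<close> is close to \<open>h (Im w) \<phi> (Re w)\<close> away from these lines, where \<open>\<phi> x = r\<^bsup>\<rho>(r)\<^esup>\<close> with
  \<open>r = e\<^sup>x\<close>. A proximate order gives \<open>\<phi>' / \<phi> \<longrightarrow> \<rho>0 > 0\<close>, so that
  \<open>\<phi> (x + t) \<approx> \<phi> x e\<^bsup>\<rho>0 t\<^esup>\<close>.

  Between two consecutive lines \<open>E\<close> has a holomorphic logarithm \<open>L\<close>. Its rescalings at \<open>x \<longrightarrow> \<infinity>\<close> have
  real parts converging to \<open>h (Im w) e\<^bsup>\<rho>0 Re w\<^esup>\<close>, so the rescaled derivatives converge, and the limit
  inherits the scaling under real translations; hence it is a multiple of \<open>e\<^bsup>\<rho>0 w\<^esup>\<close>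
  (\<open>limit_log_deriv_exponential\<close>), and \<open>h\<close> is a sinusoid of frequency \<open>\<rho>0\<close> on each interval
  (\<open>h_trigonometric\<close>). This rigidity controls \<open>L\<close> close to the lines too: at distance \<open>\<eta>\<close> from
  them, with \<open>\<eta>\<close> large compared with the error \<open>\<epsilon>\<close>, the derivative \<open>L'\<close> is comparable to \<open>\<phi>\<close> and almost
  constant on discs of radius \<open>\<sigma> \<eta>\<^sup>2\<close>, while \<open>Re L\<close> is at least a constant times \<open>\<eta> \<phi>\<close>
  (\<open>good_log_exists\<close>).

  So one step of the dynamics maps such a disc almost affinely onto a huge region far to the right, of
  which only a proportion of order \<open>\<eta>\<close> is too close to the exceptional lines. Let the distance allowed at
  time \<open>k\<close> be \<open>\<eta>\<^sub>k = \<eta>0 / 2\<^sup>k\<close>; as the real parts grow like an iterated exponential, the errors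
  \<open>\<epsilon>\<close>, although they are reciprocals of iterated logarithms, stay far below \<open>\<eta>\<^sub>k\<close> (\<open>stages\<close>). The
  losses \<open>\<eta>\<^sub>k\<close> are summable, and induction on the number of steps shows that
  at least half of a suitable disc survives for ever (\<open>survivor_density\<close>). Each step of this
  induction rests on two facts: a Lipschitz map with constant \<open>M\<close> enlarges area by at most \<open>M\<^sup>2\<close>, and
  averaging turns a lower density bound on all small discs into one on a large disc.

  The surviving points escape by construction. If \<open>U\<close> is a neighbourhood of such a point, the
  expansion makes \<open>f\<^sup>n(U)\<close> contain, for all large \<open>n\<close>, a wide annulus around \<open>0\<close> with large radii. Every such
  annulus contains points where \<open>\<bar>f\<bar> \<le> 1\<close> (\<open>small_values_in_annuli\<close>): otherwise \<open>ln \<bar>f\<bar>\<close> would be a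
  positive harmonic function there, its circular means would be affine in \<open>log r\<close>, yet they are
  asymptotic to a positive multiple of \<open>r\<^bsup>\<rho>(r)\<^esup>\<close>. Therefore no sequence of
  iterates tends to infinity uniformly near a surviving point, and the point lies in the Julia set.
\<close>

section \<open>Nearly affine holomorphic maps and positive real parts\<close>

lemma cauchy_deriv_bound:
  assumes holo: "F holomorphic_on ball w R" and R: "R > 0"
    and bd: "\<And>z. z \<in> ball w R \<Longrightarrow> norm (F z) \<le> B"
  shows "norm (deriv F w) \<le> B / R"
proof -
  have "norm (deriv F w) * R \<le> B"
  proof (rule field_le_mult_one_interval)
    fix t :: real assume t: "0 < t" "t < 1"
    have sub: "cball w (t*R) \<subseteq> ball w R"
      using t R by (simp add: cball_subset_ball_iff)
    have "norm ((deriv ^^ 1) F w) \<le> fact 1 * B / (t*R) ^ 1"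
    proof (rule Cauchy_inequality)
      show "F holomorphic_on ball w (t*R)"
        by (rule holomorphic_on_subset[OF holo]) (use sub ball_subset_cball in blast)
      show "continuous_on (cball w (t*R)) F"
        by (rule holomorphic_on_imp_continuous_on, rule holomorphic_on_subset[OF holo sub])
      show "0 < t*R" using t R by simp
      fix x assume "norm (w - x) = t*R"
      then have "x \<in> cball w (t*R)" by (simp add: dist_norm)
      with sub show "norm (F x) \<le> B" by (intro bd) blast
    qed
    then show "t * (norm (deriv F w) * R) \<le> B"
      using t R by (simp add: field_simps)
  qed
  then show ?thesis using R by (simp add: field_simps)
qed

text \<open>
A Borel-Caratheodory inequality for the derivative: Cauchy's estimate is applied to the exponential
of \<open>g / M\<close>, whose modulus is controlled by the real part alone.
\<close>

lemma deriv_bound_by_real_part: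
  assumes holo: "g holomorphic_on ball w R" and R: "R > 0" and M: "M > 0"
    and bd: "\<And>z. z \<in> ball w R \<Longrightarrow> \<bar>Re (g z)\<bar> \<le> M"
  shows "norm (deriv g w) \<le> exp 2 * M / R"
proof -
  define F where "F = (\<lambda>z. exp ((g z - g w) / of_real M))"
  have w: "w \<in> ball w R" using R by simp
  have holF: "F holomorphic_on ball w R"
    unfolding F_def using M by (intro holomorphic_intros holo) auto
  have "norm (deriv F w) \<le> exp 2 / R"
  proof (rule cauchy_deriv_bound[OF holF R])
    fix z assume z: "z \<in> ball w R"
    have "(Re (g z) - Re (g w)) / M \<le> 2"
      using bd[OF z] bd[OF w] M by (simp add: field_simps)
    then show "norm (F z) \<le> exp 2" by (simp add: F_def)
  qed
  moreover have "(F has_field_derivative (deriv g w / of_real M)) (at w)"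
    unfolding F_def using M
    by (auto intro!: derivative_eq_intros holomorphic_derivI[OF holo open_ball w])
  then have "deriv F w = deriv g w / of_real M" by (rule DERIV_imp_deriv)
  ultimately show ?thesis using M R by (simp add: norm_divide field_simps)
qed

text \<open>
Harnack's inequality for positive harmonic functions that are real parts. The Cayley transform
\<open>T\<close> maps the right half plane to the disc and \<open>L w\<close> to \<open>0\<close> (after removing its imaginary part), so
the Schwarz lemma applies.
\<close>

lemma harnack_right_half_plane:
  assumes holo: "L holomorphic_on ball w R" and R: "R > 0"
    and pos: "\<And>z. z \<in> ball w R \<Longrightarrow> Re (L z) > 0"
    and z: "dist w z \<le> R / 2"
  shows "Re (L z) \<le> 3 * Re (L w)"
proof -
  define u where "u = Re (L w)"
  define N where "N = (\<lambda>\<zeta>. L (w + of_real R * \<zeta>) - \<i> * of_real (Im (L w)))"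
  define T where "T = (\<lambda>\<zeta>. (N \<zeta> - of_real u) / (N \<zeta> + of_real u))"
  have u: "u > 0" using pos[of w] R by (simp add: u_def)
  have inb: "w + of_real R * \<zeta> \<in> ball w R" if "\<zeta> \<in> ball 0 1" for \<zeta>
  proof -
    have "dist w (w + of_real R * \<zeta>) = norm (of_real R * \<zeta>)"
      by (metis add_diff_cancel_left' dist_commute dist_norm)
    then show ?thesis using that R by (simp add: norm_mult)
  qed
  have ReN: "Re (N \<zeta>) > 0" if "\<zeta> \<in> ball 0 1" for \<zeta>
    using pos[OF inb[OF that]] by (simp add: N_def)
  have ne: "N \<zeta> + of_real u \<noteq> 0" if "\<zeta> \<in> ball 0 1" for \<zeta>
    using ReN[OF that] u by (auto simp: complex_eq_iff)
  have "(L \<circ> (\<lambda>\<zeta>. w + of_real R * \<zeta>)) holomorphic_on ball 0 1"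
    by (rule holomorphic_on_compose_gen[OF _ holo])
       (use inb in \<open>auto intro!: holomorphic_intros simp del: mem_ball\<close>)
  then have holN: "N holomorphic_on ball 0 1"
    unfolding N_def o_def by (intro holomorphic_intros)
  have holT: "T holomorphic_on ball 0 1"
    unfolding T_def using ne by (intro holomorphic_intros holN) auto
  have "N 0 = of_real u" by (simp add: N_def u_def complex_eq_iff)
  then have T0: "T 0 = 0" by (simp add: T_def)
  have lt: "norm (T \<zeta>) < 1" if "norm \<zeta> < 1" for \<zeta>
  proof -
    have z: "\<zeta> \<in> ball 0 1" using that by simp
    have "(norm (N \<zeta> - of_real u))\<^sup>2 < (norm (N \<zeta> + of_real u))\<^sup>2"
      unfolding cmod_power2 using mult_pos_pos[OF ReN[OF z] u] by (simp add: power2_eq_square algebra_simps)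
    then have "norm (N \<zeta> - of_real u) < norm (N \<zeta> + of_real u)"
      by (rule power_less_imp_less_base) simp
    then show ?thesis using ne[OF z] by (simp add: T_def norm_divide)
  qed
  define \<zeta> where "\<zeta> = (z - w) / of_real R"
  have z1: "norm \<zeta> \<le> 1/2"
    using z R by (simp add: \<zeta>_def norm_divide field_simps dist_norm norm_minus_commute)
  then have zb: "\<zeta> \<in> ball 0 1" by simp
  have "norm (T \<zeta>) \<le> norm \<zeta>"
    by (rule Schwarz_Lemma(1)[OF holT T0 lt]) (use z1 in auto)
  with z1 have "norm (T \<zeta>) \<le> 1/2" by simp
  then have "2 * norm (N \<zeta> - of_real u) \<le> norm (N \<zeta> + of_real u)"
    using ne[OF zb] by (simp add: T_def norm_divide field_simps)
  moreover have "norm (N \<zeta> + of_real u) \<le> norm (N \<zeta>) + u"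
    using norm_triangle_ineq[of "N \<zeta>" "of_real u"] u by simp
  moreover have "norm (N \<zeta>) - u \<le> norm (N \<zeta> - of_real u)"
    using norm_triangle_ineq2[of "N \<zeta>" "of_real u"] u by simp
  ultimately have "norm (N \<zeta>) \<le> 3 * u" by linarith
  moreover have "Re (N \<zeta>) = Re (L z)" using R by (simp add: N_def \<zeta>_def)
  ultimately show ?thesis using complex_Re_le_cmod[of "N \<zeta>"] by (simp add: u_def)
qed

text \<open>
A map whose derivative stays within relative distance \<open>\<tau>\<close> of a constant \<open>c\<close> distorts distances like
multiplication by \<open>c\<close>, since \<open>L z - c z\<close> has a small Lipschitz constant.
\<close>

lemma nearly_affine:
  assumes holo: "L holomorphic_on ball w s"
    and d: "\<And>z. z \<in> ball w s \<Longrightarrow> norm (deriv L z - c) \<le> \<tau> * norm c"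
    and x: "x \<in> ball w s" "y \<in> ball w s"
  shows "norm (L x - L y) \<le> (1 + \<tau>) * norm c * norm (x - y)"
    and "(1 - \<tau>) * norm c * norm (x - y) \<le> norm (L x - L y)"
proof -
  have "norm ((L x - c * x) - (L y - c * y)) \<le> \<tau> * norm c * norm (x - y)"
  proof (rule field_differentiable_bound[OF convex_ball])
    fix z assume z: "z \<in> ball w s"
    show "((\<lambda>z. L z - c * z) has_field_derivative (deriv L z - c)) (at z within ball w s)"
      by (rule has_field_derivative_at_within)
         (auto intro!: derivative_eq_intros holomorphic_derivI[OF holo open_ball z])
    show "norm (deriv L z - c) \<le> \<tau> * norm c" using d[OF z] .
  qed (use x in auto)
  then have *: "norm ((L x - L y) - c * (x - y)) \<le> \<tau> * norm c * norm (x - y)"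
    by (simp add: algebra_simps)
  have "norm (L x - L y) \<le> norm (c * (x - y)) + norm ((L x - L y) - c * (x - y))"
    by (metis add.commute diff_add_cancel norm_triangle_ineq)
  with * have "norm (L x - L y) \<le> norm c * norm (x - y) + \<tau> * norm c * norm (x - y)"
    unfolding norm_mult by linarith
  then show "norm (L x - L y) \<le> (1 + \<tau>) * norm c * norm (x - y)"
    by (simp add: ring_distribs)
  have "norm (c * (x - y)) \<le> norm (L x - L y) + norm ((L x - L y) - c * (x - y))"
    by (metis norm_minus_commute norm_triangle_sub)
  with * have "norm c * norm (x - y) - \<tau> * norm c * norm (x - y) \<le> norm (L x - L y)"
    unfolding norm_mult by linarith
  then show "(1 - \<tau>) * norm c * norm (x - y) \<le> norm (L x - L y)"
    by (simp add: left_diff_distrib)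
qed

text \<open>
The lower distance estimate keeps the image of the boundary circle away from the image of the centre,
and an open map then covers the disc in between. Radii slightly smaller than \<open>s\<close> are used because \<open>L\<close> is
only defined on the open disc.
\<close>

lemma nearly_affine_covers_ball:
  assumes holo: "L holomorphic_on ball w s" and s: "s > 0" and c: "c \<noteq> 0" and \<tau>: "\<tau> < 1"
    and d: "\<And>z. z \<in> ball w s \<Longrightarrow> norm (deriv L z - c) \<le> \<tau> * norm c"
  shows "ball (L w) ((1 - \<tau>) * norm c * s) \<subseteq> L ` ball w s"
proof
  fix a assume a: "a \<in> ball (L w) ((1 - \<tau>) * norm c * s)"
  define K where "K = (1 - \<tau>) * norm c"
  have K: "K > 0" using \<tau> c by (simp add: K_def)
  have "dist (L w) a / K < s" using a K by (simp add: K_def field_simps)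
  then obtain t where t: "dist (L w) a / K < t" "t < s" using dense by blast
  have t0: "t > 0" using t K by (meson divide_nonneg_pos le_less_trans zero_le_dist)
  have sub: "cball w t \<subseteq> ball w s" using t by auto
  have inj: "inj_on L (ball w s)"
  proof (rule inj_onI)
    fix x y assume xy: "x \<in> ball w s" "y \<in> ball w s" "L x = L y"
    have "K * norm (x - y) \<le> norm (L x - L y)"
      unfolding K_def by (rule nearly_affine(2)[OF holo d xy(1,2)])
    with xy(3) K show "x = y" by (simp add: mult_le_0_iff)
  qed
  have "ball (L w) (K * t) \<subseteq> L ` ball w t"
  proof (rule ball_subset_open_map_image)
    show "continuous_on (closure (ball w t)) L"
      using t0 holomorphic_on_imp_continuous_on[OF holo] sub continuous_on_subset by auto
    show "open (L ` interior (ball w t))"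
    proof -
      have "L holomorphic_on ball w t" using holo sub ball_subset_cball
        by (meson holomorphic_on_subset order_trans)
      moreover have "inj_on L (ball w t)" using inj sub ball_subset_cball
        by (meson inj_on_subset order_trans)
      ultimately show ?thesis by (simp add: open_mapping_thm3)
    qed
    show "K * t \<le> norm (L z - L w)" if "z \<in> frontier (ball w t)" for z
    proof -
      have "dist w z = t" using that t0 by (simp add: sphere_def)
      then show ?thesis
        using nearly_affine(2)[OF holo d, of z w] t s by (simp add: K_def dist_norm norm_minus_commute)
    qed
  qed (use t0 K in auto)
  moreover have "a \<in> ball (L w) (K * t)" using t K by (simp add: field_simps)
  ultimately show "a \<in> L ` ball w s" using t by auto
qed

section \<open>Area estimates in the plane\<close>

text \<open>
A neighbourhood of \<open>S\<close> with almost the same area is filled by disjoint discs up to a null set (Vitali); the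
image of a disc of radius \<open>r\<close> lies in one of radius \<open>M r\<close>, and Lipschitz maps preserve null sets.
\<close>

lemma area_Lipschitz_image_le:
  fixes g :: "complex \<Rightarrow> complex"
  assumes S: "S \<in> lmeasurable" and T: "T \<in> lmeasurable" and D: "open D" "S \<subseteq> D"
    and TS: "T \<subseteq> g ` S" and M: "M > 0"
    and lip: "\<And>x y. x \<in> D \<Longrightarrow> y \<in> D \<Longrightarrow> norm (g x - g y) \<le> M * norm (x - y)"
  shows "measure lebesgue T \<le> M\<^sup>2 * measure lebesgue S"
proof (rule field_le_epsilon)
  fix e :: real assume e: "e > 0"
  define e' where "e' = e / M\<^sup>2"
  have e': "e' > 0" using e M by (simp add: e'_def)
  obtain U where U: "open U" "S \<subseteq> U" "U - S \<in> lmeasurable" "emeasure lebesgue (U - S) < ennreal e'"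
    using sets_lebesgue_outer_open[OF fmeasurableD[OF S] e'] by metis
  define V where "V = U \<inter> D"
  have oV: "open V" and SV: "S \<subseteq> V" using U D by (auto simp: V_def)
  have US: "U = S \<union> (U - S)" using U by blast
  then have Um: "U \<in> lmeasurable" using fmeasurable.Un[OF S U(3)] by simp
  have "measure lebesgue U = measure lebesgue S + measure lebesgue (U - S)"
    using measure_Un2[OF S Um] U(2) by (simp add: Un_absorb1)
  also have "measure lebesgue (U - S) < e'"
    using U(3,4) e' by (simp add: emeasure_eq_measure2 ennreal_less_iff)
  finally have mU: "measure lebesgue U < measure lebesgue S + e'" by simp
  have Vm: "V \<in> lmeasurable"
    using Um oV by (auto intro: fmeasurableI2[of U] simp: V_def)
  have mV: "measure lebesgue V \<le> measure lebesgue S + e'"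
    using mU measure_mono_fmeasurable[OF _ fmeasurableD[OF Vm] Um] by (auto simp: V_def)
  define K where "K = {i :: complex \<times> real. 0 < snd i \<and> ball (fst i) (snd i) \<subseteq> V}"
  obtain C where C: "countable C" "C \<subseteq> K"
     "pairwise (\<lambda>i j. disjnt (ball (fst i) (snd i)) (ball (fst j) (snd j))) C"
     "negligible (V - (\<Union>i \<in> C. ball (fst i) (snd i)))"
  proof (rule Vitali_covering_theorem_balls[of V K fst snd])
    fix x :: complex and d :: real assume x: "x \<in> V" "0 < d"
    obtain r where r: "r > 0" "ball x r \<subseteq> V" using oV x by (meson openE)
    have "(x, min r (d/2)) \<in> K" using r x by (auto simp: K_def)
    moreover have "x \<in> ball x (min r (d/2))" "min r (d/2) < d" using r x by auto
    ultimately show "\<exists>i. i \<in> K \<and> x \<in> ball (fst i) (snd i) \<and> snd i < d"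
      by (metis fst_conv snd_conv)
  qed
  define N where "N = V - (\<Union>i \<in> C. ball (fst i) (snd i))"
  have negN: "negligible (g ` N)"
  proof (rule negligible_locally_Lipschitz_image)
    show "negligible N" using C(4) by (simp add: N_def)
    fix x assume "x \<in> N"
    then show "\<exists>T B. open T \<and> x \<in> T \<and> (\<forall>y \<in> N \<inter> T. norm (g y - g x) \<le> B * norm (y - x))"
      by (intro exI[of _ D] exI[of _ M]) (auto simp: N_def V_def intro: lip D)
  qed simp
  define W where "W = (\<Union>i\<in>C. ball (g (fst i)) (M * snd i))"
  have TW: "T \<subseteq> g ` N \<union> W"
  proof
    fix t assume "t \<in> T"
    then obtain x where x: "x \<in> S" "t = g x" using TS by blast
    show "t \<in> g ` N \<union> W"
    proof (cases "x \<in> N")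
      case False
      then obtain i where i: "i \<in> C" "x \<in> ball (fst i) (snd i)" using x SV by (auto simp: N_def)
      then have "snd i > 0" "ball (fst i) (snd i) \<subseteq> V" using C(2) by (auto simp: K_def)
      then have "fst i \<in> V" by (meson centre_in_ball subset_iff)
      then have "norm (g (fst i) - g x) \<le> M * norm (fst i - x)"
        using x D by (intro lip) (auto simp: V_def)
      also have "\<dots> < M * snd i" using i M by (simp add: dist_norm)
      finally show ?thesis using i x by (auto simp: W_def dist_norm)
    qed (use x in auto)
  qed
  have bnd: "measure lebesgue (\<Union>i\<in>I. ball (g (fst i)) (M * snd i)) \<le> M\<^sup>2 * measure lebesgue V"
    if I: "I \<subseteq> C" "finite I" for I
  proof -
    have nn: "snd i \<ge> 0" if "i \<in> I" for i using that I C(2) by (auto simp: K_def)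
    have "measure lebesgue (\<Union>i\<in>I. ball (g (fst i)) (M * snd i))
          \<le> (\<Sum>i\<in>I. measure lebesgue (ball (g (fst i)) (M * snd i)))"
      by (rule measure_UNION_le) (use I in auto)
    also have "\<dots> = (\<Sum>i\<in>I. M\<^sup>2 * measure lebesgue (ball (fst i) (snd i)))"
      using nn M by (intro sum.cong) (auto simp: content_ball power_mult_distrib)
    also have "\<dots> = M\<^sup>2 * (\<Sum>i\<in>I. measure lebesgue (ball (fst i) (snd i)))"
      by (simp add: sum_distrib_left)
    also have "(\<Sum>i\<in>I. measure lebesgue (ball (fst i) (snd i)))
        = measure lebesgue (\<Union>i\<in>I. ball (fst i) (snd i))"
      by (rule measure_UNION'[symmetric]) (use I C(3) in \<open>auto intro: pairwise_subset\<close>)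
    also have "\<dots> \<le> measure lebesgue V"
      using I C(2) Vm by (intro measure_mono_fmeasurable) (auto simp: K_def)
    finally show ?thesis using M by simp
  qed
  have Wm: "W \<in> lmeasurable" unfolding W_def
    by (rule fmeasurable_UN_bound[OF C(1) _ bnd]) auto
  have mW: "measure lebesgue W \<le> M\<^sup>2 * measure lebesgue V" unfolding W_def
    by (rule measure_UN_bound[OF C(1) _ bnd]) (auto simp:)
  have "measure lebesgue T \<le> measure lebesgue (W \<union> g ` N)"
    using TW by (intro measure_mono_fmeasurable fmeasurable.Un[OF Wm negligible_imp_measurable[OF negN]]
        fmeasurableD[OF T]) auto
  also have "\<dots> = measure lebesgue W"
    by (rule measure_Un_null_set) (use negN Wm negligible_iff_null_sets in auto)
  also have "\<dots> \<le> M\<^sup>2 * (measure lebesgue S + e')"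
    using mW mV M by (meson mult_left_mono order_trans zero_le_power2)
  also have "\<dots> = M\<^sup>2 * measure lebesgue S + e" using M by (simp add: e'_def field_simps)
  finally show "measure lebesgue T \<le> M\<^sup>2 * measure lebesgue S + e" .
qed

text \<open>
Averaging over the centres replaces a packing of the large disc by small ones: by Fubini, the integral
of the area of \<open>K \<inter> ball a s\<close> over \<open>a \<in> A\<close> counts each point of \<open>K\<close> in the large disc at most
with the weight of one small disc.
\<close>

lemma density_average:
  fixes K A :: "complex set"
  assumes K: "K \<in> sets borel" and A: "A \<in> sets borel" and s: "s > 0" and p: "p \<ge> 0"
    and AB: "\<And>a. a \<in> A \<Longrightarrow> ball a s \<subseteq> ball c R"
    and dens: "\<And>a. a \<in> A \<Longrightarrow> measure lebesgue (K \<inter> ball a s) \<ge> p * measure lebesgue (ball (0::complex) s)"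
  shows "measure lebesgue (K \<inter> ball c R) \<ge> p * measure lebesgue A"
proof -
  define v where "v = measure lebesgue (ball (0::complex) s)"
  have v: "v > 0" using s by (simp add: v_def)
  have eb: "emeasure lborel (ball a s) = ennreal v" for a :: complex
    using s by (simp add: v_def emeasure_ball content_ball)
  have Abdd: "A \<subseteq> ball c R" using AB s by (meson centre_in_ball subset_iff)
  have fin: "emeasure lborel X = ennreal (measure lebesgue X)" if "X \<in> sets borel" "X \<subseteq> ball c' R'"
    for X :: "complex set" and c' R'
  proof -
    have "emeasure lborel X \<le> emeasure lborel (ball c' R')"
      using that by (intro emeasure_mono) auto
    also have "\<dots> < \<infinity>" using emeasure_lborel_ball_finite by (metis infinity_ennreal_def)
    finally show ?thesis using that by (simp add: emeasure_eq_ennreal_measure)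
  qed
  define F where "F = (\<lambda>(a, y). indicator A a * indicator K y * indicator {q :: complex \<times> complex. dist (fst q) (snd q) < s} (a, y) :: ennreal)"
  have oD: "{q :: complex \<times> complex. dist (fst q) (snd q) < s} \<in> sets borel"
    by (intro borel_open open_Collect_less continuous_intros)
  have Fm: "F \<in> borel_measurable (lborel \<Otimes>\<^sub>M lborel)"
    unfolding F_def case_prod_beta prod.collapse using K A oD
    by (auto intro!: borel_measurable_times borel_measurable_indicator borel_measurable_indicator'
         simp: borel_prod[symmetric])
  have 1: "(\<integral>\<^sup>+a. \<integral>\<^sup>+y. F (a, y) \<partial>lborel \<partial>lborel) \<ge> (\<integral>\<^sup>+a. ennreal (p * v) * indicator A a \<partial>lborel)"
  proof (rule nn_integral_mono)
    fix a
    show "ennreal (p * v) * indicator A a \<le> (\<integral>\<^sup>+y. F (a, y) \<partial>lborel)"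
    proof (cases "a \<in> A")
      case True
      have "(\<integral>\<^sup>+y. F (a, y) \<partial>lborel) = (\<integral>\<^sup>+y. indicator (K \<inter> ball a s) y \<partial>lborel)"
        using True by (intro nn_integral_cong) (auto simp: F_def split: split_indicator)
      also have "\<dots> = ennreal (measure lebesgue (K \<inter> ball a s))"
        using K fin[of "K \<inter> ball a s" a s] by simp
      finally show ?thesis using dens[OF True] True by (simp add: v_def ennreal_leI)
    qed simp
  qed
  have 2: "(\<integral>\<^sup>+y. \<integral>\<^sup>+a. F (a, y) \<partial>lborel \<partial>lborel) \<le> (\<integral>\<^sup>+y. ennreal v * indicator (K \<inter> ball c R) y \<partial>lborel)"
  proof (rule nn_integral_mono)
    fix y
    have "(\<integral>\<^sup>+a. F (a, y) \<partial>lborel) \<le> (\<integral>\<^sup>+a. indicator (K \<inter> ball c R) y * indicator (ball y s) a \<partial>lborel)"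
    proof (rule nn_integral_mono)
      fix a show "F (a, y) \<le> indicator (K \<inter> ball c R) y * indicator (ball y s) a"
      proof (cases "a \<in> A \<and> y \<in> K \<and> dist a y < s")
        case True
        then have "y \<in> ball c R" using AB[of a] by (metis mem_ball subset_iff)
        with True show ?thesis by (simp add: F_def dist_commute)
      qed (auto simp: F_def split: split_indicator)
    qed
    also have "\<dots> = ennreal v * indicator (K \<inter> ball c R) y"
      by (subst nn_integral_cmult_indicator) (auto simp: eb mult.commute)
    finally show "(\<integral>\<^sup>+a. F (a, y) \<partial>lborel) \<le> ennreal v * indicator (K \<inter> ball c R) y" .
  qed
  have "ennreal (p * v) * emeasure lborel A = (\<integral>\<^sup>+a. ennreal (p * v) * indicator A a \<partial>lborel)"
    using A by (subst nn_integral_cmult_indicator) auto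
  also note 1
  also have "(\<integral>\<^sup>+a. \<integral>\<^sup>+y. F (a, y) \<partial>lborel \<partial>lborel) = (\<integral>\<^sup>+y. \<integral>\<^sup>+a. F (a, y) \<partial>lborel \<partial>lborel)"
    using lborel_pair.Fubini'[of "\<lambda>a y. F (a, y)"] Fm by (simp add: case_prod_beta)
  also note 2
  also have "(\<integral>\<^sup>+y. ennreal v * indicator (K \<inter> ball c R) y \<partial>lborel) = ennreal v * emeasure lborel (K \<inter> ball c R)"
    using K by (subst nn_integral_cmult_indicator) auto
  finally have "ennreal (p * v) * ennreal (measure lebesgue A)
      \<le> ennreal v * ennreal (measure lebesgue (K \<inter> ball c R))"
    using fin[OF A Abdd] fin[of "K \<inter> ball c R" c R] K by auto
  then have "p * v * measure lebesgue A \<le> v * measure lebesgue (K \<inter> ball c R)"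
    using p v by (simp flip: ennreal_mult)
  then show ?thesis using v by (simp add: mult.commute mult.left_commute)
qed

text \<open>
The disc meets at most \<open>(R + \<eta>) / \<pi> + 1 \<le> 3 R\<close> of the strips, and each of them is contained in a
rectangle with sides \<open>2 R\<close> and \<open>2 \<eta>\<close>.
\<close>

lemma area_horizontal_strips_le:
  fixes c :: complex and t :: real
  assumes R: "R \<ge> 1" and \<eta>: "0 < \<eta>" "\<eta> \<le> 1"
  defines "S \<equiv> {w \<in> ball c R. \<exists>l::int. \<bar>Im w - t - 2 * pi * of_int l\<bar> < \<eta>}"
  shows "measure lebesgue S \<le> 12 * \<eta> * R\<^sup>2"
proof -
  define lo where "lo = (Im c - t - R - \<eta>) / (2 * pi)"
  define hi where "hi = (Im c - t + R + \<eta>) / (2 * pi)"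
  define I where "I = {\<lceil>lo\<rceil>..\<lfloor>hi\<rfloor>}"
  define Q where "Q = (\<lambda>l::int. cbox (Complex (Re c - R) (t + 2 * pi * of_int l - \<eta>))
                              (Complex (Re c + R) (t + 2 * pi * of_int l + \<eta>)))"
  have Q: "measure lebesgue (Q l) = 4 * R * \<eta>" for l
    unfolding Q_def using R \<eta>
    by (simp add: content_cbox_if box_eq_empty Basis_complex_def inner_complex_def cbox_complex_of_real)
  have sub: "S \<subseteq> (\<Union>l\<in>I. Q l)"
  proof
    fix w assume "w \<in> S"
    then obtain l :: int where w: "dist c w < R" and l: "\<bar>Im w - t - 2 * pi * of_int l\<bar> < \<eta>"
      by (auto simp: S_def)
    have re: "\<bar>Re w - Re c\<bar> < R" and im: "\<bar>Im w - Im c\<bar> < R"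
      using w abs_Re_le_cmod[of "w - c"] abs_Im_le_cmod[of "w - c"]
      by (auto simp: dist_norm norm_minus_commute)
    have "lo \<le> of_int l" "of_int l \<le> hi"
      using l im by (auto simp: lo_def hi_def field_simps abs_if split: if_splits)
    then have "l \<in> I" by (simp add: I_def ceiling_le_iff le_floor_iff)
    moreover have "w \<in> Q l"
      using re l by (auto simp: Q_def in_cbox_complex_iff)
    ultimately show "w \<in> (\<Union>l\<in>I. Q l)" by blast
  qed
  have "real (card I) \<le> hi - lo + 1"
  proof -
    have "lo \<le> hi" using R \<eta> by (simp add: lo_def hi_def divide_right_mono)
    then show ?thesis unfolding I_def by simp linarith
  qed
  also have "hi - lo = (R + \<eta>) / pi"
    by (simp add: hi_def lo_def field_simps)
  also have "\<dots> \<le> 2 * R"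
  proof -
    have "R + \<eta> \<le> 2 * R" using R \<eta> by simp
    also have "\<dots> \<le> 2 * R * pi" using R pi_gt3 by simp
    finally show ?thesis by (simp add: field_simps)
  qed
  finally have card: "real (card I) \<le> 3 * R" using R by simp
  have Smeas: "S \<in> sets lebesgue"
  proof -
    have "S = ball c R \<inter> (\<Union>l::int. {w. \<bar>Im w - t - 2 * pi * of_int l\<bar> < \<eta>})" by (auto simp: S_def)
    also have "open \<dots>" by (intro open_Int open_ball open_UN ballI open_Collect_less continuous_intros)
    finally show ?thesis by simp
  qed
  have "measure lebesgue S \<le> measure lebesgue (\<Union>l\<in>I. Q l)"
    using sub Smeas by (intro measure_mono_fmeasurable fmeasurable.finite_UN) (auto simp: I_def Q_def)
  also have "\<dots> \<le> (\<Sum>l\<in>I. measure lebesgue (Q l))"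
    by (rule measure_UNION_le) (auto simp: I_def Q_def)
  also have "\<dots> = real (card I) * (4 * R * \<eta>)" by (simp add: Q)
  also have "\<dots> \<le> 3 * R * (4 * R * \<eta>)"
    using card R \<eta> by (intro mult_right_mono) auto
  finally show ?thesis by (simp add: power2_eq_square algebra_simps)
qed

section \<open>Iterated logarithms and proximate orders\<close>

lemma filterlim_iter_ln: "filterlim ((ln :: real \<Rightarrow> real) ^^ n) at_top at_top"
proof (induction n)
  case (Suc n)
  then show ?case using filterlim_compose[OF ln_at_top Suc] by (simp add: o_def)
qed (simp add: filterlim_ident id_def)

lemma eventually_iter_ln_gt: "\<forall>\<^sub>F x in at_top. c < ((ln :: real \<Rightarrow> real) ^^ n) x"
  using filterlim_iter_ln[of n] unfolding filterlim_at_top_dense by blast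

lemma iter_ln_mono: "\<exists>X. \<forall>x\<ge>X. \<forall>y\<ge>x. 0 < ((ln :: real \<Rightarrow> real) ^^ n) x \<and> (ln ^^ n) x \<le> (ln ^^ n) y"
proof (induction n)
  case 0
  show ?case by (intro exI[of _ 1]) auto
next
  case (Suc n)
  then obtain X :: real where X: "\<And>x y. x \<ge> X \<Longrightarrow> y \<ge> x \<Longrightarrow> 0 < (ln ^^ n) x \<and> (ln ^^ n) x \<le> (ln ^^ n) y"
    by blast
  have "\<forall>\<^sub>F x in at_top. (ln ^^ Suc n) x > (0::real)"
    by (rule eventually_iter_ln_gt)
  then obtain Y where Y: "\<And>x. x \<ge> Y \<Longrightarrow> (ln ^^ Suc n) x > (0::real)"
    unfolding eventually_at_top_linorder by blast
  show ?case
  proof (intro exI[of _ "max X Y"] allI impI conjI)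
    fix x y :: real assume x: "max X Y \<le> x" "x \<le> y"
    show "0 < (ln ^^ Suc n) x" using Y[of x] x by simp
    show "(ln ^^ Suc n) x \<le> (ln ^^ Suc n) y"
      using X[of x y] X[of y y] x by (simp add: ln_mono)
  qed
qed

lemma iter_ln_scale:
  assumes "c > 0"
  shows "\<exists>d>0. \<forall>\<^sub>F x in at_top. d * ((ln :: real \<Rightarrow> real) ^^ n) x \<le> (ln ^^ n) (c * x)"
proof (induction n)
  case 0
  show ?case using assms by (intro exI[of _ c]) auto
next
  case (Suc n)
  then obtain d :: real where d: "d > 0" and ev: "\<forall>\<^sub>F x in at_top. d * (ln ^^ n) x \<le> (ln ^^ n) (c * x)"
    by blast
  have "\<forall>\<^sub>F x in at_top. (ln ^^ n) x > (0::real)"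
    by (rule eventually_iter_ln_gt)
  moreover have "\<forall>\<^sub>F x in at_top. (ln ^^ Suc n) x > (-2 * ln d)"
    by (rule eventually_iter_ln_gt)
  ultimately have "\<forall>\<^sub>F x in at_top. 1/2 * (ln ^^ Suc n) x \<le> (ln ^^ Suc n) (c * x)"
    using ev
  proof eventually_elim
    case (elim x)
    have "ln (d * (ln ^^ n) x) \<le> ln ((ln ^^ n) (c * x))"
      using elim d by (intro ln_mono) auto
    moreover have "ln (d * (ln ^^ n) x) = ln d + ln ((ln ^^ n) x)"
      using elim d by (simp add: ln_mult)
    ultimately show ?case using elim by simp
  qed
  then show ?case by (intro exI[of _ "1/2"]) auto
qed

text \<open>
Along the tower \<open>x, e\<^bsup>a x\<^esup>, \<dots>\<close> an iterated logarithm at least doubles in each step, so its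
reciprocal decays geometrically. One logarithm turns the claim into a comparison of the iterates at
\<open>a x\<close> and at \<open>ln x\<close>; the first is at least a constant multiple of \<open>y = ln\<^sup>k x\<close>, the second is \<open>ln y\<close>.
\<close>

lemma iter_ln_exp_ge:
  assumes a: "a > 0"
  shows "\<forall>\<^sub>F x in at_top. 2 * ((ln :: real \<Rightarrow> real) ^^ n) x \<le> (ln ^^ n) (exp (a * x))"
proof (cases n)
  case 0
  have "\<forall>\<^sub>F x::real in at_top. 2 * x \<le> exp (a * x)" using a by real_asymp
  then show ?thesis using 0 by simp
next
  case (Suc k)
  obtain d :: real where d: "d > 0" and ev: "\<forall>\<^sub>F x in at_top. d * (ln ^^ k) x \<le> (ln ^^ k) (a * x)"
    using iter_ln_scale[OF a] by blast
  have "\<forall>\<^sub>F y::real in at_top. 2 * ln y \<le> d * y" using d by real_asymp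
  then have "\<forall>\<^sub>F x in at_top. 2 * ln ((ln ^^ k) x) \<le> d * (ln ^^ k) x"
    by (rule eventually_compose_filterlim[OF _ filterlim_iter_ln])
  with ev show ?thesis
  proof eventually_elim
    case (elim x)
    have "(ln ^^ n) (exp (a * x)) = (ln ^^ k) (a * x)"
      unfolding Suc funpow_Suc_right by simp
    with elim show ?case by (simp add: Suc)
  qed
qed

lemma abs_exp_minus_one_le:
  fixes D :: real assumes "\<bar>D\<bar> \<le> 1/2" shows "\<bar>exp D - 1\<bar> \<le> 2 * \<bar>D\<bar>"
proof (cases "D \<ge> 0")
  case True then show ?thesis using real_exp_bound_lemma[of D] assms by auto
next
  case False
  then have "exp D < 1" by simp
  with False exp_ge_add_one_self[of D] show ?thesis by linarith
qed

text \<open>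
Applied to \<open>\<phi> = exp \<circ> \<psi>\<close>, it says that \<open>\<phi>\<close> is locally almost an exponential function. It matters that
the error is proportional to \<open>\<bar>t\<bar>\<close>: near the exceptional lines the
estimate is used on discs of small radius, where the error is divided by that radius when passing
to derivatives.
\<close>

lemma exp_increment_approx:
  fixes \<psi> \<psi>' :: "real \<Rightarrow> real"
  assumes der: "\<forall>\<^sub>F x in at_top. (\<psi> has_real_derivative \<psi>' x) (at x)"
    and lim: "(\<psi>' \<longlongrightarrow> \<rho>0) at_top" and \<rho>0: "\<rho>0 > 0" and e: "e > 0" and A: "A > 0"
  shows "\<forall>\<^sub>F x in at_top. \<forall>t\<in>{-A..A}. \<bar>exp (\<psi> (x + t)) - exp (\<psi> x) * exp (\<rho>0 * t)\<bar> \<le> e * \<bar>t\<bar> * exp (\<psi> x)"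
proof -
  define e' where "e' = min (e / (2 * exp (\<rho>0 * A))) (1 / (2 * A))"
  have e': "e' > 0" "e' \<le> e / (2 * exp (\<rho>0 * A))" "e' \<le> 1 / (2 * A)" using e A by (auto simp: e'_def)
  have "\<forall>\<^sub>F x in at_top. \<bar>\<psi>' x - \<rho>0\<bar> < e'"
    using lim e'(1) by (auto simp: tendsto_iff dist_real_def)
  with der have "\<forall>\<^sub>F x in at_top. (\<psi> has_real_derivative \<psi>' x) (at x) \<and> \<bar>\<psi>' x - \<rho>0\<bar> < e'"
    by eventually_elim simp
  then obtain X where X: "\<And>x. x \<ge> X \<Longrightarrow> (\<psi> has_real_derivative \<psi>' x) (at x) \<and> \<bar>\<psi>' x - \<rho>0\<bar> < e'"
    unfolding eventually_at_top_linorder by blast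
  have "\<forall>\<^sub>F x in at_top. x \<ge> X + A" by (rule eventually_ge_at_top)
  then show ?thesis
  proof (rule eventually_mono)
    fix x assume elim: "X + A \<le> x"
    show "\<forall>t\<in>{-A..A}. \<bar>exp (\<psi> (x + t)) - exp (\<psi> x) * exp (\<rho>0 * t)\<bar> \<le> e * \<bar>t\<bar> * exp (\<psi> x)"
    proof
      fix t assume t: "t \<in> {-A..A}"
      define D where "D = \<psi> (x + t) - \<psi> x - \<rho>0 * t"
      have "norm ((\<psi> (x + t) - \<rho>0 * (x + t)) - (\<psi> x - \<rho>0 * x)) \<le> e' * norm ((x + t) - x)"
      proof (rule field_differentiable_bound[where S = "{X..}" and f = "\<lambda>z. \<psi> z - \<rho>0 * z" and f' = "\<lambda>z. \<psi>' z - \<rho>0"])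
        fix z assume z: "z \<in> {X..}"
        have "(\<psi> has_real_derivative \<psi>' z) (at z)" using X[of z] z by blast
        from DERIV_diff[OF this DERIV_cmult_Id]
        show "((\<lambda>z. \<psi> z - \<rho>0 * z) has_real_derivative (\<psi>' z - \<rho>0)) (at z within {X..})"
          by (rule has_field_derivative_at_within)
        show "norm (\<psi>' z - \<rho>0) \<le> e'" using X[of z] z by (simp add: less_imp_le)
      next
        show "convex {X..}" by (rule convex_real_interval)
        show "x + t \<in> {X..}" "x \<in> {X..}" using t elim A by simp_all
      qed
      then have D: "\<bar>D\<bar> \<le> e' * \<bar>t\<bar>" by (simp add: D_def algebra_simps)
      also have "e' * \<bar>t\<bar> \<le> 1 / (2 * A) * A" using e' t A by (intro mult_mono) auto
      finally have "\<bar>D\<bar> \<le> 1/2" using A by simp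
      then have "\<bar>exp D - 1\<bar> \<le> 2 * \<bar>D\<bar>" by (rule abs_exp_minus_one_le)
      also have "\<dots> \<le> 2 * (e / (2 * exp (\<rho>0 * A)) * \<bar>t\<bar>)"
        using D e'(2) by (meson abs_ge_zero mult_left_mono mult_right_mono order_trans zero_le_numeral)
      finally have E: "exp (\<rho>0 * A) * \<bar>exp D - 1\<bar> \<le> e * \<bar>t\<bar>" by (simp add: field_simps)
      have "exp (\<psi> (x + t)) - exp (\<psi> x) * exp (\<rho>0 * t) = exp (\<psi> x) * (exp (\<rho>0 * t) * (exp D - 1))"
        by (simp add: D_def right_diff_distrib flip: exp_add)
      then have "\<bar>exp (\<psi> (x + t)) - exp (\<psi> x) * exp (\<rho>0 * t)\<bar> = exp (\<psi> x) * (exp (\<rho>0 * t) * \<bar>exp D - 1\<bar>)"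
        by (simp add: abs_mult)
      also have "\<dots> \<le> exp (\<psi> x) * (exp (\<rho>0 * A) * \<bar>exp D - 1\<bar>)"
        using t \<rho>0 by (intro mult_left_mono mult_right_mono) auto
      also have "\<dots> \<le> exp (\<psi> x) * (e * \<bar>t\<bar>)" using E by simp
      finally show "\<bar>exp (\<psi> (x + t)) - exp (\<psi> x) * exp (\<rho>0 * t)\<bar> \<le> e * \<bar>t\<bar> * exp (\<psi> x)"
        by (simp add: mult.commute mult.left_commute)
    qed
  qed
qed

text \<open>
With \<open>r = e\<^sup>x\<close>, the logarithm of \<open>r\<^bsup>\<rho>(r)\<^esup>\<close> is \<open>x \<rho>(e\<^sup>x)\<close>; its derivative is
\<open>\<rho>(r) + \<rho>'(r) r ln r\<close>.
\<close>

lemma proximate_order_log_derivative: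
  assumes "proximate_order \<rho>"
  obtains \<rho>0 \<psi>' where "\<rho>0 > 0" "(\<rho> \<longlongrightarrow> \<rho>0) at_top"
    "\<forall>\<^sub>F x in at_top. ((\<lambda>x. x * \<rho> (exp x)) has_real_derivative \<psi>' x) (at x)" "(\<psi>' \<longlongrightarrow> \<rho>0) at_top"
proof -
  obtain \<rho>0 where \<rho>0: "\<rho>0 > 0" "(\<rho> \<longlongrightarrow> \<rho>0) at_top" using assms by (auto simp: proximate_order_def)
  have dif: "\<forall>\<^sub>F r in at_top. \<rho> differentiable (at r)"
    using assms by (auto simp: proximate_order_def elim: eventually_mono)
  have lim: "((\<lambda>r. deriv \<rho> r * r * ln r) \<longlongrightarrow> 0) at_top" using assms by (simp add: proximate_order_def)
  define \<psi>' where "\<psi>' = (\<lambda>x. \<rho> (exp x) + deriv \<rho> (exp x) * exp x * ln (exp x))"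
  have "\<forall>\<^sub>F x in at_top. \<rho> differentiable (at (exp x))"
    by (rule eventually_compose_filterlim[OF dif exp_at_top])
  then have 1: "\<forall>\<^sub>F x in at_top. ((\<lambda>x. x * \<rho> (exp x)) has_real_derivative \<psi>' x) (at x)"
  proof eventually_elim
    case (elim x)
    then have d: "(\<rho> has_real_derivative deriv \<rho> (exp x)) (at (exp x))"
      by (simp add: DERIV_deriv_iff_real_differentiable)
    have "((\<lambda>x. \<rho> (exp x)) has_real_derivative deriv \<rho> (exp x) * exp x) (at x)"
      by (rule DERIV_chain2[OF d DERIV_exp])
    then show ?case unfolding \<psi>'_def
      by (auto intro!: derivative_eq_intros simp: algebra_simps)
  qed
  have "(\<psi>' \<longlongrightarrow> \<rho>0 + 0) at_top" unfolding \<psi>'_def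
    by (intro tendsto_add filterlim_compose[OF \<rho>0(2) exp_at_top] filterlim_compose[OF lim exp_at_top])
  with 1 \<rho>0 that show ?thesis by simp
qed

section \<open>Entire functions in logarithmic coordinates\<close>

text \<open>
The hypotheses of the theorem in the variable \<open>x = ln r\<close>, with \<open>\<phi> x = r\<^bsup>\<rho>(r)\<^esup>\<close> and \<open>\<epsilon> x = \<epsilon>(r)\<close>. Both
are kept abstract: what matters is how \<open>\<phi>\<close> scales under translations and how fast \<open>\<epsilon>\<close> decays along
towers of exponentials.
\<close>

locale regular_growth =
  fixes m :: nat and \<theta> :: "nat \<Rightarrow> real" and h \<phi> \<epsilon> :: "real \<Rightarrow> real"
    and f :: "complex \<Rightarrow> complex" and \<rho>0 C :: real
  assumes m_ge: "1 \<le> m"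
    and \<theta>_less: "\<And>j. j \<in> {1..m} \<Longrightarrow> \<theta> j < \<theta> (j + 1)"
    and \<theta>_period: "\<theta> (m + 1) = \<theta> 1 + 2 * pi"
    and h_cont: "continuous_on UNIV h"
    and h_pos: "\<And>j t. j \<in> {1..m} \<Longrightarrow> \<theta> j < t \<Longrightarrow> t < \<theta> (j + 1) \<Longrightarrow> h t > 0"
    and f_holo: "f holomorphic_on UNIV"
    and \<rho>0_pos: "\<rho>0 > 0" and C_nonneg: "C \<ge> 0"
    and \<phi>_pos: "\<And>x. \<phi> x > 0"
    and \<phi>_shift: "\<And>e A. e > 0 \<Longrightarrow> A > 0 \<Longrightarrow>
          \<forall>\<^sub>F x in at_top. \<forall>t\<in>{-A..A}. \<bar>\<phi> (x + t) - \<phi> x * exp (\<rho>0 * t)\<bar> \<le> e * \<bar>t\<bar> * \<phi> x"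
    and \<phi>_ge: "\<forall>\<^sub>F x in at_top. exp (\<rho>0 / 2 * x) \<le> \<phi> x"
    and \<epsilon>_pos: "\<forall>\<^sub>F x in at_top. 0 < \<epsilon> x"
    and \<epsilon>_lim: "(\<epsilon> \<longlongrightarrow> 0) at_top"
    and \<epsilon>_antimono: "\<exists>X. \<forall>x\<ge>X. \<forall>y\<ge>x. \<epsilon> y \<le> \<epsilon> x"
    and \<epsilon>_tower: "\<And>a. a > 0 \<Longrightarrow> \<forall>\<^sub>F x in at_top. \<epsilon> (exp (a * x)) \<le> \<epsilon> x / 2"
    and growth: "\<forall>\<^sub>F x in at_top. \<forall>t\<in>{\<theta> 1..\<theta> (m + 1)}. (\<forall>j\<in>{1..m + 1}. \<bar>t - \<theta> j\<bar> > \<epsilon> x) \<longrightarrow>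
          f (exp (Complex x t)) \<noteq> 0 \<and>
          \<bar>ln (norm (f (exp (Complex x t)))) - h t * \<phi> x\<bar> \<le> C * (\<phi> x * \<epsilon> x)"
begin

definition E :: "complex \<Rightarrow> complex" where "E w = f (exp w)"

text \<open>
The derivative of every local branch of \<open>log E\<close>. It does not depend on the choice of the branch, so its
values at different places can be compared directly.
\<close>

definition log_deriv :: "complex \<Rightarrow> complex" where "log_deriv w = deriv E w / E w"

definition sector :: "nat \<Rightarrow> complex set" where
  "sector j = {w. \<theta> j < Im w \<and> Im w < \<theta> (j + 1)}"

lemma E_holo: "E holomorphic_on A"
proof -
  have "(f \<circ> exp) holomorphic_on A"
    by (rule holomorphic_on_compose_gen[OF _ f_holo]) (auto intro: holomorphic_intros)
  then show ?thesis by (simp add: E_def[abs_def] o_def)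
qed

lemma holomorphic_on_shift:
  fixes F :: "complex \<Rightarrow> complex"
  assumes "F holomorphic_on UNIV" shows "(\<lambda>z. F (a + z)) holomorphic_on A"
proof -
  have "(F \<circ> (\<lambda>z. a + z)) holomorphic_on A"
    by (rule holomorphic_on_compose_gen[OF _ assms]) (auto intro: holomorphic_intros)
  then show ?thesis by (simp add: o_def)
qed

lemma \<theta>_mono: "1 \<le> i \<Longrightarrow> i \<le> j \<Longrightarrow> j \<le> m + 1 \<Longrightarrow> \<theta> i \<le> \<theta> j"
proof (induction j)
  case (Suc j)
  show ?case
  proof (cases "i = Suc j")
    case False
    then have "\<theta> i \<le> \<theta> j" using Suc by simp
    also have "\<theta> j < \<theta> (j + 1)" using Suc False by (intro \<theta>_less) auto
    finally show ?thesis by simp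
  qed simp
qed simp

lemma sector_growth:
  "\<exists>X. \<forall>w. \<forall>j\<in>{1..m}. Re w \<ge> X \<longrightarrow> \<theta> j + \<epsilon> (Re w) < Im w \<longrightarrow> Im w < \<theta> (j + 1) - \<epsilon> (Re w) \<longrightarrow>
      E w \<noteq> 0 \<and> \<bar>ln (norm (E w)) - h (Im w) * \<phi> (Re w)\<bar> \<le> C * (\<phi> (Re w) * \<epsilon> (Re w))"
proof -
  from growth \<epsilon>_pos obtain X where X: "\<And>x. x \<ge> X \<Longrightarrow> 0 < \<epsilon> x \<and> (\<forall>t\<in>{\<theta> 1..\<theta> (m + 1)}.
     (\<forall>j\<in>{1..m + 1}. \<bar>t - \<theta> j\<bar> > \<epsilon> x) \<longrightarrow> f (exp (Complex x t)) \<noteq> 0 \<and>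
          \<bar>ln (norm (f (exp (Complex x t)))) - h t * \<phi> x\<bar> \<le> C * (\<phi> x * \<epsilon> x))"
    using eventually_conj[OF \<epsilon>_pos growth] unfolding eventually_at_top_linorder by blast
  show ?thesis
  proof (intro exI[of _ X] allI ballI impI)
    fix w j assume w: "j \<in> {1..m}" "X \<le> Re w" "\<theta> j + \<epsilon> (Re w) < Im w" "Im w < \<theta> (j + 1) - \<epsilon> (Re w)"
    have eps: "0 < \<epsilon> (Re w)" using X w by blast
    have "\<theta> 1 \<le> \<theta> j" "\<theta> (j + 1) \<le> \<theta> (m + 1)" using w by (auto intro: \<theta>_mono)
    then have t: "Im w \<in> {\<theta> 1..\<theta> (m + 1)}" using w eps by auto
    have "\<bar>Im w - \<theta> i\<bar> > \<epsilon> (Re w)" if "i \<in> {1..m + 1}" for i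
    proof (cases "i \<le> j")
      case True
      then have "\<theta> i \<le> \<theta> j" using that w by (intro \<theta>_mono) auto
      then show ?thesis using w by linarith
    next
      case False
      then have "\<theta> (j + 1) \<le> \<theta> i" using that w by (intro \<theta>_mono) auto
      then show ?thesis using w by linarith
    qed
    with X[OF w(2)] t have "f (exp (Complex (Re w) (Im w))) \<noteq> 0 \<and>
       \<bar>ln (norm (f (exp (Complex (Re w) (Im w))))) - h (Im w) * \<phi> (Re w)\<bar> \<le> C * (\<phi> (Re w) * \<epsilon> (Re w))"
      by blast
    then show "E w \<noteq> 0 \<and> \<bar>ln (norm (E w)) - h (Im w) * \<phi> (Re w)\<bar> \<le> C * (\<phi> (Re w) * \<epsilon> (Re w))"
      unfolding E_def complex_surj .
  qed
qed

text \<open>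
The base point \<open>a\<close> is kept apart from the variable \<open>z\<close> because it tends to infinity in the rescaling
arguments, while \<open>z\<close> ranges over a fixed set \<open>A\<close>.
\<close>

lemma local_logarithm:
  assumes A: "convex A" "open A" "A \<noteq> {}" and nz: "\<And>z. z \<in> A \<Longrightarrow> E (a + z) \<noteq> 0"
  shows "\<exists>L. L holomorphic_on A \<and> (\<forall>z\<in>A. exp (L z) = E (a + z) \<and> Re (L z) = ln (norm (E (a + z))) \<and>
            (L has_field_derivative log_deriv (a + z)) (at z))"
proof -
  obtain z0 where z0: "z0 \<in> A" using A by blast
  have holo: "(\<lambda>z. E (a + z)) holomorphic_on A" by (rule holomorphic_on_shift[OF E_holo])
  obtain L where L: "L holomorphic_on A" "\<And>z. z \<in> A \<Longrightarrow> exp (L z) = E (a + z)"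
    using holomorphic_logarithm_exists[OF A(1,2) holo nz z0] by blast
  have re: "Re (L z) = ln (norm (E (a + z)))" if "z \<in> A" for z
    using L(2)[OF that, symmetric] by (simp add: norm_exp_eq_Re)
  have der: "(L has_field_derivative log_deriv (a + z)) (at z)" if z: "z \<in> A" for z
  proof -
    have dL: "(L has_field_derivative deriv L z) (at z)"
      by (rule holomorphic_derivI[OF L(1) A(2) z])
    then have "((\<lambda>z. exp (L z)) has_field_derivative exp (L z) * deriv L z) (at z)"
      by (auto intro!: derivative_eq_intros)
    then have 1: "((\<lambda>z. E (a + z)) has_field_derivative exp (L z) * deriv L z) (at z)"
      by (rule has_field_derivative_transform_within_open[OF _ A(2) z L(2)])
    have "(E has_field_derivative deriv E (a + z)) (at (a + z))"
      by (rule holomorphic_derivI[OF E_holo open_UNIV]) simp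
    moreover have "((\<lambda>z. a + z) has_field_derivative 1) (at z)"
      by (auto intro!: derivative_eq_intros)
    ultimately have 2: "((\<lambda>z. E (a + z)) has_field_derivative deriv E (a + z)) (at z)"
      using DERIV_chain2 by fastforce
    have "exp (L z) * deriv L z = deriv E (a + z)" by (rule DERIV_unique[OF 1 2])
    then have "deriv L z = log_deriv (a + z)" using L(2)[OF z] nz[OF z] by (simp add: log_deriv_def field_simps)
    with dL show ?thesis by simp
  qed
  show ?thesis using L re der by blast
qed

lemma h_bounded: "\<exists>H>0. \<forall>t\<in>{\<theta> 1..\<theta> (m + 1)}. \<bar>h t\<bar> \<le> H"
proof -
  have "compact (h ` {\<theta> 1..\<theta> (m + 1)})"
    by (intro compact_continuous_image continuous_on_subset[OF h_cont]) auto
  then have "bounded (h ` {\<theta> 1..\<theta> (m + 1)})" by (rule compact_imp_bounded)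
  then obtain H where "H > 0" "\<forall>t\<in>h ` {\<theta> 1..\<theta> (m + 1)}. norm t \<le> H" by (auto simp: bounded_pos)
  then show ?thesis by (intro exI[of _ H]) auto
qed

lemma sector_Im_range: "j \<in> {1..m} \<Longrightarrow> w \<in> sector j \<Longrightarrow> Im w \<in> {\<theta> 1..\<theta> (m + 1)}"
  using \<theta>_mono[of 1 j] \<theta>_mono[of "j+1" "m+1"] by (auto simp: sector_def)

lemma abs_Im_diff_le: "dist z w \<le> r \<Longrightarrow> \<bar>Im z - Im w\<bar> \<le> r"
  using abs_Im_le_cmod[of "z - w"] by (simp add: dist_norm)

lemma abs_Re_diff_le: "dist z w \<le> r \<Longrightarrow> \<bar>Re z - Re w\<bar> \<le> r"
  using abs_Re_le_cmod[of "z - w"] by (simp add: dist_norm)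

text \<open>
A compact disc in a sector keeps a positive distance from the exceptional lines, which eventually exceeds \<open>\<epsilon>\<close>.
Then the error of the hypothesis is \<open>O(\<epsilon>)\<close> relative to \<open>\<phi>\<close>, and \<open>\<phi> (x + t)\<close> is asymptotic to
\<open>\<phi> x e\<^bsup>\<rho>0 t\<^esup>\<close>.
\<close>

lemma scaled_log_limit:
  assumes j: "j \<in> {1..m}" and sub: "cball \<zeta>0 r \<subseteq> sector j" and r: "r \<ge> 0" and e: "e > 0"
  shows "\<forall>\<^sub>F x in at_top. \<forall>\<zeta>\<in>cball \<zeta>0 r. E (of_real x + \<zeta>) \<noteq> 0 \<and>
     \<bar>ln (norm (E (of_real x + \<zeta>))) / \<phi> x - h (Im \<zeta>) * exp (\<rho>0 * Re \<zeta>)\<bar> \<le> e"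
proof -
  obtain H where H: "H > 0" "\<And>t. t \<in> {\<theta> 1..\<theta> (m + 1)} \<Longrightarrow> \<bar>h t\<bar> \<le> H" using h_bounded by blast
  obtain X where X: "\<And>w. Re w \<ge> X \<Longrightarrow> \<theta> j + \<epsilon> (Re w) < Im w \<Longrightarrow> Im w < \<theta> (j + 1) - \<epsilon> (Re w) \<Longrightarrow>
      E w \<noteq> 0 \<and> \<bar>ln (norm (E w)) - h (Im w) * \<phi> (Re w)\<bar> \<le> C * (\<phi> (Re w) * \<epsilon> (Re w))"
    using sector_growth j by metis
  define A where "A = \<bar>Re \<zeta>0\<bar> + r + 1"
  have A: "A > 0" using r by (simp add: A_def add_nonneg_pos)
  define B where "B = exp (\<rho>0 * A) + 1"
  have B: "B > 0" by (simp add: B_def add_pos_pos)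
  define e1 where "e1 = min (1 / A) (e / (2 * H * A))"
  have e1: "e1 > 0" "e1 * A \<le> 1" "H * (e1 * A) \<le> e / 2"
    using A H e by (auto simp: e1_def min_def field_simps)
  \<comment> \<open>the distance of the disc from the two lines bounding the sector\<close>
  define d where "d = min (Im \<zeta>0 - r - \<theta> j) (\<theta> (j + 1) - (Im \<zeta>0 + r))"
  have d: "d > 0"
  proof -
    have "\<zeta>0 + Complex 0 r \<in> cball \<zeta>0 r" "\<zeta>0 - Complex 0 r \<in> cball \<zeta>0 r"
      using r by (auto simp: dist_norm cmod_def)
    then have "\<zeta>0 + Complex 0 r \<in> sector j" "\<zeta>0 - Complex 0 r \<in> sector j" using sub by blast+
    then show ?thesis by (auto simp: sector_def d_def)
  qed
  define C1 where "C1 = C + 1"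
  have C1: "C1 > 0" "C \<le> C1" using C_nonneg by (auto simp: C1_def)
  define e2 where "e2 = min (d / 2) (e / (2 * C1 * B))"
  have e2: "e2 > 0" "e2 < d" "C * (B * e2) \<le> e / 2"
  proof -
    show "e2 > 0" using d e C1 B by (simp add: e2_def)
    have "e2 \<le> d / 2" unfolding e2_def by (rule min.cobounded1)
    with d show "e2 < d" by simp
    have "C * (B * e2) \<le> C1 * (B * (e / (2 * C1 * B)))"
      using C_nonneg C1 B e d by (intro mult_mono) (auto simp: e2_def)
    also have "\<dots> = e / 2" using C1 B by (simp add: field_simps)
    finally show "C * (B * e2) \<le> e / 2" .
  qed
  have "\<forall>\<^sub>F x in at_top. \<epsilon> x < e2" using order_tendstoD(2)[OF \<epsilon>_lim e2(1)] .
  then have "\<forall>\<^sub>F x in at_top. 0 < \<epsilon> x \<and> \<epsilon> x < e2" using \<epsilon>_pos by eventually_elim simp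
  then obtain Y where Y: "\<And>x. x \<ge> Y \<Longrightarrow> 0 < \<epsilon> x \<and> \<epsilon> x < e2"
    unfolding eventually_at_top_linorder by blast
  have "\<forall>\<^sub>F x in at_top. x \<ge> max X Y + A" by (rule eventually_ge_at_top)
  then show ?thesis using \<phi>_shift[OF e1(1) A]
  proof eventually_elim
    case (elim x)
    show ?case
    proof
      fix \<zeta> assume z: "\<zeta> \<in> cball \<zeta>0 r"
      let ?w = "of_real x + \<zeta>" and ?t = "Re \<zeta>"
      have im: "\<bar>Im \<zeta> - Im \<zeta>0\<bar> \<le> r" and re: "\<bar>?t - Re \<zeta>0\<bar> \<le> r"
        using z abs_Im_diff_le abs_Re_diff_le by (auto simp: dist_commute)
      have tA: "?t \<in> {-A..A}" "\<bar>?t\<bar> \<le> A" using re by (auto simp: A_def)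
      have eps: "0 < \<epsilon> (x + ?t)" "\<epsilon> (x + ?t) < e2" using Y[of "x + ?t"] elim tA by auto
      have 1: "E ?w \<noteq> 0 \<and> \<bar>ln (norm (E ?w)) - h (Im \<zeta>) * \<phi> (x + ?t)\<bar> \<le> C * (\<phi> (x + ?t) * \<epsilon> (x + ?t))"
      proof -
        have "e2 < Im \<zeta>0 - r - \<theta> j" "e2 < \<theta> (j + 1) - (Im \<zeta>0 + r)" using e2(2) by (simp_all add: d_def)
        then have "\<theta> j + \<epsilon> (x + ?t) < Im \<zeta>" "Im \<zeta> < \<theta> (j + 1) - \<epsilon> (x + ?t)" using eps im by linarith+
        moreover have "X \<le> x + ?t" using elim tA by auto
        ultimately show ?thesis using X[of ?w] by simp
      qed
      have 2: "\<bar>\<phi> (x + ?t) - \<phi> x * exp (\<rho>0 * ?t)\<bar> \<le> e1 * \<bar>?t\<bar> * \<phi> x" using elim tA by blast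
      also have "\<dots> \<le> e1 * A * \<phi> x" using tA e1 \<phi>_pos[of x] by (intro mult_right_mono mult_left_mono) auto
      finally have 3: "\<bar>\<phi> (x + ?t) - \<phi> x * exp (\<rho>0 * ?t)\<bar> \<le> e1 * A * \<phi> x" .
      have 4: "\<phi> (x + ?t) \<le> B * \<phi> x"
      proof -
        have "\<phi> x * exp (\<rho>0 * ?t) \<le> \<phi> x * exp (\<rho>0 * A)"
          using tA \<rho>0_pos \<phi>_pos[of x] by (intro mult_left_mono) auto
        moreover have "e1 * A * \<phi> x \<le> 1 * \<phi> x" using e1 \<phi>_pos[of x] by (intro mult_right_mono) auto
        ultimately show ?thesis using 3 by (simp add: B_def algebra_simps)
      qed
      have hH: "\<bar>h (Im \<zeta>)\<bar> \<le> H" using z sub sector_Im_range[OF j] by (intro H) blast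
      have "\<bar>h (Im \<zeta>) * \<phi> (x + ?t) - h (Im \<zeta>) * exp (\<rho>0 * ?t) * \<phi> x\<bar>
          = \<bar>h (Im \<zeta>)\<bar> * \<bar>\<phi> (x + ?t) - \<phi> x * exp (\<rho>0 * ?t)\<bar>"
        by (simp add: algebra_simps flip: abs_mult)
      also have "\<dots> \<le> H * (e1 * A * \<phi> x)" using hH 3 H by (intro mult_mono) auto
      also have "\<dots> \<le> e / 2 * \<phi> x" using e1(3) \<phi>_pos[of x] by (simp add: mult.assoc[symmetric])
      finally have 5: "\<bar>h (Im \<zeta>) * \<phi> (x + ?t) - h (Im \<zeta>) * exp (\<rho>0 * ?t) * \<phi> x\<bar> \<le> e / 2 * \<phi> x" .
      have "C * (\<phi> (x + ?t) * \<epsilon> (x + ?t)) \<le> C * ((B * \<phi> x) * e2)"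
        using 4 eps C_nonneg \<phi>_pos[of "x + ?t"] \<phi>_pos[of x] B by (intro mult_left_mono mult_mono) auto
      also have "\<dots> = C * (B * e2) * \<phi> x" by simp
      also have "\<dots> \<le> e / 2 * \<phi> x" using e2(3) \<phi>_pos[of x] by (intro mult_right_mono) auto
      finally have "\<bar>ln (norm (E ?w)) - h (Im \<zeta>) * exp (\<rho>0 * ?t) * \<phi> x\<bar> \<le> e * \<phi> x"
        using 1 5 by linarith
      moreover have "ln (norm (E ?w)) / \<phi> x - h (Im \<zeta>) * exp (\<rho>0 * ?t)
          = (ln (norm (E ?w)) - h (Im \<zeta>) * exp (\<rho>0 * ?t) * \<phi> x) / \<phi> x"
        using \<phi>_pos[of x] by (simp add: field_simps)
      ultimately have "\<bar>ln (norm (E ?w)) / \<phi> x - h (Im \<zeta>) * exp (\<rho>0 * ?t)\<bar> \<le> e"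
        using \<phi>_pos[of x] by (simp add: abs_divide divide_le_eq)
      with 1 show "E ?w \<noteq> 0 \<and> \<bar>ln (norm (E ?w)) / \<phi> x - h (Im \<zeta>) * exp (\<rho>0 * Re \<zeta>)\<bar> \<le> e" by blast
    qed
  qed
qed

section \<open>The indicator is trigonometric between the exceptional rays\<close>

text \<open>
The derivative in \<open>\<zeta>\<close> of a branch of \<open>log E (x + \<zeta>) / \<phi> x\<close>, whose real part converges by \<open>scaled_log_limit\<close>.
\<close>

definition scaled_log_deriv :: "real \<Rightarrow> complex \<Rightarrow> complex" where
  "scaled_log_deriv x \<zeta> = log_deriv (of_real x + \<zeta>) / of_real (\<phi> x)"

lemma cball_double:
  assumes "\<zeta> \<in> cball \<zeta>0 r" shows "ball \<zeta> r \<subseteq> cball \<zeta>0 (2 * r)"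
proof
  fix z assume "z \<in> ball \<zeta> r"
  then show "z \<in> cball \<zeta>0 (2 * r)" using assms dist_triangle[of \<zeta>0 z \<zeta>] by simp
qed

text \<open>
The difference of two rescaled logarithms has a small real part, because both real parts are close to the
same limit; hence its derivative is small.
\<close>

lemma scaled_log_deriv_Cauchy:
  assumes j: "j \<in> {1..m}" and sub: "cball \<zeta>0 (2 * r) \<subseteq> sector j" and r: "r > 0" and e: "e > 0"
  shows "\<exists>X. \<forall>x\<ge>X. \<forall>x'\<ge>X. \<forall>\<zeta>\<in>cball \<zeta>0 r. norm (scaled_log_deriv x \<zeta> - scaled_log_deriv x' \<zeta>) \<le> e"
proof -
  define e1 where "e1 = e * r / (2 * exp 2)"
  have e1: "e1 > 0" using e r by (simp add: e1_def)
  obtain X where X: "\<And>x \<zeta>. x \<ge> X \<Longrightarrow> \<zeta> \<in> cball \<zeta>0 (2 * r) \<Longrightarrow> E (of_real x + \<zeta>) \<noteq> 0 \<and>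
     \<bar>ln (norm (E (of_real x + \<zeta>))) / \<phi> x - h (Im \<zeta>) * exp (\<rho>0 * Re \<zeta>)\<bar> \<le> e1"
    using scaled_log_limit[OF j sub _ e1] r unfolding eventually_at_top_linorder
    by (metis less_imp_le mult_nonneg_nonneg zero_le_numeral)
  show ?thesis
  proof (intro exI[of _ X] allI ballI impI)
    fix x x' \<zeta> assume x: "x \<ge> X" "x' \<ge> X" and z: "\<zeta> \<in> cball \<zeta>0 r"
    have sub2: "ball \<zeta> r \<subseteq> cball \<zeta>0 (2 * r)" by (rule cball_double[OF z])
    have ne: "ball \<zeta> r \<noteq> {}" using r by simp
    have nz1: "E (of_real x + z) \<noteq> 0" if "z \<in> ball \<zeta> r" for z
      using X[OF x(1), of z] sub2 that by blast
    have nz2: "E (of_real x' + z) \<noteq> 0" if "z \<in> ball \<zeta> r" for z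
      using X[OF x(2), of z] sub2 that by blast
    have zin: "\<zeta> \<in> ball \<zeta> r" using r by simp
    obtain L where L: "L holomorphic_on ball \<zeta> r"
      "\<And>z. z \<in> ball \<zeta> r \<Longrightarrow> exp (L z) = E (of_real x + z)"
      "\<And>z. z \<in> ball \<zeta> r \<Longrightarrow> Re (L z) = ln (norm (E (of_real x + z)))"
      "\<And>z. z \<in> ball \<zeta> r \<Longrightarrow> (L has_field_derivative log_deriv (of_real x + z)) (at z)"
      using local_logarithm[OF convex_ball open_ball ne nz1] by blast
    obtain L' where L': "L' holomorphic_on ball \<zeta> r"
      "\<And>z. z \<in> ball \<zeta> r \<Longrightarrow> exp (L' z) = E (of_real x' + z)"
      "\<And>z. z \<in> ball \<zeta> r \<Longrightarrow> Re (L' z) = ln (norm (E (of_real x' + z)))"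
      "\<And>z. z \<in> ball \<zeta> r \<Longrightarrow> (L' has_field_derivative log_deriv (of_real x' + z)) (at z)"
      using local_logarithm[OF convex_ball open_ball ne nz2] by blast
    define g where "g = (\<lambda>z. L z / of_real (\<phi> x) - L' z / of_real (\<phi> x'))"
    have "norm (deriv g \<zeta>) \<le> exp 2 * (2 * e1) / r"
    proof (rule deriv_bound_by_real_part[OF _ r])
      show "g holomorphic_on ball \<zeta> r" unfolding g_def
        using \<phi>_pos[of x] \<phi>_pos[of x'] by (intro holomorphic_intros L(1) L'(1)) auto
      show "2 * e1 > 0" using e1 by simp
      fix z assume z: "z \<in> ball \<zeta> r"
      with sub2 have z2: "z \<in> cball \<zeta>0 (2 * r)" by blast
      have "Re (g z) = ln (norm (E (of_real x + z))) / \<phi> x - ln (norm (E (of_real x' + z))) / \<phi> x'"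
        using L(3)[OF z] L'(3)[OF z] by (simp add: g_def)
      then show "\<bar>Re (g z)\<bar> \<le> 2 * e1" using X[OF x(1) z2] X[OF x(2) z2] by linarith
    qed
    moreover have "(g has_field_derivative scaled_log_deriv x \<zeta> - scaled_log_deriv x' \<zeta>) (at \<zeta>)"
      unfolding g_def scaled_log_deriv_def
      by (intro DERIV_diff DERIV_cdivide L(4) L'(4) zin)
    then have "deriv g \<zeta> = scaled_log_deriv x \<zeta> - scaled_log_deriv x' \<zeta>" by (rule DERIV_imp_deriv)
    ultimately show "norm (scaled_log_deriv x \<zeta> - scaled_log_deriv x' \<zeta>) \<le> e" using r by (simp add: e1_def)
  qed
qed

text \<open>
The limit along the integers is a convenient choice; \<open>scaled_log_deriv_limit\<close> shows that it is the limit
along all reals, locally uniformly.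
\<close>

definition limit_log_deriv :: "complex \<Rightarrow> complex" where "limit_log_deriv \<zeta> = lim (\<lambda>n. scaled_log_deriv (real n) \<zeta>)"

lemma scaled_log_deriv_limit:
  assumes j: "j \<in> {1..m}" and sub: "cball \<zeta>0 (2 * r) \<subseteq> sector j" and r: "r > 0"
  shows "uniform_limit (cball \<zeta>0 r) scaled_log_deriv limit_log_deriv at_top"
proof (rule uniform_limitI)
  fix e :: real assume "e > 0"
  then have e2: "e / 2 > 0" by simp
  have lim: "(\<lambda>n. scaled_log_deriv (real n) \<zeta>) \<longlonglongrightarrow> limit_log_deriv \<zeta>" if z: "\<zeta> \<in> cball \<zeta>0 r" for \<zeta>
  proof -
    have "Cauchy (\<lambda>n. scaled_log_deriv (real n) \<zeta>)"
    proof (rule metric_CauchyI)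
      fix d :: real assume "d > 0"
      then obtain X where X: "\<And>x x'. x \<ge> X \<Longrightarrow> x' \<ge> X \<Longrightarrow> norm (scaled_log_deriv x \<zeta> - scaled_log_deriv x' \<zeta>) \<le> d / 2"
        using scaled_log_deriv_Cauchy[OF j sub r, of "d/2"] z by (meson half_gt_zero)
      show "\<exists>M. \<forall>k\<ge>M. \<forall>n\<ge>M. dist (scaled_log_deriv (real k) \<zeta>) (scaled_log_deriv (real n) \<zeta>) < d"
      proof (intro exI[of _ "nat \<lceil>X\<rceil>"] allI impI)
        fix k n assume "nat \<lceil>X\<rceil> \<le> k" "nat \<lceil>X\<rceil> \<le> n"
        then have "norm (scaled_log_deriv (real k) \<zeta> - scaled_log_deriv (real n) \<zeta>) \<le> d / 2" by (intro X) linarith+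
        then show "dist (scaled_log_deriv (real k) \<zeta>) (scaled_log_deriv (real n) \<zeta>) < d" using \<open>d > 0\<close> by (simp add: dist_norm)
      qed
    qed
    then show ?thesis unfolding limit_log_deriv_def by (simp add: Cauchy_convergent_iff convergent_LIMSEQ_iff)
  qed
  obtain X where X: "\<And>x x' \<zeta>. x \<ge> X \<Longrightarrow> x' \<ge> X \<Longrightarrow> \<zeta> \<in> cball \<zeta>0 r \<Longrightarrow> norm (scaled_log_deriv x \<zeta> - scaled_log_deriv x' \<zeta>) \<le> e / 2"
    using scaled_log_deriv_Cauchy[OF j sub r e2] by blast
  have "\<forall>\<^sub>F x in at_top. x \<ge> X" by (rule eventually_ge_at_top)
  then show "\<forall>\<^sub>F x in at_top. \<forall>\<zeta>\<in>cball \<zeta>0 r. dist (scaled_log_deriv x \<zeta>) (limit_log_deriv \<zeta>) < e"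
  proof (rule eventually_mono, intro ballI)
    fix x \<zeta> assume x: "X \<le> x" and z: "\<zeta> \<in> cball \<zeta>0 r"
    have "(\<lambda>n. norm (scaled_log_deriv x \<zeta> - scaled_log_deriv (real n) \<zeta>)) \<longlonglongrightarrow> norm (scaled_log_deriv x \<zeta> - limit_log_deriv \<zeta>)"
      by (intro tendsto_intros lim z)
    moreover have "\<forall>\<^sub>F n in sequentially. norm (scaled_log_deriv x \<zeta> - scaled_log_deriv (real n) \<zeta>) \<le> e / 2"
      using eventually_ge_at_top[of "nat \<lceil>X\<rceil>"]
    proof (rule eventually_mono)
      fix n assume "nat \<lceil>X\<rceil> \<le> n" then show "norm (scaled_log_deriv x \<zeta> - scaled_log_deriv (real n) \<zeta>) \<le> e / 2"
        using x z by (intro X) linarith+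
    qed
    ultimately have "norm (scaled_log_deriv x \<zeta> - limit_log_deriv \<zeta>) \<le> e / 2"
      by (intro tendsto_upperbound) auto
    then show "dist (scaled_log_deriv x \<zeta>) (limit_log_deriv \<zeta>) < e" using \<open>e > 0\<close> by (simp add: dist_norm)
  qed
qed

lemma open_sector: "open (sector j)"
  unfolding sector_def by (intro open_Collect_conj open_Collect_less continuous_intros)

lemma convex_sector: "convex (sector j)"
proof -
  have "sector j = {w. \<theta> j < Im w} \<inter> {w. Im w < \<theta> (j + 1)}" by (auto simp: sector_def)
  then show ?thesis by (simp add: convex_Int convex_halfspace_Im_gt convex_halfspace_Im_lt)
qed

lemma sector_cball:
  assumes "\<zeta> \<in> sector j" obtains r where "r > 0" "cball \<zeta> (2 * r) \<subseteq> sector j"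
proof -
  obtain d where "d > 0" "cball \<zeta> d \<subseteq> sector j" using open_contains_cball open_sector assms by blast
  then show ?thesis by (intro that[of "d / 2"]) auto
qed

lemma scaled_log_deriv_tendsto:
  assumes j: "j \<in> {1..m}" and z: "\<zeta> \<in> sector j" shows "((\<lambda>x. scaled_log_deriv x \<zeta>) \<longlongrightarrow> limit_log_deriv \<zeta>) at_top"
proof -
  obtain r where "r > 0" "cball \<zeta> (2 * r) \<subseteq> sector j" using sector_cball[OF z] .
  then show ?thesis using tendsto_uniform_limitI[OF scaled_log_deriv_limit[OF j]] by simp
qed

lemma limit_log_deriv_holo: assumes j: "j \<in> {1..m}" shows "limit_log_deriv holomorphic_on sector j"
proof (rule holomorphic_on_open[OF open_sector, THEN iffD2], intro ballI)
  fix \<zeta> assume z: "\<zeta> \<in> sector j"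
  obtain r where r: "r > 0" "cball \<zeta> (2 * r) \<subseteq> sector j" using sector_cball[OF z] .
  have "\<forall>\<^sub>F x in at_top. continuous_on (cball \<zeta> r) (scaled_log_deriv x) \<and> scaled_log_deriv x holomorphic_on ball \<zeta> r"
  proof -
    have "cball \<zeta> r \<subseteq> cball \<zeta> (2 * r)" using r by auto
    have "\<forall>\<^sub>F x in at_top. \<forall>z\<in>cball \<zeta> (2*r). E (of_real x + z) \<noteq> 0"
      using scaled_log_limit[OF j r(2), of 1] r(1) by (auto elim!: eventually_mono)
    then show ?thesis
    proof (rule eventually_mono)
      fix x assume nz: "\<forall>z\<in>cball \<zeta> (2*r). E (of_real x + z) \<noteq> 0"
      have "scaled_log_deriv x holomorphic_on ball \<zeta> (2*r)"
      proof -
        have "deriv E holomorphic_on UNIV" by (rule holomorphic_deriv[OF E_holo open_UNIV])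
        note 1 = holomorphic_on_shift[OF E_holo] holomorphic_on_shift[OF this]
        show ?thesis unfolding scaled_log_deriv_def[abs_def] log_deriv_def
          using nz \<phi>_pos[of x] by (intro holomorphic_intros 1) auto
      qed
      moreover have "cball \<zeta> r \<subseteq> ball \<zeta> (2*r)" using r by auto
      ultimately show "continuous_on (cball \<zeta> r) (scaled_log_deriv x) \<and> scaled_log_deriv x holomorphic_on ball \<zeta> r"
        by (meson ball_subset_cball holomorphic_on_imp_continuous_on holomorphic_on_subset)
    qed
  qed
  then have "limit_log_deriv holomorphic_on ball \<zeta> r"
    by (rule holomorphic_uniform_limit[OF _ scaled_log_deriv_limit[OF j r(2,1)]]) simp_all
  then show "\<exists>f'. (limit_log_deriv has_field_derivative f') (at \<zeta>)"
    using r(1) by (metis centre_in_ball holomorphic_on_open open_ball)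
qed

text \<open>
The limit scales like \<open>e\<^bsup>\<rho>0 t\<^esup>\<close> under translation by a real \<open>t\<close>, because \<open>\<phi> (x + t) / \<phi> x\<close> tends to that factor.
\<close>

lemma limit_log_deriv_shift:
  assumes j: "j \<in> {1..m}" and z: "\<zeta> \<in> sector j"
  shows "limit_log_deriv (\<zeta> + of_real a) = exp (\<rho>0 * a) * limit_log_deriv \<zeta>"
proof -
  have z': "\<zeta> + of_real a \<in> sector j" using z by (simp add: sector_def)
  have 1: "((\<lambda>x. scaled_log_deriv x (\<zeta> + of_real a)) \<longlongrightarrow> limit_log_deriv (\<zeta> + of_real a)) at_top" by (rule scaled_log_deriv_tendsto[OF j z'])
  have "((\<lambda>x. \<phi> (x + a) / \<phi> x) \<longlongrightarrow> exp (\<rho>0 * a)) at_top"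
  proof (rule tendstoI)
    fix e :: real assume e: "e > 0"
    define A where "A = \<bar>a\<bar> + 1"
    define d where "d = e / (2 * A)"
    have d: "d > 0" and A: "A > 0" using e by (auto simp: d_def A_def add_nonneg_pos)
    from \<phi>_shift[OF d A] show "\<forall>\<^sub>F x in at_top. dist (\<phi> (x + a) / \<phi> x) (exp (\<rho>0 * a)) < e"
    proof (rule eventually_mono)
      fix x assume *: "\<forall>t\<in>{-A..A}. \<bar>\<phi> (x + t) - \<phi> x * exp (\<rho>0 * t)\<bar> \<le> d * \<bar>t\<bar> * \<phi> x"
      have "a \<in> {-A..A}" by (auto simp: A_def)
      with * have "\<bar>\<phi> (x + a) - \<phi> x * exp (\<rho>0 * a)\<bar> \<le> d * \<bar>a\<bar> * \<phi> x" by blast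
      also have "\<dots> \<le> d * A * \<phi> x" using d \<phi>_pos[of x] by (intro mult_right_mono mult_left_mono) (auto simp: A_def)
      also have "\<dots> = e / 2 * \<phi> x" using A by (simp add: d_def)
      finally have "\<bar>\<phi> (x + a) - \<phi> x * exp (\<rho>0 * a)\<bar> / \<phi> x \<le> e / 2"
        using \<phi>_pos[of x] by (simp add: divide_le_eq)
      moreover have "\<phi> (x + a) / \<phi> x - exp (\<rho>0 * a) = (\<phi> (x + a) - \<phi> x * exp (\<rho>0 * a)) / \<phi> x"
        using \<phi>_pos[of x] by (simp add: field_simps)
      then have "dist (\<phi> (x + a) / \<phi> x) (exp (\<rho>0 * a)) = \<bar>\<phi> (x + a) - \<phi> x * exp (\<rho>0 * a)\<bar> / \<phi> x"
        using \<phi>_pos[of x] by (simp add: dist_real_def abs_divide)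
      ultimately show "dist (\<phi> (x + a) / \<phi> x) (exp (\<rho>0 * a)) < e"
        using e by linarith
    qed
  qed
  then have "((\<lambda>x. complex_of_real (\<phi> (x + a) / \<phi> x)) \<longlongrightarrow> of_real (exp (\<rho>0 * a))) at_top"
    by (rule tendsto_of_real)
  moreover have "((\<lambda>x. scaled_log_deriv (x + a) \<zeta>) \<longlongrightarrow> limit_log_deriv \<zeta>) at_top"
  proof -
    have "filterlim (\<lambda>x. x + a) at_top at_top"
      by (rule filterlim_at_top_add_at_top[OF filterlim_ident, of "\<lambda>x. a"] filterlim_tendsto_add_at_top[OF tendsto_const filterlim_ident, of a, unfolded add.commute[of a]])
    from filterlim_compose[OF scaled_log_deriv_tendsto[OF j z] this] show ?thesis .
  qed
  ultimately have "((\<lambda>x. complex_of_real (\<phi> (x + a) / \<phi> x) * scaled_log_deriv (x + a) \<zeta>) \<longlongrightarrow> of_real (exp (\<rho>0 * a)) * limit_log_deriv \<zeta>) at_top"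
    by (rule tendsto_mult)
  moreover have "complex_of_real (\<phi> (x + a) / \<phi> x) * scaled_log_deriv (x + a) \<zeta> = scaled_log_deriv x (\<zeta> + of_real a)" for x
    using \<phi>_pos[of x] \<phi>_pos[of "x + a"] by (simp add: scaled_log_deriv_def algebra_simps)
  ultimately have 2: "((\<lambda>x. scaled_log_deriv x (\<zeta> + of_real a)) \<longlongrightarrow> of_real (exp (\<rho>0 * a)) * limit_log_deriv \<zeta>) at_top" by simp
  show ?thesis using tendsto_unique[OF _ 1 2] by simp
qed

text \<open>
Divided by \<open>e\<^bsup>\<rho>0 \<zeta>\<^esup>\<close> the limit is constant along a horizontal line, hence constant by the identity
theorem.
\<close>

lemma limit_log_deriv_exponential:
  assumes j: "j \<in> {1..m}"
  shows "\<exists>c. \<forall>\<zeta>\<in>sector j. limit_log_deriv \<zeta> = c * exp (of_real \<rho>0 * \<zeta>)"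
proof -
  define \<xi> where "\<xi> = Complex 0 ((\<theta> j + \<theta> (j + 1)) / 2)"
  have xi: "\<xi> \<in> sector j" using \<theta>_less[OF j] by (simp add: \<xi>_def sector_def)
  define k where "k = (\<lambda>\<zeta>. limit_log_deriv \<zeta> * exp (- of_real \<rho>0 * \<zeta>))"
  have holo: "(\<lambda>\<zeta>. k \<zeta> - k \<xi>) holomorphic_on sector j"
    unfolding k_def by (intro holomorphic_intros limit_log_deriv_holo j)
  have kshift: "k (\<xi> + of_real a) = k \<xi>" for a
    using limit_log_deriv_shift[OF j xi, of a]
    by (simp add: k_def exp_of_real[symmetric] algebra_simps exp_add exp_minus)
  have "k \<zeta> - k \<xi> = 0" if z: "\<zeta> \<in> sector j" for \<zeta>
  proof (rule analytic_continuation[OF holo open_sector])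
    show "connected (sector j)" by (rule convex_connected[OF convex_sector])
    show "range (\<lambda>a. \<xi> + of_real a) \<subseteq> sector j" using xi by (auto simp: sector_def)
    show "\<xi> islimpt range (\<lambda>a::real. \<xi> + of_real a)"
      unfolding islimpt_approachable
    proof (intro allI impI)
      fix e :: real assume "e > 0"
      then show "\<exists>x'\<in>range (\<lambda>a::real. \<xi> + of_real a). x' \<noteq> \<xi> \<and> dist x' \<xi> < e"
        by (intro bexI[of _ "\<xi> + of_real (e/2)"] rangeI) (auto simp: dist_norm)
    qed
    show "k z - k \<xi> = 0" if "z \<in> range (\<lambda>a::real. \<xi> + of_real a)" for z
      using that kshift by auto
  qed (use xi z in auto)
  then have "limit_log_deriv \<zeta> = k \<xi> * exp (of_real \<rho>0 * \<zeta>)" if "\<zeta> \<in> sector j" for \<zeta>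
    using that by (auto simp: k_def exp_minus field_simps)
  then show ?thesis by blast
qed

text \<open>
Let \<open>G\<close> be the primitive of the limit derivative that is itself a multiple of \<open>e\<^bsup>\<rho>0 \<zeta>\<^esup>\<close>. The rescaled logarithms
minus \<open>G\<close> have derivatives tending to \<open>0\<close>, so in the limit \<open>h (Im \<zeta>) e\<^bsup>\<rho>0 Re \<zeta>\<^esup> - Re (G \<zeta>)\<close> is the same at \<open>\<zeta>\<close>
and at \<open>\<zeta> + a\<close>. Since it is also multiplied by \<open>e\<^bsup>\<rho>0 a\<^esup> \<noteq> 1\<close> under this translation, it vanishes.
\<close>

lemma h_trigonometric:
  assumes j: "j \<in> {1..m}"
  shows "\<exists>b. \<forall>y. \<theta> j < y \<longrightarrow> y < \<theta> (j + 1) \<longrightarrow> h y = Re (b * exp (\<i> * of_real (\<rho>0 * y)))"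
proof -
  obtain c where c: "\<And>\<zeta>. \<zeta> \<in> sector j \<Longrightarrow> limit_log_deriv \<zeta> = c * exp (of_real \<rho>0 * \<zeta>)"
    using limit_log_deriv_exponential[OF j] by blast
  define G where "G = (\<lambda>z. c / of_real \<rho>0 * exp (of_real \<rho>0 * z))"
  have Gder: "(G has_field_derivative limit_log_deriv z) (at z)" if "z \<in> sector j" for z
    unfolding G_def c[OF that] using \<rho>0_pos by (auto intro!: derivative_eq_intros)
  have "h y = Re (c / of_real \<rho>0 * exp (\<i> * of_real (\<rho>0 * y)))" if y: "\<theta> j < y" "y < \<theta> (j + 1)" for y
  proof -
    define \<zeta> where "\<zeta> = Complex 0 y"
    have z: "\<zeta> \<in> sector j" using y by (simp add: \<zeta>_def sector_def)
    obtain r where r: "r > 0" "cball \<zeta> (2 * r) \<subseteq> sector j" using sector_cball[OF z] .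
    define a where "a = r / 2"
    have a: "a > 0" "a < r" using r by (auto simp: a_def)
    have zb: "\<zeta> \<in> ball \<zeta> r" "\<zeta> + of_real a \<in> ball \<zeta> r" using a by (auto simp: dist_norm)
    have sub: "ball \<zeta> r \<subseteq> cball \<zeta> r" "cball \<zeta> r \<subseteq> cball \<zeta> (2 * r)" using r by auto
    define D where "D = (h y - Re (G \<zeta>)) * (exp (\<rho>0 * a) - 1)"
    have D: "\<bar>D\<bar> \<le> e * (2 + a)" if e: "e > 0" for e
    proof -
      have "\<forall>\<^sub>F x in at_top. \<forall>z\<in>cball \<zeta> r. dist (scaled_log_deriv x z) (limit_log_deriv z) < e"
        by (rule uniform_limitD[OF scaled_log_deriv_limit[OF j r(2,1)] e])
      moreover note scaled_log_limit[OF j r(2) _ e]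
      ultimately have "\<forall>\<^sub>F x in at_top. (\<forall>z\<in>cball \<zeta> r. dist (scaled_log_deriv x z) (limit_log_deriv z) < e) \<and>
        (\<forall>z\<in>cball \<zeta> (2 * r). E (of_real x + z) \<noteq> 0 \<and>
           \<bar>ln (norm (E (of_real x + z))) / \<phi> x - h (Im z) * exp (\<rho>0 * Re z)\<bar> \<le> e)"
        using r(1) by (auto elim: eventually_elim2)
      then obtain x where x1: "\<And>z. z\<in>cball \<zeta> r \<Longrightarrow> dist (scaled_log_deriv x z) (limit_log_deriv z) < e"
        and x2: "\<And>z. z\<in>cball \<zeta> (2 * r) \<Longrightarrow> E (of_real x + z) \<noteq> 0"
        and x3: "\<And>z. z\<in>cball \<zeta> (2 * r) \<Longrightarrow> \<bar>ln (norm (E (of_real x + z))) / \<phi> x - h (Im z) * exp (\<rho>0 * Re z)\<bar> \<le> e"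
        using eventually_happens'[OF trivial_limit_at_top_linorder] by blast
      have ne: "ball \<zeta> r \<noteq> {}" using r by simp
      have nz: "E (of_real x + z) \<noteq> 0" if "z \<in> ball \<zeta> r" for z using x2 sub that by blast
      obtain L where L: "L holomorphic_on ball \<zeta> r"
      "\<And>z. z \<in> ball \<zeta> r \<Longrightarrow> exp (L z) = E (of_real x + z)"
        "\<And>z. z \<in> ball \<zeta> r \<Longrightarrow> Re (L z) = ln (norm (E (of_real x + z)))"
        "\<And>z. z \<in> ball \<zeta> r \<Longrightarrow> (L has_field_derivative log_deriv (of_real x + z)) (at z)"
        using local_logarithm[OF convex_ball open_ball ne nz] by blast
      define g where "g = (\<lambda>z. L z / of_real (\<phi> x) - G z)"
      have "norm (g (\<zeta> + of_real a) - g \<zeta>) \<le> e * norm ((\<zeta> + of_real a) - \<zeta>)"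
      proof (rule field_differentiable_bound[where S = "ball \<zeta> r" and f = g and f' = "\<lambda>z. scaled_log_deriv x z - limit_log_deriv z"])
        fix z assume z: "z \<in> ball \<zeta> r"
        have zs: "z \<in> sector j" using z sub r(2) by blast
        have "(g has_field_derivative scaled_log_deriv x z - limit_log_deriv z) (at z)"
          unfolding g_def scaled_log_deriv_def by (intro DERIV_diff DERIV_cdivide L(4) Gder z zs)
        then show "(g has_field_derivative scaled_log_deriv x z - limit_log_deriv z) (at z within ball \<zeta> r)"
          by (rule has_field_derivative_at_within)
        show "norm (scaled_log_deriv x z - limit_log_deriv z) \<le> e" using x1[of z] z sub by (force simp: dist_norm)
      qed (use zb in auto)
      then have "\<bar>Re (g (\<zeta> + of_real a)) - Re (g \<zeta>)\<bar> \<le> e * a"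
        using abs_Re_le_cmod[of "g (\<zeta> + of_real a) - g \<zeta>"] a by simp
      moreover have "Re (g z) = ln (norm (E (of_real x + z))) / \<phi> x - Re (G z)" if "z \<in> ball \<zeta> r" for z
        using L(3)[OF that] by (simp add: g_def)
      moreover have "\<bar>ln (norm (E (of_real x + \<zeta>))) / \<phi> x - h y\<bar> \<le> e"
        using x3[of \<zeta>] r by (simp add: \<zeta>_def)
      moreover have "\<bar>ln (norm (E (of_real x + (\<zeta> + of_real a)))) / \<phi> x - h y * exp (\<rho>0 * a)\<bar> \<le> e"
        using x3[of "\<zeta> + of_real a"] zb sub by (force simp: \<zeta>_def)
      moreover have "Re (G (\<zeta> + of_real a)) = exp (\<rho>0 * a) * Re (G \<zeta>)"
      proof -
        have "G (\<zeta> + of_real a) = of_real (exp (\<rho>0 * a)) * G \<zeta>"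
          by (simp add: G_def algebra_simps exp_add exp_of_real[symmetric])
        then show ?thesis by simp
      qed
      ultimately have "\<bar>(h y * exp (\<rho>0 * a) - exp (\<rho>0 * a) * Re (G \<zeta>)) - (h y - Re (G \<zeta>))\<bar> \<le> e * a + 2 * e"
        using zb by smt
      then show ?thesis by (simp add: D_def algebra_simps)
    qed
    have "D = 0"
    proof (rule ccontr)
      assume "D \<noteq> 0"
      define s where "s = 2 + a"
      have s: "s > 0" using a by (simp add: s_def)
      define e where "e = \<bar>D\<bar> / (2 * s)"
      have "e > 0" using \<open>D \<noteq> 0\<close> s by (simp add: e_def)
      from D[OF this] have "\<bar>D\<bar> \<le> e * s" unfolding s_def .
      also have "\<dots> = \<bar>D\<bar> / 2" using s by (simp add: e_def)
      finally have "\<bar>D\<bar> \<le> \<bar>D\<bar> / 2" .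
      with \<open>D \<noteq> 0\<close> show False by simp
    qed
    moreover have "exp (\<rho>0 * a) \<noteq> 1" using a \<rho>0_pos by simp
    ultimately have "h y = Re (G \<zeta>)" by (simp add: D_def)
    moreover have "of_real \<rho>0 * \<zeta> = \<i> * of_real (\<rho>0 * y)" by (simp add: \<zeta>_def complex_eq_iff)
    ultimately show ?thesis by (simp add: G_def)
  qed
  then show ?thesis by blast
qed

section \<open>Branches of the logarithm away from the exceptional rays\<close>

text \<open>
A positive sinusoid satisfies \<open>h'' = - \<rho>0\<^sup>2 h < 0\<close>, so \<open>h\<close> is concave on the interval and lies above its
chords. In particular \<open>h\<close> can vanish at an exceptional ray to first order at most.
\<close>

lemma h_distance_bound:
  assumes j: "j \<in> {1..m}"
  shows "\<exists>c>0. \<forall>y. \<theta> j < y \<longrightarrow> y < \<theta> (j + 1) \<longrightarrow> c * min (y - \<theta> j) (\<theta> (j + 1) - y) \<le> h y"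
proof -
  obtain b where b: "\<And>y. \<theta> j < y \<Longrightarrow> y < \<theta> (j + 1) \<Longrightarrow> h y = Re (b * exp (\<i> * of_real (\<rho>0 * y)))"
    using h_trigonometric[OF j] by blast
  define g where "g = (\<lambda>y. Re b * cos (\<rho>0 * y) - Im b * sin (\<rho>0 * y))"
  have hg: "h y = g y" if "\<theta> j < y" "y < \<theta> (j + 1)" for y
    using b[OF that] by (simp add: g_def Re_exp Im_exp)
  let ?I = "{\<theta> j<..<\<theta> (j + 1)}"
  have conc: "concave_on ?I g"
  proof (rule f''_le0_imp_concave)
    show "(g has_real_derivative - \<rho>0 * (Re b * sin (\<rho>0 * y) + Im b * cos (\<rho>0 * y))) (at y)" for y
      unfolding g_def by (auto intro!: derivative_eq_intros simp: algebra_simps)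
    show "((\<lambda>y. - \<rho>0 * (Re b * sin (\<rho>0 * y) + Im b * cos (\<rho>0 * y))) has_real_derivative - \<rho>0\<^sup>2 * g y) (at y)" for y
      unfolding g_def by (auto intro!: derivative_eq_intros simp: algebra_simps power2_eq_square)
    show "- \<rho>0\<^sup>2 * g y \<le> 0" if "y \<in> ?I" for y
      using hg[of y] h_pos[OF j, of y] that by simp
  qed simp
  define M where "M = (\<theta> j + \<theta> (j + 1)) / 2"
  have M: "\<theta> j < M" "M < \<theta> (j + 1)" using \<theta>_less[OF j] by (auto simp: M_def)
  have gM: "g M > 0" using h_pos[OF j M] hg[OF M] by simp
  define d where "d = M - \<theta> j"
  have d: "d > 0" using M by (simp add: d_def)
  \<comment> \<open>compare with the chord through the middle of the interval and a point half way to the endpoint\<close>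
  have chord: "s * g M \<le> g (s * M + (1 - s) * a)" if "a \<in> ?I" "0 \<le> s" "s \<le> 1" for a s
  proof -
    have "s * g M + (1 - s) * g a \<le> g ((1 - s) *\<^sub>R a + s *\<^sub>R M)"
      using concave_onD[OF conc, of s a M] that M by (simp add: algebra_simps)
    moreover have "g a > 0" using h_pos[OF j, of a] hg[of a] that by simp
    then have "(1 - s) * g a \<ge> 0" using that by simp
    ultimately show ?thesis by (simp add: add.commute)
  qed
  show ?thesis
  proof (intro exI[of _ "g M / (2 * d)"] conjI allI impI)
    show "g M / (2 * d) > 0" using gM d by simp
    fix y assume y: "\<theta> j < y" "y < \<theta> (j + 1)"
    define \<delta> where "\<delta> = min (y - \<theta> j) (\<theta> (j + 1) - y)"
    \<comment> \<open>starting the chord inside the open interval, at the price of a factor 2, avoids the values of h at the endpoints\<close>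
    define a where "a = (if y \<le> M then (\<theta> j + y) / 2 else (\<theta> (j + 1) + y) / 2)"
    define s where "s = \<bar>y - a\<bar> / \<bar>M - a\<bar>"
    have \<delta>: "0 < \<delta>" "\<delta> \<le> d" using y by (auto simp: \<delta>_def d_def M_def min_def)
    have a: "a \<in> ?I" using y by (auto simp: a_def)
    have ya: "\<bar>y - a\<bar> \<ge> \<delta> / 2" and Ma: "\<bar>M - a\<bar> \<le> d" "\<bar>M - a\<bar> > 0" "\<bar>y - a\<bar> \<le> \<bar>M - a\<bar>"
      using y M by (auto simp: a_def \<delta>_def d_def M_def min_def field_simps abs_if split: if_splits)
    have s: "0 \<le> s" "s \<le> 1" using Ma by (auto simp: s_def)
    have "\<delta> / 2 / d \<le> s" unfolding s_def using ya Ma \<delta> by (intro frac_le) auto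
    then have "\<delta> / (2 * d) * g M \<le> s * g M" using gM by (intro mult_right_mono) auto
    also have "s * M + (1 - s) * a = y"
    proof -
      have "s = (y - a) / (M - a)"
        using y M Ma by (cases "y \<le> M") (auto simp: s_def a_def abs_if field_simps split: if_splits)
      moreover have "M - a \<noteq> 0" using Ma by auto
      ultimately have "s * (M - a) = y - a" by simp
      then show ?thesis by (simp add: algebra_simps)
    qed
    with chord[OF a s] have "s * g M \<le> g y" by simp
    finally show "g M / (2 * d) * min (y - \<theta> j) (\<theta> (j + 1) - y) \<le> h y"
      using hg[OF y] by (simp add: \<delta>_def mult.commute)
  qed
qed

lemma sector_constants:
  "\<exists>b bmin bmax c. 0 < bmin \<and> 0 < c \<and> (\<forall>j\<in>{1..m}. bmin \<le> norm (b j) \<and> norm (b j) \<le> bmax \<and>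
      (\<forall>y. \<theta> j < y \<longrightarrow> y < \<theta> (j + 1) \<longrightarrow> h y = Re (b j * exp (\<i> * of_real (\<rho>0 * y))) \<and>
         c * min (y - \<theta> j) (\<theta> (j + 1) - y) \<le> h y))"
proof -
  have "\<exists>b. \<forall>j\<in>{1..m}. \<forall>y. \<theta> j < y \<longrightarrow> y < \<theta> (j + 1) \<longrightarrow> h y = Re (b j * exp (\<i> * of_real (\<rho>0 * y)))"
    by (rule bchoice) (use h_trigonometric in blast)
  then obtain b :: "nat \<Rightarrow> complex" where b: "\<And>j y. j \<in> {1..m} \<Longrightarrow> \<theta> j < y \<Longrightarrow> y < \<theta> (j + 1) \<Longrightarrow> h y = Re (b j * exp (\<i> * of_real (\<rho>0 * y)))"
    by blast
  have "\<exists>c. \<forall>j\<in>{1..m}. c j > 0 \<and> (\<forall>y. \<theta> j < y \<longrightarrow> y < \<theta> (j + 1) \<longrightarrow> c j * min (y - \<theta> j) (\<theta> (j + 1) - y) \<le> h y)"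
    by (rule bchoice) (use h_distance_bound in blast)
  then obtain c :: "nat \<Rightarrow> real" where c: "\<And>j. j \<in> {1..m} \<Longrightarrow> c j > 0"
    "\<And>j y. j \<in> {1..m} \<Longrightarrow> \<theta> j < y \<Longrightarrow> y < \<theta> (j + 1) \<Longrightarrow> c j * min (y - \<theta> j) (\<theta> (j + 1) - y) \<le> h y"
    by blast
  have b0: "norm (b j) > 0" if j: "j \<in> {1..m}" for j
  proof -
    obtain y where y: "\<theta> j < y" "y < \<theta> (j + 1)" using \<theta>_less[OF j] dense by blast
    have "b j \<noteq> 0" using b[OF j y] h_pos[OF j y] by auto
    then show ?thesis by simp
  qed
  have ne: "{1..m} \<noteq> {}" using m_ge by simp
  let ?c = "Min (c ` {1..m})"
  have "?c * min (y - \<theta> j) (\<theta> (j + 1) - y) \<le> h y" if "j \<in> {1..m}" "\<theta> j < y" "y < \<theta> (j + 1)" for j y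
  proof -
    have "?c * min (y - \<theta> j) (\<theta> (j + 1) - y) \<le> c j * min (y - \<theta> j) (\<theta> (j + 1) - y)"
      using that by (intro mult_right_mono Min_le) auto
    also have "\<dots> \<le> h y" by (rule c(2)[OF that])
    finally show ?thesis .
  qed
  moreover have "0 < ?c" "0 < Min ((\<lambda>j. norm (b j)) ` {1..m})" using ne c(1) b0 by auto
  moreover have "Min ((\<lambda>j. norm (b j)) ` {1..m}) \<le> norm (b j)" "norm (b j) \<le> Max ((\<lambda>j. norm (b j)) ` {1..m})"
    if "j \<in> {1..m}" for j using that by auto
  ultimately show ?thesis using b by blast
qed

text \<open>
All translates of the exceptional lines occur, since the values of a branch of \<open>log E\<close> have arbitrary imaginary parts.
\<close>

definition far :: "real \<Rightarrow> complex \<Rightarrow> bool" where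
  "far \<eta> w \<longleftrightarrow> (\<forall>j\<in>{1..m}. \<forall>l::int. \<eta> \<le> \<bar>Im w - \<theta> j - 2 * pi * of_int l\<bar>)"

lemma E_periodic: "E (w + 2 * pi * of_int l * \<i>) = E w"
proof -
  have "exp (w + \<i> * (of_int l * (of_real pi * 2))) = exp w" by (rule exp_plus_2pin)
  then show ?thesis by (simp add: E_def mult_ac)
qed

lemma far_sector:
  assumes far: "far \<eta> w"
  shows "\<exists>j\<in>{1..m}. \<exists>l::int. \<theta> j + \<eta> \<le> Im w - 2 * pi * of_int l \<and> Im w - 2 * pi * of_int l \<le> \<theta> (j + 1) - \<eta>"
proof -
  define l where "l = \<lfloor>(Im w - \<theta> 1) / (2 * pi)\<rfloor>"
  define y where "y = Im w - 2 * pi * of_int l"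
  have "of_int l \<le> (Im w - \<theta> 1) / (2 * pi)" "(Im w - \<theta> 1) / (2 * pi) < of_int l + 1"
    by (auto simp: l_def)
  then have y: "\<theta> 1 \<le> y" "y < \<theta> (m + 1)"
    unfolding y_def \<theta>_period by (simp_all add: field_simps)
  define J where "J = {j\<in>{1..m}. \<theta> j \<le> y}"
  define j where "j = Max J"
  have "1 \<in> J" using y m_ge by (simp add: J_def)
  moreover have fin: "finite J" by (simp add: J_def)
  ultimately have "j \<in> J" unfolding j_def by (intro Max_in) auto
  then have j: "j \<in> {1..m}" "\<theta> j \<le> y" by (auto simp: J_def)
  have lt: "y < \<theta> (j + 1)"
  proof (cases "j = m")
    case False
    show ?thesis
    proof (rule ccontr)
      assume "\<not> y < \<theta> (j + 1)"
      then have "j + 1 \<in> J" using False j by (simp add: J_def)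
      then have "j + 1 \<le> j" unfolding j_def using fin by (intro Max_ge) auto
      then show False by simp
    qed
  qed (use y in simp)
  have 1: "\<eta> \<le> y - \<theta> j"
    using far j by (auto simp: far_def y_def abs_if algebra_simps split: if_splits dest!: bspec[of _ _ j] spec[of _ l])
  have 2: "\<eta> \<le> \<theta> (j + 1) - y"
  proof (cases "j = m")
    case True
    have "\<eta> \<le> \<bar>Im w - \<theta> 1 - 2 * pi * of_int (l + 1)\<bar>" using far m_ge unfolding far_def by fastforce
    then show ?thesis using lt unfolding True \<theta>_period y_def by (simp add: algebra_simps)
  next
    case False
    then have "\<eta> \<le> \<bar>Im w - \<theta> (j + 1) - 2 * pi * of_int l\<bar>" using far j unfolding far_def by fastforce
    then show ?thesis using lt by (simp add: y_def)
  qed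
  show ?thesis using j 1 2 by (intro bexI[of _ j] exI[of _ l]) (auto simp: y_def)
qed

text \<open>
The branches of \<open>log E\<close> on which the dynamics is controlled: almost affine at scales below \<open>\<eta>\<close>, with derivative
and real part bounded below in terms of \<open>\<phi>\<close>.
\<close>

definition good_log :: "real \<Rightarrow> real \<Rightarrow> real \<Rightarrow> complex \<Rightarrow> (complex \<Rightarrow> complex) \<Rightarrow> bool" where
  "good_log c C' \<eta> w0 L \<longleftrightarrow> L holomorphic_on ball w0 (\<eta> / 8) \<and> (\<forall>w\<in>ball w0 (\<eta> / 8). exp (L w) = E w \<and>
     c * \<eta> * \<phi> (Re w0) \<le> Re (L w) \<and> norm (deriv L w - deriv L w0) \<le> C' / \<eta> * \<phi> (Re w0) * norm (w - w0)) \<and>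
     c * \<phi> (Re w0) \<le> norm (deriv L w0)"

text \<open>
Compare the branch \<open>L\<close> on a disc of radius \<open>\<eta> / 2\<close> with the model
\<open>g0 w = b \<phi>(Re w0) e\<^bsup>\<rho>0 (w - Re w0)\<^esup>\<close>. The real part of the difference is at most \<open>\<nu> \<eta> \<phi>\<close>: one
contribution is the error term of the hypothesis, which is \<open>O(\<kappa> \<eta> \<phi>)\<close>, the other comes from
\<open>exp_increment_approx\<close> and is proportional to the radius of the disc. Differentiating costs a factor
\<open>1 / \<eta>\<close>, so \<open>L'\<close> differs from \<open>g0'\<close> by \<open>O(\<nu> \<phi>)\<close>, which the constants make at most half of the lower bound
\<open>\<rho>0 bmin \<phi>\<close> for \<open>\<bar>g0'(w0)\<bar>\<close>. The oscillation of \<open>L'\<close> follows by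
one more Cauchy estimate, and the lower bound for \<open>Re L\<close> from the linear lower bound for \<open>h\<close>.
\<close>

lemma good_log_in_sector:
  "\<exists>c>0. \<exists>C'>0. \<exists>\<kappa>>0. \<exists>X. \<forall>w0 \<eta> j. X \<le> Re w0 \<longrightarrow> 0 < \<eta> \<longrightarrow> \<eta> \<le> 1 \<longrightarrow> (\<forall>x\<ge>Re w0 - 1. \<epsilon> x \<le> \<kappa> * \<eta>) \<longrightarrow>
     j \<in> {1..m} \<longrightarrow> \<theta> j + \<eta> \<le> Im w0 \<longrightarrow> Im w0 \<le> \<theta> (j + 1) - \<eta> \<longrightarrow> (\<exists>L. good_log c C' \<eta> w0 L)"
proof -
  obtain b bmin bmax c where bm: "0 < bmin" and c: "0 < c"
    and b: "\<And>j. j \<in> {1..m} \<Longrightarrow> bmin \<le> norm (b j) \<and> norm (b j) \<le> bmax"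
    and hb: "\<And>j y. j \<in> {1..m} \<Longrightarrow> \<theta> j < y \<Longrightarrow> y < \<theta> (j + 1) \<Longrightarrow> h y = Re (b j * exp (\<i> * of_real (\<rho>0 * y)))"
    and hc: "\<And>j y. j \<in> {1..m} \<Longrightarrow> \<theta> j < y \<Longrightarrow> y < \<theta> (j + 1) \<Longrightarrow> c * min (y - \<theta> j) (\<theta> (j + 1) - y) \<le> h y"
    using sector_constants by blast
  obtain H where H: "H > 0" "\<And>t. t \<in> {\<theta> 1..\<theta> (m + 1)} \<Longrightarrow> \<bar>h t\<bar> \<le> H" using h_bounded by blast
  obtain X1 where X1: "\<And>w j. j \<in> {1..m} \<Longrightarrow> X1 \<le> Re w \<Longrightarrow> \<theta> j + \<epsilon> (Re w) < Im w \<Longrightarrow> Im w < \<theta> (j + 1) - \<epsilon> (Re w) \<Longrightarrow>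
      E w \<noteq> 0 \<and> \<bar>ln (norm (E w)) - h (Im w) * \<phi> (Re w)\<bar> \<le> C * (\<phi> (Re w) * \<epsilon> (Re w))"
    using sector_growth by metis
  define \<nu> where "\<nu> = \<rho>0 * bmin / (8 * exp 2)"
  define B where "B = exp \<rho>0 + 1"
  define C1 where "C1 = C + 1"
  define \<mu> where "\<mu> = min (exp (- \<rho>0) / 2) (\<nu> / (2 * H))"
  define \<kappa> where "\<kappa> = min (1/4) (min (c / (4 * C1)) (\<nu> / (2 * (C1 * B))))"
  have pos: "\<nu> > 0" "B > 0" "C1 > 0" "C \<le> C1"
    using \<rho>0_pos bm C_nonneg by (auto simp: \<nu>_def B_def C1_def add_pos_pos)
  have \<mu>: "\<mu> > 0" "\<mu> \<le> exp (- \<rho>0) / 2" "H * \<mu> \<le> \<nu> / 2" "\<mu> \<le> 1"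
  proof -
    show "\<mu> > 0" using pos H by (simp add: \<mu>_def)
    show 1: "\<mu> \<le> exp (- \<rho>0) / 2" unfolding \<mu>_def by (rule min.cobounded1)
    have "exp (- \<rho>0) \<le> 1" using \<rho>0_pos by simp
    with 1 show "\<mu> \<le> 1" by linarith
    have "H * \<mu> \<le> H * (\<nu> / (2 * H))" unfolding \<mu>_def using H by (intro mult_left_mono) auto
    then show "H * \<mu> \<le> \<nu> / 2" using H by simp
  qed
  have \<kappa>: "\<kappa> > 0" "\<kappa> \<le> 1/4" "C * \<kappa> \<le> c / 4" "C * B * \<kappa> \<le> \<nu> / 2"
  proof -
    show "\<kappa> > 0" using pos c by (simp add: \<kappa>_def)
    then have k0: "\<kappa> \<ge> 0" by simp
    show "\<kappa> \<le> 1/4" unfolding \<kappa>_def by (rule min.cobounded1)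
    have "C * \<kappa> \<le> C1 * (c / (4 * C1))"
      using pos k0 C_nonneg by (intro mult_mono) (auto simp: \<kappa>_def)
    then show "C * \<kappa> \<le> c / 4" using pos by simp
    have "(C * B) * \<kappa> \<le> (C1 * B) * (\<nu> / (2 * (C1 * B)))"
      using pos k0 C_nonneg by (intro mult_mono) (auto simp: \<kappa>_def)
    then show "C * B * \<kappa> \<le> \<nu> / 2" using pos by simp
  qed
  obtain X2 where "\<forall>x\<ge>X2. \<forall>t\<in>{-1..1}. \<bar>\<phi> (x + t) - \<phi> x * exp (\<rho>0 * t)\<bar> \<le> \<mu> * \<bar>t\<bar> * \<phi> x"
    using \<phi>_shift[OF \<mu>(1) zero_less_one] unfolding eventually_at_top_linorder by blast
  then have X2: "\<And>x t. X2 \<le> x \<Longrightarrow> t \<in> {-1..1} \<Longrightarrow> \<bar>\<phi> (x + t) - \<phi> x * exp (\<rho>0 * t)\<bar> \<le> \<mu> * \<bar>t\<bar> * \<phi> x"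
    by blast
  obtain X3 where X3: "\<And>x. X3 \<le> x \<Longrightarrow> 0 < \<epsilon> x" using \<epsilon>_pos unfolding eventually_at_top_linorder by blast
  define cc where "cc = min (\<rho>0 * bmin / 2) (c * exp (- \<rho>0) / 8)"
  have cc: "cc > 0" "cc \<le> \<rho>0 * bmin / 2" "cc \<le> c * exp (- \<rho>0) / 8"
    using \<rho>0_pos bm c by (auto simp: cc_def)
  define C0 where "C0 = \<rho>0 * bmin / 2 + \<rho>0 * bmax * exp \<rho>0"
  have bmax0: "0 < bmax" using bm b[of 1] m_ge by fastforce
  then have C0: "C0 > 0" using \<rho>0_pos bm by (simp add: C0_def add_pos_pos)
  have main: "\<exists>L. good_log cc (8 * C0) \<eta> w0 L"
    if x0: "max (X1 + 1) (max X2 (X3 + 1)) \<le> Re w0" and \<eta>: "0 < \<eta>" "\<eta> \<le> 1"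
      and eps: "\<And>x. x \<ge> Re w0 - 1 \<Longrightarrow> \<epsilon> x \<le> \<kappa> * \<eta>" and j: "j \<in> {1..m}"
      and y0: "\<theta> j + \<eta> \<le> Im w0" "Im w0 \<le> \<theta> (j + 1) - \<eta>" for w0 \<eta> j
  proof -
    define \<phi>0 where "\<phi>0 = \<phi> (Re w0)"
    have \<phi>0: "\<phi>0 > 0" by (simp add: \<phi>0_def \<phi>_pos)
    have loc: "E w \<noteq> 0 \<and> \<bar>ln (norm (E w)) - h (Im w) * \<phi> (Re w)\<bar> \<le> C * (\<phi> (Re w) * (\<kappa> * \<eta>)) \<and>
        \<theta> j + \<eta> / 2 < Im w \<and> Im w < \<theta> (j + 1) - \<eta> / 2 \<and> w \<in> sector j \<and> \<bar>Re w - Re w0\<bar> \<le> \<eta> / 2"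
      if w: "w \<in> ball w0 (\<eta> / 2)" for w
    proof -
      have im: "\<bar>Im w0 - Im w\<bar> < \<eta> / 2" using w abs_Im_le_cmod[of "w0 - w"] by (simp add: dist_norm)
      have re: "\<bar>Re w0 - Re w\<bar> < \<eta> / 2" using w abs_Re_le_cmod[of "w0 - w"] by (simp add: dist_norm)
      have "X1 + 1 \<le> Re w0" "X3 + 1 \<le> Re w0" using x0 by auto
      then have rw: "X1 \<le> Re w" "X3 \<le> Re w" "Re w0 - 1 \<le> Re w" using re \<eta> by linarith+
      have e1: "0 < \<epsilon> (Re w)" "\<epsilon> (Re w) \<le> \<kappa> * \<eta>" using X3[OF rw(2)] eps[OF rw(3)] by auto
      have "\<kappa> * \<eta> \<le> 1/4 * \<eta>" using \<kappa> \<eta> by (intro mult_right_mono) auto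
      with e1 have e2: "\<epsilon> (Re w) \<le> \<eta> / 4" by linarith
      have y: "\<theta> j + \<eta> / 2 < Im w" "Im w < \<theta> (j + 1) - \<eta> / 2" using im y0 by linarith+
      have A: "E w \<noteq> 0 \<and> \<bar>ln (norm (E w)) - h (Im w) * \<phi> (Re w)\<bar> \<le> C * (\<phi> (Re w) * \<epsilon> (Re w))"
        using y e2 \<eta> by (intro X1[OF j rw(1)]) linarith+
      have "C * (\<phi> (Re w) * \<epsilon> (Re w)) \<le> C * (\<phi> (Re w) * (\<kappa> * \<eta>))"
        using e1 \<phi>_pos[of "Re w"] C_nonneg by (intro mult_left_mono) auto
      then have "\<bar>ln (norm (E w)) - h (Im w) * \<phi> (Re w)\<bar> \<le> C * (\<phi> (Re w) * (\<kappa> * \<eta>))"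
        using A by linarith
      moreover have "w \<in> sector j" using y \<eta> by (simp add: sector_def)
      moreover have "\<bar>Re w - Re w0\<bar> \<le> \<eta> / 2" using re by linarith
      ultimately show ?thesis using A y by blast
    qed
    have \<phi>w: "\<bar>\<phi> (Re w) - \<phi>0 * exp (\<rho>0 * (Re w - Re w0))\<bar> \<le> \<mu> * (\<eta> / 2) * \<phi>0"
      "\<phi> (Re w) \<le> B * \<phi>0" "exp (- \<rho>0) / 2 * \<phi>0 \<le> \<phi> (Re w)"
      if w: "w \<in> ball w0 (\<eta> / 2)" for w
    proof -
      define t where "t = Re w - Re w0"
      have t1: "\<bar>t\<bar> \<le> \<eta> / 2" using loc[OF w] unfolding t_def by blast
      then have "\<bar>t\<bar> \<le> 1" using \<eta> by linarith
      with t1 have t: "\<bar>t\<bar> \<le> \<eta> / 2" "t \<in> {-1..1}" "\<bar>t\<bar> \<le> 1" by auto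
      have 1: "\<bar>\<phi> (Re w) - \<phi>0 * exp (\<rho>0 * t)\<bar> \<le> \<mu> * \<bar>t\<bar> * \<phi>0"
        using X2[of "Re w0" t] x0 t by (simp add: t_def \<phi>0_def)
      also have "\<dots> \<le> \<mu> * (\<eta> / 2) * \<phi>0" using t \<mu> \<phi>0 by (intro mult_right_mono mult_left_mono) auto
      finally show 2: "\<bar>\<phi> (Re w) - \<phi>0 * exp (\<rho>0 * (Re w - Re w0))\<bar> \<le> \<mu> * (\<eta> / 2) * \<phi>0" by (simp add: t_def)
      have 3: "\<mu> * \<bar>t\<bar> * \<phi>0 \<le> \<mu> * 1 * \<phi>0" using t \<mu> \<phi>0 by (intro mult_right_mono mult_left_mono) auto
      have "exp (\<rho>0 * t) * \<phi>0 \<le> exp \<rho>0 * \<phi>0" "exp (- \<rho>0) * \<phi>0 \<le> exp (\<rho>0 * t) * \<phi>0"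
        using t \<rho>0_pos \<phi>0 mult_left_mono[of "-1" t \<rho>0] by auto
      moreover have "\<mu> * \<phi>0 \<le> 1 * \<phi>0" "\<mu> * \<phi>0 \<le> exp (- \<rho>0) / 2 * \<phi>0"
        using \<mu> \<phi>0 by (auto intro: mult_right_mono)
      ultimately show "\<phi> (Re w) \<le> B * \<phi>0" "exp (- \<rho>0) / 2 * \<phi>0 \<le> \<phi> (Re w)"
        using 1 3 by (simp_all add: B_def algebra_simps abs_le_iff)
    qed
    have ne: "ball w0 (\<eta> / 2) \<noteq> {}" using \<eta> by simp
    have nz: "E (0 + z) \<noteq> 0" if "z \<in> ball w0 (\<eta> / 2)" for z using loc[OF that] by simp
    obtain L where L: "L holomorphic_on ball w0 (\<eta> / 2)"
      "\<And>z. z \<in> ball w0 (\<eta> / 2) \<Longrightarrow> exp (L z) = E z"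
      "\<And>z. z \<in> ball w0 (\<eta> / 2) \<Longrightarrow> Re (L z) = ln (norm (E z))"
      using local_logarithm[OF convex_ball open_ball ne nz] by auto
    define g0 where "g0 = (\<lambda>w. b j * of_real \<phi>0 * exp (of_real \<rho>0 * (w - of_real (Re w0))))"
    have RM: "Re (of_real r * z) = r * Re z" for r z by simp
    have Reg0: "Re (g0 w) = h (Im w) * (\<phi>0 * exp (\<rho>0 * (Re w - Re w0)))" if w: "w \<in> ball w0 (\<eta> / 2)" for w
    proof -
      have "h (Im w) = Re (b j * exp (\<i> * of_real (\<rho>0 * Im w)))"
        using loc[OF w] by (intro hb[OF j]) (auto simp: sector_def)
      moreover have "exp (of_real \<rho>0 * (w - of_real (Re w0)))
          = of_real (exp (\<rho>0 * (Re w - Re w0))) * exp (\<i> * of_real (\<rho>0 * Im w))"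
        by (subst exp_of_real[symmetric], subst exp_add[symmetric], rule arg_cong[of _ _ exp])
           (simp add: complex_eq_iff algebra_simps)
      then have "g0 w = of_real (\<phi>0 * exp (\<rho>0 * (Re w - Re w0))) * (b j * exp (\<i> * of_real (\<rho>0 * Im w)))"
        by (simp add: g0_def)
      then have "Re (g0 w) = \<phi>0 * exp (\<rho>0 * (Re w - Re w0)) * Re (b j * exp (\<i> * of_real (\<rho>0 * Im w)))"
        by (simp only: RM)
      ultimately show ?thesis by simp
    qed
    have g0der: "(g0 has_field_derivative of_real \<rho>0 * g0 w) (at w)" for w
      unfolding g0_def by (auto intro!: derivative_eq_intros)
    define g where "g = (\<lambda>w. L w - g0 w)"
    have ghol: "g holomorphic_on ball w0 (\<eta> / 2)"
      unfolding g_def g0_def by (intro holomorphic_intros L(1))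
    have Reg: "\<bar>Re (g w)\<bar> \<le> \<nu> * \<eta> * \<phi>0" if w: "w \<in> ball w0 (\<eta> / 2)" for w
    proof -
      have hH: "\<bar>h (Im w)\<bar> \<le> H" using loc[OF w] sector_Im_range[OF j] by (intro H) blast
      have "C * (\<phi> (Re w) * (\<kappa> * \<eta>)) \<le> C * ((B * \<phi>0) * (\<kappa> * \<eta>))"
        using \<phi>w(2)[OF w] C_nonneg \<kappa> \<eta> by (intro mult_left_mono mult_right_mono) auto
      also have "\<dots> = (C * B * \<kappa>) * (\<eta> * \<phi>0)" by simp
      also have "\<dots> \<le> \<nu> / 2 * (\<eta> * \<phi>0)" using \<kappa> \<eta> \<phi>0 by (intro mult_right_mono) auto
      finally have 1: "\<bar>ln (norm (E w)) - h (Im w) * \<phi> (Re w)\<bar> \<le> \<nu> / 2 * (\<eta> * \<phi>0)" using loc[OF w] by linarith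
      have "\<bar>h (Im w) * \<phi> (Re w) - Re (g0 w)\<bar> = \<bar>h (Im w)\<bar> * \<bar>\<phi> (Re w) - \<phi>0 * exp (\<rho>0 * (Re w - Re w0))\<bar>"
        unfolding Reg0[OF w] by (simp add: right_diff_distrib flip: abs_mult)
      also have "\<dots> \<le> H * (\<mu> * (\<eta> / 2) * \<phi>0)" using hH \<phi>w(1)[OF w] H by (intro mult_mono) auto
      also have "\<dots> = (H * \<mu>) * (\<eta> / 2 * \<phi>0)" by simp
      also have "\<dots> \<le> \<nu> / 2 * (\<eta> / 2 * \<phi>0)" using \<mu> \<eta> \<phi>0 by (intro mult_right_mono) auto
      also have "\<dots> \<le> \<nu> / 2 * (\<eta> * \<phi>0)" using pos \<eta> \<phi>0 by (intro mult_left_mono mult_right_mono) auto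
      finally have "\<bar>h (Im w) * \<phi> (Re w) - Re (g0 w)\<bar> \<le> \<nu> / 2 * (\<eta> * \<phi>0)" .
      with 1 have "\<bar>ln (norm (E w)) - Re (g0 w)\<bar> \<le> \<nu> / 2 * (\<eta> * \<phi>0) + \<nu> / 2 * (\<eta> * \<phi>0)" by linarith
      then show ?thesis using L(3)[OF w] by (simp add: g_def mult_ac)
    qed
    have dg: "norm (deriv L w - of_real \<rho>0 * g0 w) \<le> \<rho>0 * bmin / 2 * \<phi>0" if w: "w \<in> ball w0 (\<eta> / 4)" for w
    proof -
      have sub: "ball w (\<eta> / 4) \<subseteq> ball w0 (\<eta> / 2)"
        using w unfolding ball_subset_ball_iff mem_ball dist_commute[of w0] by linarith
      have w': "w \<in> ball w0 (\<eta> / 2)" using w \<eta> unfolding mem_ball by linarith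
      have "norm (deriv g w) \<le> exp 2 * (\<nu> * \<eta> * \<phi>0) / (\<eta> / 4)"
        using sub Reg \<eta> pos \<phi>0
        by (intro deriv_bound_by_real_part holomorphic_on_subset[OF ghol]) (auto intro!: mult_pos_pos)
      also have "\<dots> = \<rho>0 * bmin / 2 * \<phi>0" using \<eta> by (simp add: \<nu>_def)
      finally have "norm (deriv g w) \<le> \<rho>0 * bmin / 2 * \<phi>0" .
      moreover have "(g has_field_derivative deriv L w - of_real \<rho>0 * g0 w) (at w)"
        unfolding g_def by (intro DERIV_diff g0der holomorphic_derivI[OF L(1) open_ball w'])
      then have "deriv g w = deriv L w - of_real \<rho>0 * g0 w" by (rule DERIV_imp_deriv)
      ultimately show ?thesis by simp
    qed
    have ng0: "norm (g0 w) = norm (b j) * \<phi>0 * exp (\<rho>0 * (Re w - Re w0))" for w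
      using \<phi>0 by (simp add: g0_def norm_mult)
    have d0: "cc * \<phi>0 \<le> norm (deriv L w0)"
    proof -
      have "\<rho>0 * bmin * \<phi>0 \<le> \<rho>0 * (norm (b j) * \<phi>0)" using b[OF j] \<rho>0_pos \<phi>0 by simp
      also have "\<dots> = norm (of_real \<rho>0 * g0 w0)" using \<rho>0_pos by (simp add: norm_mult ng0)
      also have "\<dots> \<le> norm (deriv L w0) + norm (deriv L w0 - of_real \<rho>0 * g0 w0)"
        by (metis norm_minus_commute norm_triangle_sub)
      also have "\<dots> \<le> norm (deriv L w0) + \<rho>0 * bmin / 2 * \<phi>0" using dg[of w0] \<eta> by simp
      finally have "\<rho>0 * bmin / 2 * \<phi>0 \<le> norm (deriv L w0)" by (simp add: algebra_simps)
      moreover have "cc * \<phi>0 \<le> \<rho>0 * bmin / 2 * \<phi>0" using cc \<phi>0 by (intro mult_right_mono) auto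
      ultimately show ?thesis by linarith
    qed
    have dup: "norm (deriv L w) \<le> C0 * \<phi>0" if w: "w \<in> ball w0 (\<eta> / 4)" for w
    proof -
      have "w \<in> ball w0 (\<eta> / 2)" using w \<eta> unfolding mem_ball by linarith
      from loc[OF this] have "\<rho>0 * (Re w - Re w0) \<le> \<rho>0 * 1" using \<eta> \<rho>0_pos by (intro mult_left_mono) linarith+
      then have "norm (b j) * \<phi>0 * exp (\<rho>0 * (Re w - Re w0)) \<le> bmax * \<phi>0 * exp \<rho>0"
        using b[OF j] \<phi>0 bmax0 by (intro mult_mono) auto
      then have "norm (of_real \<rho>0 * g0 w) \<le> \<rho>0 * (bmax * \<phi>0 * exp \<rho>0)"
        using \<rho>0_pos by (simp add: norm_mult ng0)
      moreover have "norm (deriv L w) \<le> norm (of_real \<rho>0 * g0 w) + norm (deriv L w - of_real \<rho>0 * g0 w)"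
        by (rule norm_triangle_sub)
      ultimately show ?thesis using dg[OF w] by (simp add: C0_def algebra_simps)
    qed
    have osc: "norm (deriv L w - deriv L w0) \<le> 8 * C0 / \<eta> * \<phi>0 * norm (w - w0)" if w: "w \<in> ball w0 (\<eta> / 8)" for w
    proof (rule field_differentiable_bound[where S = "ball w0 (\<eta> / 8)" and f = "deriv L" and f' = "deriv (deriv L)"])
      have hol': "deriv L holomorphic_on ball w0 (\<eta> / 2)" by (rule holomorphic_deriv[OF L(1) open_ball])
      fix z assume z: "z \<in> ball w0 (\<eta> / 8)"
      have z': "z \<in> ball w0 (\<eta> / 2)" using z \<eta> unfolding mem_ball by linarith
      show "(deriv L has_field_derivative deriv (deriv L) z) (at z within ball w0 (\<eta> / 8))"
        by (rule has_field_derivative_at_within[OF holomorphic_derivI[OF hol' open_ball z']])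
      have sub: "ball z (\<eta> / 8) \<subseteq> ball w0 (\<eta> / 4)"
        using z unfolding ball_subset_ball_iff mem_ball dist_commute[of w0] by linarith
      also have "\<dots> \<subseteq> ball w0 (\<eta> / 2)" using \<eta> by (intro subset_ball) simp
      finally have sub2: "ball z (\<eta> / 8) \<subseteq> ball w0 (\<eta> / 2)" .
      have "norm (deriv (deriv L) z) \<le> C0 * \<phi>0 / (\<eta> / 8)"
        using sub dup \<eta> by (intro cauchy_deriv_bound holomorphic_on_subset[OF hol' sub2]) auto
      then show "norm (deriv (deriv L) z) \<le> 8 * C0 / \<eta> * \<phi>0" by (simp add: field_simps)
    qed (use w \<eta> in auto)
    have re: "cc * \<eta> * \<phi>0 \<le> Re (L w)" if w: "w \<in> ball w0 (\<eta> / 8)" for w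
    proof -
      have w': "w \<in> ball w0 (\<eta> / 2)" using w \<eta> unfolding mem_ball by linarith
      have "\<eta> / 2 \<le> min (Im w - \<theta> j) (\<theta> (j + 1) - Im w)" using loc[OF w'] by (intro min.boundedI) linarith+
      then have "c * (\<eta> / 2) \<le> c * min (Im w - \<theta> j) (\<theta> (j + 1) - Im w)"
        using c by (intro mult_left_mono) auto
      also have "\<dots> \<le> h (Im w)" using loc[OF w'] by (intro hc[OF j]) (auto simp: sector_def)
      finally have h1: "c * \<eta> / 2 \<le> h (Im w)" by simp
      have "C * \<kappa> * \<eta> \<le> c / 4 * \<eta>" using \<kappa> \<eta> by (intro mult_right_mono) auto
      with h1 have h2: "c * \<eta> / 4 \<le> h (Im w) - C * \<kappa> * \<eta>" by linarith
      have "cc * \<eta> * \<phi>0 \<le> (c * exp (- \<rho>0) / 8) * \<eta> * \<phi>0" using cc \<eta> \<phi>0 by (intro mult_right_mono) auto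
      also have "\<dots> = c * \<eta> / 4 * (exp (- \<rho>0) / 2 * \<phi>0)" by simp
      also have "\<dots> \<le> c * \<eta> / 4 * \<phi> (Re w)" using \<phi>w(3)[OF w'] c \<eta> by (intro mult_left_mono) auto
      also have "\<dots> \<le> (h (Im w) - C * \<kappa> * \<eta>) * \<phi> (Re w)" using h2 \<phi>_pos[of "Re w"] by (intro mult_right_mono) auto
      also have "\<dots> = h (Im w) * \<phi> (Re w) - C * (\<phi> (Re w) * (\<kappa> * \<eta>))" by (simp add: algebra_simps)
      also have "\<dots> \<le> ln (norm (E w))" using loc[OF w'] by linarith
      finally show ?thesis using L(3)[OF w'] by simp
    qed
    have sub8: "ball w0 (\<eta> / 8) \<subseteq> ball w0 (\<eta> / 2)" using \<eta> by (intro subset_ball) simp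
    have "good_log cc (8 * C0) \<eta> w0 L"
      unfolding good_log_def \<phi>0_def[symmetric]
      using holomorphic_on_subset[OF L(1) sub8] L(2) sub8 re osc d0 by auto
    then show ?thesis by blast
  qed
  show ?thesis
    by (rule exI[of _ cc], rule conjI[OF cc(1)], rule exI[of _ "8 * C0"], rule conjI, use C0 in simp,
        rule exI[of _ \<kappa>], rule conjI[OF \<kappa>(1)], rule exI[of _ "max (X1 + 1) (max X2 (X3 + 1))"])
       (use main in blast)
qed

lemma good_log_exists:
  "\<exists>c>0. \<exists>C'>0. \<exists>\<kappa>>0. \<exists>X. \<forall>w0 \<eta>. X \<le> Re w0 \<longrightarrow> 0 < \<eta> \<longrightarrow> \<eta> \<le> 1 \<longrightarrow> (\<forall>x\<ge>Re w0 - 1. \<epsilon> x \<le> \<kappa> * \<eta>) \<longrightarrow>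
     far \<eta> w0 \<longrightarrow> (\<exists>L. good_log c C' \<eta> w0 L)"
proof -
  obtain c C' \<kappa> X where c: "c > 0" "C' > 0" "\<kappa> > 0" and
    X: "\<And>w0 \<eta> j. X \<le> Re w0 \<Longrightarrow> 0 < \<eta> \<Longrightarrow> \<eta> \<le> 1 \<Longrightarrow> (\<forall>x\<ge>Re w0 - 1. \<epsilon> x \<le> \<kappa> * \<eta>) \<Longrightarrow>
     j \<in> {1..m} \<Longrightarrow> \<theta> j + \<eta> \<le> Im w0 \<Longrightarrow> Im w0 \<le> \<theta> (j + 1) - \<eta> \<Longrightarrow> (\<exists>L. good_log c C' \<eta> w0 L)"
    using good_log_in_sector by metis
  have "\<exists>L. good_log c C' \<eta> w0 L"
    if w0: "X \<le> Re w0" "0 < \<eta>" "\<eta> \<le> 1" "\<forall>x\<ge>Re w0 - 1. \<epsilon> x \<le> \<kappa> * \<eta>" "far \<eta> w0" for w0 \<eta>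
  proof -
    obtain j l where j: "j \<in> {1..m}" "\<theta> j + \<eta> \<le> Im w0 - 2 * pi * of_int l" "Im w0 - 2 * pi * of_int l \<le> \<theta> (j + 1) - \<eta>"
      using far_sector[OF w0(5)] by blast
    define p where "p = 2 * pi * of_int (- l) * \<i>"
    have p: "Re (w0 + p) = Re w0" "Im (w0 + p) = Im w0 - 2 * pi * of_int l" by (auto simp: p_def)
    obtain L where L: "good_log c C' \<eta> (w0 + p) L"
      using X[of "w0 + p" \<eta> j] w0 j unfolding p by blast
    define L' where "L' = (\<lambda>w. L (w + p))"
    have in_ball: "w + p \<in> ball (w0 + p) (\<eta> / 8)" if "w \<in> ball w0 (\<eta> / 8)" for w using that by (simp add: dist_norm)
    have holL: "L holomorphic_on ball (w0 + p) (\<eta> / 8)" using L by (simp add: good_log_def)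
    have der: "deriv L' w = deriv L (w + p)" if "w \<in> ball w0 (\<eta> / 8)" for w
    proof (rule DERIV_imp_deriv)
      have "(L has_field_derivative deriv L (w + p)) (at (w + p))"
        by (rule holomorphic_derivI[OF holL open_ball in_ball[OF that]])
      then show "(L' has_field_derivative deriv L (w + p)) (at w)" by (simp add: L'_def DERIV_shift)
    qed
    have "(L \<circ> (\<lambda>w. w + p)) holomorphic_on ball w0 (\<eta> / 8)"
      by (rule holomorphic_on_compose_gen[OF _ holL]) (use in_ball in \<open>auto intro: holomorphic_intros simp del: mem_ball\<close>)
    then have "L' holomorphic_on ball w0 (\<eta> / 8)" by (simp add: L'_def o_def)
    moreover have "exp (L' w) = E w" "c * \<eta> * \<phi> (Re w0) \<le> Re (L' w)"
      "norm (deriv L' w - deriv L' w0) \<le> C' / \<eta> * \<phi> (Re w0) * norm (w - w0)" if w: "w \<in> ball w0 (\<eta> / 8)" for w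
    proof -
      have w0b: "w0 \<in> ball w0 (\<eta> / 8)" using w0 by simp
      note * = L[unfolded good_log_def, THEN conjunct2, THEN conjunct1, rule_format, OF in_ball[OF w]]
      show "exp (L' w) = E w" using * E_periodic[of w "- l"] by (simp add: L'_def p_def)
      show "c * \<eta> * \<phi> (Re w0) \<le> Re (L' w)" using * p by (simp add: L'_def)
      show "norm (deriv L' w - deriv L' w0) \<le> C' / \<eta> * \<phi> (Re w0) * norm (w - w0)"
        using * p by (simp add: der[OF w] der[OF w0b])
    qed
    moreover have "c * \<phi> (Re w0) \<le> norm (deriv L' w0)"
      using L p w0 by (simp add: good_log_def der)
    ultimately have "good_log c C' \<eta> w0 L'" unfolding good_log_def by blast
    then show ?thesis by blast
  qed
  with c show ?thesis by blast
qed

section \<open>Every large annulus contains small values\<close>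

lemma interval_cover:
  assumes "\<theta> 1 \<le> y" "y \<le> \<theta> (m + 1)"
  shows "\<exists>j\<in>{1..m}. \<theta> j \<le> y \<and> y \<le> \<theta> (j + 1)"
proof -
  have "\<exists>j\<in>{1..k}. \<theta> j \<le> y \<and> y \<le> \<theta> (j + 1)" if "1 \<le> k" "y \<le> \<theta> (k + 1)" for k
    using that
  proof (induction k)
    case (Suc k)
    show ?case
    proof (cases "1 \<le> k \<and> y \<le> \<theta> (k + 1)")
      case True
      then show ?thesis using Suc.IH by fastforce
    next
      case False
      then have "\<theta> (Suc k) \<le> y" using assms(1) by (cases "k = 0") auto
      then show ?thesis using Suc.prems by (intro bexI[of _ "Suc k"]) auto
    qed
  qed simp
  then show ?thesis using assms m_ge by blast
qed

text \<open>
Supplies, for each angle, a nearby one at distance at least \<open>\<delta>\<close> from all exceptional rays, where \<open>ln \<bar>E\<bar>\<close> is known and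
from which Harnack's inequality can be applied.
\<close>

lemma dominating_points:
  "\<exists>\<delta>>0. \<delta> \<le> 1/4 \<and> (\<forall>y. \<theta> 1 \<le> y \<longrightarrow> y \<le> \<theta> (m + 1) \<longrightarrow>
     (\<exists>j\<in>{1..m}. \<exists>y'. \<bar>y - y'\<bar> \<le> \<delta> \<and> \<theta> j + \<delta> \<le> y' \<and> y' \<le> \<theta> (j + 1) - \<delta>))"
proof -
  define \<delta> where "\<delta> = min (1/4) (Min ((\<lambda>j. (\<theta> (j + 1) - \<theta> j) / 2) ` {1..m}))"
  have ne: "{1..m} \<noteq> {}" using m_ge by simp
  have "0 < Min ((\<lambda>j. (\<theta> (j + 1) - \<theta> j) / 2) ` {1..m})"
    using ne \<theta>_less by (subst Min_gr_iff) auto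
  then have \<delta>: "\<delta> > 0" "\<delta> \<le> 1/4" by (auto simp: \<delta>_def)
  have gap: "2 * \<delta> \<le> \<theta> (j + 1) - \<theta> j" if "j \<in> {1..m}" for j
  proof -
    have "Min ((\<lambda>j. (\<theta> (j + 1) - \<theta> j) / 2) ` {1..m}) \<le> (\<theta> (j + 1) - \<theta> j) / 2"
      using that by (intro Min_le) auto
    then have "\<delta> \<le> (\<theta> (j + 1) - \<theta> j) / 2" unfolding \<delta>_def by (rule min.coboundedI2)
    then show ?thesis by (simp add: field_simps)
  qed
  have "\<exists>j\<in>{1..m}. \<exists>y'. \<bar>y - y'\<bar> \<le> \<delta> \<and> \<theta> j + \<delta> \<le> y' \<and> y' \<le> \<theta> (j + 1) - \<delta>"
    if y: "\<theta> 1 \<le> y" "y \<le> \<theta> (m + 1)" for y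
  proof -
    obtain j where j: "j \<in> {1..m}" "\<theta> j \<le> y" "y \<le> \<theta> (j + 1)" using interval_cover[OF y] by blast
    show ?thesis
      by (intro bexI[OF _ j(1)] exI[of _ "max (\<theta> j + \<delta>) (min y (\<theta> (j + 1) - \<delta>))"])
         (use j(2,3) gap[OF j(1)] \<delta> in \<open>auto simp: max_def min_def\<close>)
  qed
  then show ?thesis using \<delta> by blast
qed

lemma log_deriv_periodic: "log_deriv (w + 2 * pi * \<i>) = log_deriv w"
proof -
  define p where "p = 2 * pi * \<i>"
  have per: "E (z + p) = E z" for z
    using exp_plus_2pin[of z 1] by (simp add: E_def p_def mult_ac)
  have "(E has_field_derivative deriv E (w + p)) (at (w + p))"
    by (rule holomorphic_derivI[OF E_holo open_UNIV]) simp
  then have "((\<lambda>z. E (z + p)) has_field_derivative deriv E (w + p)) (at w)"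
    by (simp only: DERIV_shift)
  then have "(E has_field_derivative deriv E (w + p)) (at w)" by (simp only: per)
  then have "deriv E w = deriv E (w + p)" by (rule DERIV_imp_deriv)
  then show ?thesis unfolding p_def[symmetric] by (simp add: log_deriv_def per)
qed

text \<open>
Let \<open>L\<close> be a branch of \<open>log E\<close> on the vertical strip around \<open>x\<close> and \<open>\<Phi>\<close> a primitive of \<open>L\<close>. The
difference \<open>L (w + 2 \<pi> i) - L w\<close> is a constant \<open>\<kappa>\<close>, so \<open>\<Psi>\<close>, the difference of \<open>\<Phi>\<close> over a vertical
period, has constant derivative and is affine. The integral of \<open>Re L\<close> over the period is the imaginary
part of \<open>\<Psi>\<close>.
\<close>

lemma circular_mean_affine:
  assumes nz: "\<And>w. \<bar>Re w - x\<bar> < 2 \<Longrightarrow> E w \<noteq> 0"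
  defines "M \<equiv> \<lambda>t. integral {\<theta> 1..\<theta> (m + 1)} (\<lambda>y. ln (norm (E (of_real x + Complex t y))))"
  shows "M 1 + M (-1) = 2 * M 0"
    and "\<And>t. \<bar>t\<bar> < 2 \<Longrightarrow> (\<lambda>y. ln (norm (E (of_real x + Complex t y)))) integrable_on {\<theta> 1..\<theta> (m + 1)}"
proof -
  define V where "V = {w. \<bar>Re w\<bar> < 2}"
  have V: "convex V" "open V" "V \<noteq> {}"
  proof -
    have "V = {w. - 2 < Re w} \<inter> {w. Re w < 2}" by (auto simp: V_def)
    then show "convex V" "open V"
      by (auto intro!: convex_Int open_Int convex_halfspace_Re_gt convex_halfspace_Re_lt open_halfspace_Re_gt open_halfspace_Re_lt)
    have "0 \<in> V" by (simp add: V_def) then show "V \<noteq> {}" by blast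
  qed
  have nz': "E (of_real x + z) \<noteq> 0" if "z \<in> V" for z using that by (intro nz) (simp add: V_def)
  obtain L where L: "L holomorphic_on V" "\<And>z. z \<in> V \<Longrightarrow> Re (L z) = ln (norm (E (of_real x + z)))"
     "\<And>z. z \<in> V \<Longrightarrow> (L has_field_derivative log_deriv (of_real x + z)) (at z)"
    using local_logarithm[OF V nz'] by blast
  obtain \<Phi> where "\<And>z. z \<in> V \<Longrightarrow> (\<Phi> has_field_derivative L z) (at z within V)"
    using holomorphic_convex_primitive'[OF V(1,2) L(1)] by blast
  then have \<Phi>: "(\<Phi> has_field_derivative L z) (at z)" if "z \<in> V" for z
    using that V(2) by (metis at_within_open)
  define p where "p = 2 * pi * \<i>"
  have pV: "z + p \<in> V \<longleftrightarrow> z \<in> V" "z + \<i> * of_real r \<in> V \<longleftrightarrow> z \<in> V" for z r by (auto simp: V_def p_def)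
  obtain \<kappa> where \<kappa>: "\<And>z. z \<in> V \<Longrightarrow> L (z + p) - L z = \<kappa>"
  proof -
    have d: "((\<lambda>z. L (z + p) - L z) has_field_derivative 0) (at z within V)" if z: "z \<in> V" for z
    proof -
      have eq: "log_deriv (of_real x + (z + p)) = log_deriv (of_real x + z)"
        using log_deriv_periodic[of "of_real x + z"] by (simp only: p_def add.assoc)
      have "(L has_field_derivative log_deriv (of_real x + (z + p))) (at (z + p))" using z pV by (intro L(3)) simp
      then have "((\<lambda>z. L (z + p)) has_field_derivative log_deriv (of_real x + (z + p))) (at z)" by (simp only: DERIV_shift)
      from DERIV_diff[OF this L(3)[OF z]] have "((\<lambda>z. L (z + p) - L z) has_field_derivative 0) (at z)"
        by (simp only: eq diff_self)
      then show ?thesis by (rule has_field_derivative_at_within)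
    qed
    have "\<exists>c. \<forall>z\<in>V. L (z + p) - L z = c"
      by (rule has_field_derivative_zero_constant[where f = "\<lambda>z. L (z + p) - L z", OF V(1) d])
    then show ?thesis using that by blast
  qed
  define \<Psi> where "\<Psi> = (\<lambda>z. \<Phi> (z + \<i> * of_real (\<theta> 1) + p) - \<Phi> (z + \<i> * of_real (\<theta> 1)))"
  have d: "((\<lambda>z. \<Psi> z - \<kappa> * z) has_field_derivative 0) (at z within V)" if z: "z \<in> V" for z
  proof -
    have zi: "z + \<i> * of_real (\<theta> 1) \<in> V" "z + (\<i> * of_real (\<theta> 1) + p) \<in> V"
      using z pV by (simp_all add: add.assoc[symmetric])
    have "((\<lambda>z. \<Phi> (z + \<i> * of_real (\<theta> 1))) has_field_derivative L (z + \<i> * of_real (\<theta> 1))) (at z)"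
      using \<Phi>[OF zi(1)] by (simp only: DERIV_shift)
    moreover have "((\<lambda>z. \<Phi> (z + (\<i> * of_real (\<theta> 1) + p))) has_field_derivative L (z + (\<i> * of_real (\<theta> 1) + p))) (at z)"
      using \<Phi>[OF zi(2)] by (simp only: DERIV_shift)
    ultimately have "((\<lambda>z. \<Psi> z - \<kappa> * z) has_field_derivative
        L (z + (\<i> * of_real (\<theta> 1) + p)) - L (z + \<i> * of_real (\<theta> 1)) - \<kappa>) (at z)"
      unfolding \<Psi>_def add.assoc by (intro DERIV_diff DERIV_cmult_Id)
    moreover have "L (z + (\<i> * of_real (\<theta> 1) + p)) - L (z + \<i> * of_real (\<theta> 1)) = \<kappa>"
      using \<kappa>[OF zi(1)] by (simp add: add.assoc)
    ultimately show ?thesis by (simp add: has_field_derivative_at_within)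
  qed
  have "\<exists>c. \<forall>z\<in>V. \<Psi> z - \<kappa> * z = c"
    by (rule has_field_derivative_zero_constant[where f = "\<lambda>z. \<Psi> z - \<kappa> * z", OF V(1) d])
  then obtain c where c: "\<And>z. z \<in> V \<Longrightarrow> \<Psi> z = c + \<kappa> * z" by (metis diff_add_cancel)
  have int: "((\<lambda>y. ln (norm (E (of_real x + Complex t y)))) has_integral Im (\<Psi> (of_real t))) {\<theta> 1..\<theta> (m + 1)}"
    if t: "\<bar>t\<bar> < 2" for t
  proof -
    have tV: "Complex t y \<in> V" for y using t by (simp add: V_def)
    have "((\<lambda>y. \<i> * L (Complex t y)) has_integral \<Phi> (Complex t (\<theta> (m + 1))) - \<Phi> (Complex t (\<theta> 1))) {\<theta> 1..\<theta> (m + 1)}"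
    proof (rule fundamental_theorem_of_calculus)
      show "\<theta> 1 \<le> \<theta> (m + 1)" unfolding \<theta>_period by simp
      fix y
      have "((\<lambda>y. Complex t y) has_vector_derivative \<i>) (at y within {\<theta> 1..\<theta> (m + 1)})"
      proof -
        have "((\<lambda>y. of_real t + \<i> * of_real y) has_vector_derivative \<i>) (at y within {\<theta> 1..\<theta> (m + 1)})"
          by (auto intro!: derivative_eq_intros)
        then show ?thesis by (simp add: Complex_eq)
      qed
      from field_vector_diff_chain_within[OF this has_field_derivative_at_within[OF \<Phi>[OF tV[of y]]]]
      show "((\<lambda>y. \<Phi> (Complex t y)) has_vector_derivative \<i> * L (Complex t y)) (at y within {\<theta> 1..\<theta> (m + 1)})"
        by (simp add: o_def)
    qed
    also have "\<Phi> (Complex t (\<theta> (m + 1))) - \<Phi> (Complex t (\<theta> 1)) = \<Psi> (of_real t)"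
      unfolding \<Psi>_def \<theta>_period by (simp add: Complex_eq p_def algebra_simps)
    finally have "((\<lambda>y. Im (\<i> * L (Complex t y))) has_integral Im (\<Psi> (of_real t))) {\<theta> 1..\<theta> (m + 1)}"
      by (rule has_integral_Im)
    then show ?thesis using L(2)[OF tV] by simp
  qed
  have M: "M t = Im (\<Psi> (of_real t))" if "\<bar>t\<bar> < 2" for t
    unfolding M_def by (rule integral_unique[OF int[OF that]])
  have "\<Psi> (of_real 1) + \<Psi> (of_real (-1)) = 2 * \<Psi> (of_real 0)"
    using c[of 1] c[of "-1"] c[of 0] by (simp add: V_def)
  from arg_cong[OF this, of Im]
  have "Im (\<Psi> (of_real 1)) + Im (\<Psi> (of_real (-1))) = 2 * Im (\<Psi> (of_real 0))" by simp
  then show "M 1 + M (-1) = 2 * M 0" using M[of 1] M[of "-1"] M[of 0] by simp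
  show "(\<lambda>y. ln (norm (E (of_real x + Complex t y)))) integrable_on {\<theta> 1..\<theta> (m + 1)}" if "\<bar>t\<bar> < 2" for t
    using int[OF that] by blast
qed

text \<open>
Close to the exceptional lines the hypothesis gives no upper bound for \<open>\<bar>f\<bar>\<close>. If \<open>\<bar>f\<bar> > 1\<close> on the whole annulus, Harnack's
inequality for the positive function \<open>ln \<bar>E\<bar>\<close> supplies one.
\<close>

lemma log_bounded_on_zero_free_strip:
  "\<exists>B X. \<forall>x\<ge>X. (\<forall>w. \<bar>Re w - x\<bar> < 2 \<longrightarrow> norm (E w) > 1) \<longrightarrow>
     (\<forall>t y. \<bar>t\<bar> \<le> 1 \<longrightarrow> \<theta> 1 \<le> y \<longrightarrow> y \<le> \<theta> (m + 1) \<longrightarrow>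
        \<bar>ln (norm (E (of_real x + Complex t y)))\<bar> \<le> B * \<phi> x)"
proof -
  obtain \<delta> where \<delta>: "\<delta> > 0" "\<delta> \<le> 1/4" and near: "\<And>y. \<theta> 1 \<le> y \<Longrightarrow> y \<le> \<theta> (m + 1) \<Longrightarrow>
     (\<exists>j\<in>{1..m}. \<exists>y'. \<bar>y - y'\<bar> \<le> \<delta> \<and> \<theta> j + \<delta> \<le> y' \<and> y' \<le> \<theta> (j + 1) - \<delta>)"
    using dominating_points by metis
  obtain H where H: "H > 0" "\<And>t. t \<in> {\<theta> 1..\<theta> (m + 1)} \<Longrightarrow> \<bar>h t\<bar> \<le> H" using h_bounded by blast
  obtain X1 where X1: "\<And>w j. j \<in> {1..m} \<Longrightarrow> X1 \<le> Re w \<Longrightarrow> \<theta> j + \<epsilon> (Re w) < Im w \<Longrightarrow> Im w < \<theta> (j + 1) - \<epsilon> (Re w) \<Longrightarrow>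
      E w \<noteq> 0 \<and> \<bar>ln (norm (E w)) - h (Im w) * \<phi> (Re w)\<bar> \<le> C * (\<phi> (Re w) * \<epsilon> (Re w))"
    using sector_growth by metis
  obtain X2 where "\<forall>x\<ge>X2. \<forall>t\<in>{-1..1}. \<bar>\<phi> (x + t) - \<phi> x * exp (\<rho>0 * t)\<bar> \<le> 1 * \<bar>t\<bar> * \<phi> x"
    using \<phi>_shift[OF zero_less_one zero_less_one] unfolding eventually_at_top_linorder by blast
  then have X2: "\<bar>\<phi> (x + t) - \<phi> x * exp (\<rho>0 * t)\<bar> \<le> \<bar>t\<bar> * \<phi> x" if "X2 \<le> x" "t \<in> {-1..1}" for x t
    using that by simp
  obtain X3 where X3: "\<And>x. X3 \<le> x \<Longrightarrow> \<epsilon> x < \<delta>"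
    using order_tendstoD(2)[OF \<epsilon>_lim \<delta>(1)] unfolding eventually_at_top_linorder by blast
  obtain X4 where X4: "\<And>x. X4 \<le> x \<Longrightarrow> 0 < \<epsilon> x" using \<epsilon>_pos unfolding eventually_at_top_linorder by blast
  define B where "B = 3 * ((H + C) * (exp \<rho>0 + 1))"
  have main: "\<bar>ln (norm (E (of_real x + Complex t y)))\<bar> \<le> B * \<phi> x"
    if x: "max (max X1 X2) (max X3 X4) + 1 \<le> x" and big: "\<forall>w. \<bar>Re w - x\<bar> < 2 \<longrightarrow> norm (E w) > 1"
      and t: "\<bar>t\<bar> \<le> 1" and y: "\<theta> 1 \<le> y" "y \<le> \<theta> (m + 1)" for x t y
  proof -
    obtain j y' where j: "j \<in> {1..m}" and y': "\<bar>y - y'\<bar> \<le> \<delta>" "\<theta> j + \<delta> \<le> y'" "y' \<le> \<theta> (j + 1) - \<delta>"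
      using near[OF y] by blast
    have xs: "X1 + 1 \<le> x" "X2 + 1 \<le> x" "X3 + 1 \<le> x" "X4 + 1 \<le> x" using x by (simp_all add: max_def split: if_splits)
    have xt: "X1 \<le> x + t" "X3 \<le> x + t" "X4 \<le> x + t" using xs t by linarith+
    define w where "w = Complex t y'"
    have w: "Re (of_real x + w) = x + t" "Im (of_real x + w) = y'" by (simp_all add: w_def)
    have eps: "0 < \<epsilon> (x + t)" "\<epsilon> (x + t) < \<delta>" using X3[OF xt(2)] X4[OF xt(3)] by auto
    have "\<theta> j + \<epsilon> (x + t) < y'" "y' < \<theta> (j + 1) - \<epsilon> (x + t)" using eps y' by linarith+
    then have u: "\<bar>ln (norm (E (of_real x + w))) - h y' * \<phi> (x + t)\<bar> \<le> C * (\<phi> (x + t) * \<epsilon> (x + t))"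
      using X1[OF j, of "of_real x + w"] xt(1) unfolding w by blast
    have "y' \<in> {\<theta> 1..\<theta> (m + 1)}"
      using y' \<delta> \<theta>_mono[of 1 j] \<theta>_mono[of "j+1" "m+1"] j by auto
    then have "h y' * \<phi> (x + t) \<le> H * \<phi> (x + t)"
      using H(2)[of y'] \<phi>_pos[of "x + t"] by (intro mult_right_mono) auto
    moreover have "C * (\<phi> (x + t) * \<epsilon> (x + t)) \<le> C * (\<phi> (x + t) * 1)"
      using eps \<delta> C_nonneg \<phi>_pos[of "x + t"] by (intro mult_left_mono) auto
    ultimately have "ln (norm (E (of_real x + w))) \<le> (H + C) * \<phi> (x + t)"
      using u by (simp add: algebra_simps) 
    also have "\<phi> (x + t) \<le> (exp \<rho>0 + 1) * \<phi> x"
    proof -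
      have "\<phi> x * exp (\<rho>0 * t) \<le> \<phi> x * exp \<rho>0" using t \<rho>0_pos \<phi>_pos[of x] by (intro mult_left_mono) auto
      moreover have "\<bar>t\<bar> * \<phi> x \<le> 1 * \<phi> x" using t \<phi>_pos[of x] by (intro mult_right_mono) auto
      moreover have "\<bar>\<phi> (x + t) - \<phi> x * exp (\<rho>0 * t)\<bar> \<le> \<bar>t\<bar> * \<phi> x" using xs t by (intro X2) auto
      ultimately show ?thesis by (simp add: algebra_simps abs_le_iff)
    qed
    finally have u': "ln (norm (E (of_real x + w))) \<le> (H + C) * ((exp \<rho>0 + 1) * \<phi> x)"
      using H C_nonneg by simp
    have ballV: "\<bar>Re (of_real x + z) - x\<bar> < 2" if "z \<in> ball w 1" for z
    proof -
      have "\<bar>Re w - Re z\<bar> < 1" using that abs_Re_le_cmod[of "w - z"] by (simp add: dist_norm)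
      then show ?thesis using t by (simp add: w_def)
    qed
    have ne: "ball w 1 \<noteq> {}" by simp
    have nz: "E (of_real x + z) \<noteq> 0" if "z \<in> ball w 1" for z
    proof -
      have "1 < norm (E (of_real x + z))" using big ballV[OF that] by blast
      then show ?thesis by auto
    qed
    obtain L where L: "L holomorphic_on ball w 1" "\<And>z. z \<in> ball w 1 \<Longrightarrow> Re (L z) = ln (norm (E (of_real x + z)))"
      using local_logarithm[OF convex_ball open_ball ne nz] by blast
    have "dist w (Complex t y) = \<bar>y' - y\<bar>" by (simp add: w_def dist_norm cmod_def)
    also have "\<dots> \<le> 1 / 2" using y'(1) \<delta>(2) by linarith
    finally have dist: "dist w (Complex t y) \<le> 1 / 2" .
    have inb: "Complex t y \<in> ball w 1" "w \<in> ball w 1" using dist by auto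
    have "Re (L (Complex t y)) \<le> 3 * Re (L w)"
    proof (rule harnack_right_half_plane[OF L(1) _ _ dist])
      fix z assume z: "z \<in> ball w 1"
      have "1 < norm (E (of_real x + z))" using big ballV[OF z] by blast
      then show "Re (L z) > 0" unfolding L(2)[OF z] by (rule ln_gt_zero)
    qed simp
    then have "ln (norm (E (of_real x + Complex t y))) \<le> 3 * ln (norm (E (of_real x + w)))"
      using L(2) inb by simp
    also have "\<dots> \<le> B * \<phi> x" using u' by (simp add: B_def)
    finally have "ln (norm (E (of_real x + Complex t y))) \<le> B * \<phi> x" .
    moreover have "1 < norm (E (of_real x + Complex t y))" using big ballV[OF inb(1)] by blast
    then have "0 < ln (norm (E (of_real x + Complex t y)))" by (rule ln_gt_zero)
    ultimately show ?thesis by linarith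
  qed
  show ?thesis by (rule exI[of _ B], rule exI[of _ "max (max X1 X2) (max X3 X4) + 1"]) (use main in blast)
qed

text \<open>
Otherwise there are annuli with arbitrarily large \<open>x\<close> on which \<open>\<bar>f\<bar> > 1\<close>. By dominated convergence the
circular means at \<open>x + t\<close>, divided by \<open>\<phi> x\<close>, tend to \<open>J e\<^bsup>\<rho>0 t\<^esup>\<close> with \<open>J > 0\<close> the integral of \<open>h\<close>. The means are
affine in \<open>t\<close>, but the exponential function is strictly convex.
\<close>

lemma small_values_in_annuli: "\<exists>X. \<forall>x\<ge>X. \<exists>w. \<bar>Re w - x\<bar> < 2 \<and> norm (E w) \<le> 1"
proof (rule ccontr)
  assume "\<not> ?thesis"
  then have inf: "\<exists>x\<ge>X. \<forall>w. \<bar>Re w - x\<bar> < 2 \<longrightarrow> norm (E w) > 1" for X by (meson not_le)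
  obtain B X where BX: "\<And>x t y. x \<ge> X \<Longrightarrow> (\<forall>w. \<bar>Re w - x\<bar> < 2 \<longrightarrow> norm (E w) > 1) \<Longrightarrow>
     \<bar>t\<bar> \<le> 1 \<Longrightarrow> \<theta> 1 \<le> y \<Longrightarrow> y \<le> \<theta> (m + 1) \<Longrightarrow> \<bar>ln (norm (E (of_real x + Complex t y)))\<bar> \<le> B * \<phi> x"
    using log_bounded_on_zero_free_strip by metis
  have "\<forall>n. \<exists>y. max X (real n) \<le> y \<and> (\<forall>w. \<bar>Re w - y\<bar> < 2 \<longrightarrow> norm (E w) > 1)" using inf by blast
  from choice[OF this] obtain x :: "nat \<Rightarrow> real"
    where x: "\<And>n. max X (real n) \<le> x n" and big: "\<And>n w. \<bar>Re w - x n\<bar> < 2 \<Longrightarrow> norm (E w) > 1" by blast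
  have xlim: "filterlim x at_top sequentially"
    by (rule filterlim_at_top_mono[OF filterlim_real_sequentially]) (use x in \<open>auto intro: always_eventually\<close>)
  define I where "I = {\<theta> 1..\<theta> (m + 1)}"
  define S where "S = I - \<theta> ` {1..m + 1}"
  have spike: "negligible (\<theta> ` {1..m + 1})" by (intro negligible_finite) simp
  have intS: "integral S g = integral I g" for g :: "real \<Rightarrow> real"
    by (rule integral_spike_set; rule negligible_subset[OF spike]) (auto simp: S_def)
  have iblS: "g integrable_on S \<longleftrightarrow> g integrable_on I" for g :: "real \<Rightarrow> real"
    by (rule integrable_spike_set_eq; rule negligible_subset[OF spike]) (auto simp: S_def)
  define v where "v = (\<lambda>n t y. ln (norm (E (of_real (x n) + Complex t y))) / \<phi> (x n))"
  have nz: "E w \<noteq> 0" if "\<bar>Re w - x n\<bar> < 2" for w n using big[OF that] by auto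
  have ibl: "v n t integrable_on S" if "\<bar>t\<bar> \<le> 1" for n t
    unfolding iblS v_def I_def using that by (intro integrable_on_divide circular_mean_affine(2) nz) auto
  have Sj: "\<exists>j\<in>{1..m}. \<theta> j < y \<and> y < \<theta> (j + 1)" if "y \<in> S" for y
  proof -
    have "\<theta> 1 \<le> y" "y \<le> \<theta> (m + 1)" using that by (auto simp: S_def I_def)
    then obtain j where j: "j \<in> {1..m}" "\<theta> j \<le> y" "y \<le> \<theta> (j + 1)" using interval_cover by blast
    have "\<theta> j \<in> \<theta> ` {1..m + 1}" "\<theta> (j + 1) \<in> \<theta> ` {1..m + 1}" using j(1) by auto
    then have "y \<noteq> \<theta> j" "y \<noteq> \<theta> (j + 1)" using that by (auto simp: S_def)
    then show ?thesis using j by force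
  qed
  have lim: "(\<lambda>n. v n t y) \<longlonglongrightarrow> h y * exp (\<rho>0 * t)" if y: "y \<in> S" for t y
  proof -
    obtain j where j: "j \<in> {1..m}" "\<theta> j < y" "y < \<theta> (j + 1)" using Sj[OF y] by blast
    have sub: "cball (Complex t y) 0 \<subseteq> sector j" using j by (simp add: sector_def)
    have "((\<lambda>a. ln (norm (E (of_real a + Complex t y))) / \<phi> a) \<longlongrightarrow> h y * exp (\<rho>0 * t)) at_top"
    proof (rule tendstoI)
      fix e :: real assume "e > 0"
      then have e: "e / 2 > 0" by simp
      from scaled_log_limit[OF j(1) sub order_refl e]
      show "\<forall>\<^sub>F a in at_top. dist (ln (norm (E (of_real a + Complex t y))) / \<phi> a) (h y * exp (\<rho>0 * t)) < e"
        by (rule eventually_mono) (use \<open>e > 0\<close> in \<open>force simp: dist_real_def\<close>)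
    qed
    then show ?thesis unfolding v_def by (rule filterlim_compose[OF _ xlim])
  qed
  have bd: "norm (v n t y) \<le> B" if "\<bar>t\<bar> \<le> 1" "y \<in> S" for n t y
  proof -
    have "\<bar>ln (norm (E (of_real (x n) + Complex t y)))\<bar> \<le> B * \<phi> (x n)"
      using x[of n] big[of _ n] that by (intro BX allI impI) (auto simp: S_def I_def)
    then show ?thesis using \<phi>_pos[of "x n"] by (simp add: v_def abs_divide divide_le_eq)
  qed
  have B_ibl: "(\<lambda>y. B) integrable_on S" unfolding iblS I_def by (rule integrable_const_ivl)
  have conv: "(\<lambda>n. integral S (v n t)) \<longlonglongrightarrow> integral S (\<lambda>y. h y * exp (\<rho>0 * t))" if "\<bar>t\<bar> \<le> 1" for t
    by (rule dominated_convergence(2)[OF ibl B_ibl bd lim]) (use that in auto)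
  have h_ibl: "h integrable_on S" unfolding iblS I_def
    by (intro integrable_continuous_real continuous_on_subset[OF h_cont]) auto
  define J where "J = integral S h"
  have conv': "(\<lambda>n. integral S (v n t)) \<longlonglongrightarrow> J * exp (\<rho>0 * t)" if "\<bar>t\<bar> \<le> 1" for t
    using conv[OF that] by (simp add: J_def)
  have aff: "integral S (v n 1) + integral S (v n (-1)) = 2 * integral S (v n 0)" for n
  proof -
    have "integral S (v n t) = integral I (\<lambda>y. ln (norm (E (of_real (x n) + Complex t y)))) / \<phi> (x n)" for t
      unfolding intS v_def by simp
    then show ?thesis using circular_mean_affine(1)[of "x n"] nz unfolding I_def
      by (simp add: add_divide_distrib[symmetric])
  qed
  have "(\<lambda>n. integral S (v n 1) + integral S (v n (-1))) \<longlonglongrightarrow> J * exp (\<rho>0 * 1) + J * exp (\<rho>0 * (-1))"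
    by (intro tendsto_add conv') auto
  moreover have "(\<lambda>n. 2 * integral S (v n 0)) \<longlonglongrightarrow> 2 * (J * exp (\<rho>0 * 0))"
    by (intro tendsto_mult tendsto_const conv') auto
  ultimately have eq: "J * exp (\<rho>0 * 1) + J * exp (\<rho>0 * (-1)) = 2 * (J * exp (\<rho>0 * 0))"
    unfolding aff using LIMSEQ_unique by blast
  have "J > 0"
  proof -
    have one: "1 \<in> {1..m}" using m_ge by simp
    define d where "d = (\<theta> 2 - \<theta> 1) / 3"
    have d: "d > 0" using \<theta>_less[OF one] by (simp add: d_def numeral_2_eq_2)
    have th2: "\<theta> 2 = \<theta> 1 + 3 * d" by (simp add: d_def field_simps)
    let ?K = "{\<theta> 1 + d..\<theta> 1 + 2 * d}"
    have hK: "h y > 0" if "y \<in> ?K" for y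
      using h_pos[OF one, of y] that d th2 by (simp add: numeral_2_eq_2)
    have KS: "?K \<subseteq> S"
    proof
      fix y assume y: "y \<in> ?K"
      have lt: "\<theta> 1 < y" "y < \<theta> 2" using y d th2 by auto
      have "\<theta> 2 \<le> \<theta> (m + 1)" using m_ge \<theta>_mono[of 2 "m+1"] by simp
      moreover have "y \<noteq> \<theta> i" if "i \<in> {1..m + 1}" for i
        using lt \<theta>_mono[of 2 i] that by (cases "i = 1") auto
      then have "y \<notin> \<theta> ` {1..m + 1}" by blast
      ultimately show "y \<in> S" using lt by (simp add: S_def I_def)
    qed
    obtain y0 where y0: "y0 \<in> ?K" "\<And>y. y \<in> ?K \<Longrightarrow> h y0 \<le> h y"
      using continuous_attains_inf[of ?K h] d continuous_on_subset[OF h_cont, of ?K] by auto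
    have K_ibl: "h integrable_on ?K" by (intro integrable_continuous_real continuous_on_subset[OF h_cont]) auto
    have "0 < h y0 * d" using hK[OF y0(1)] d by simp
    also have "h y0 * d = integral ?K (\<lambda>y. h y0)" using d by simp
    also have "\<dots> \<le> integral ?K h" by (rule integral_le[OF integrable_const_ivl K_ibl y0(2)])
    also have "\<dots> \<le> integral S h"
    proof (rule integral_subset_le[OF KS K_ibl h_ibl], intro ballI)
      fix y assume "y \<in> S"
      then obtain j where j: "j \<in> {1..m}" "\<theta> j < y" "y < \<theta> (j + 1)" using Sj by blast
      show "0 \<le> h y" using h_pos[OF j] by simp
    qed
    finally show ?thesis by (simp add: J_def)
  qed
  with eq have "exp \<rho>0 + exp (- \<rho>0) = 2" by (simp add: distrib_left[symmetric])
  moreover have "exp \<rho>0 * exp (- \<rho>0) = 1" by (simp add: exp_minus)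
  moreover have "exp \<rho>0 > 1" using \<rho>0_pos by simp
  ultimately have "(exp \<rho>0 - 1)\<^sup>2 = 0"
    by (simp add: power2_eq_square algebra_simps) (metis add.commute distrib_left mult_2 mult.commute)
  with \<open>exp \<rho>0 > 1\<close> show False by simp
qed

section \<open>A tower of scales\<close>

text \<open>
The scales of the construction: \<open>x\<^sub>k\<^sub>+\<^sub>1 = e\<^bsup>a x\<^sub>k\<^esup>\<close> with \<open>a = \<rho>0 / 4\<close>. Since \<open>\<phi> y \<ge> e\<^bsup>2 a y\<^esup>\<close>, the image of a
point at height \<open>x\<^sub>k\<close> lies above \<open>x\<^sub>k\<^sub>+\<^sub>1\<close> even after multiplication by \<open>\<eta>\<^sub>k\<close>, because \<open>A\<^sub>k = e\<^bsup>a x\<^sub>k\<^esup>\<close> grows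
at least like \<open>4\<^sup>k\<close>.
\<close>

lemma stages:
  assumes c: "c > 0" and \<kappa>: "\<kappa> > 0" and \<eta>0: "0 < \<eta>0" "\<eta>0 \<le> 1"
  shows "\<exists>x :: nat \<Rightarrow> real. \<forall>k. X \<le> x k \<and> real k \<le> x k \<and>
    (\<forall>y\<ge>x k. \<epsilon> y \<le> \<kappa> * (\<eta>0 / 2 ^ k) \<and> x (Suc k) + 2 \<le> c * (\<eta>0 / 2 ^ k) * \<phi> y \<and> T \<le> c * \<phi> y * (\<eta>0 / 2 ^ k)\<^sup>2)"
proof -
  define a where "a = \<rho>0 / 4"
  have a: "a > 0" using \<rho>0_pos by (simp add: a_def)
  define D where "D = max (3 / (c * \<eta>0)) (T / (c * \<eta>0\<^sup>2))"
  obtain X1 where X1: "\<And>x. X1 \<le> x \<Longrightarrow> exp (\<rho>0 / 2 * x) \<le> \<phi> x" using \<phi>_ge unfolding eventually_at_top_linorder by blast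
  obtain X2 where X2: "\<And>x y. X2 \<le> x \<Longrightarrow> x \<le> y \<Longrightarrow> \<epsilon> y \<le> \<epsilon> x" using \<epsilon>_antimono by blast
  obtain X3 where X3: "\<And>x. X3 \<le> x \<Longrightarrow> \<epsilon> (exp (a * x)) \<le> \<epsilon> x / 2"
    using \<epsilon>_tower[OF a] unfolding eventually_at_top_linorder by blast
  have "\<kappa> * \<eta>0 > 0" using \<kappa> \<eta>0 by simp
  then obtain X4 where X4: "\<And>x. X4 \<le> x \<Longrightarrow> \<epsilon> x < \<kappa> * \<eta>0"
    using order_tendstoD(2)[OF \<epsilon>_lim] unfolding eventually_at_top_linorder by blast
  have "\<forall>\<^sub>F x::real in at_top. 4 * x \<le> exp (a * x)" using a by real_asymp
  then obtain X5 where X5: "\<And>x. X5 \<le> x \<Longrightarrow> 4 * x \<le> exp (a * x)" unfolding eventually_at_top_linorder by blast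
  have "\<forall>\<^sub>F x::real in at_top. max D (max X5 1) \<le> exp (a * x)" using a by real_asymp
  then obtain X6 where X6: "\<And>x. X6 \<le> x \<Longrightarrow> max D (max X5 1) \<le> exp (a * x)" unfolding eventually_at_top_linorder by blast
  define x0 where "x0 = Max {X, X1, X2, X3, X4, X5, X6, 1}"
  have x0: "X \<le> x0" "X1 \<le> x0" "X2 \<le> x0" "X3 \<le> x0" "X4 \<le> x0" "X5 \<le> x0" "X6 \<le> x0" "1 \<le> x0"
    unfolding x0_def by (rule Max_ge; simp)+
  define x where "x = rec_nat x0 (\<lambda>_ y. exp (a * y))"
  have xS: "x (Suc k) = exp (a * x k)" and x_0: "x 0 = x0" for k by (simp_all add: x_def)
  have step: "x0 \<le> x k \<and> real k \<le> x k" for k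
  proof (induction k)
    case 0 then show ?case using x0 by (simp add: x_0)
  next
    case (Suc k)
    have "4 * x k \<le> x (Suc k)" unfolding xS using Suc x0 by (intro X5) simp
    then show ?case using Suc x0 by simp
  qed
  have eps: "\<epsilon> (x k) \<le> \<kappa> * (\<eta>0 / 2 ^ k)" for k
  proof (induction k)
    case 0 then show ?case using X4[of x0] x0 by (simp add: x_0)
  next
    case (Suc k)
    have "\<epsilon> (x (Suc k)) \<le> \<epsilon> (x k) / 2" unfolding xS using step[of k] x0 by (intro X3) simp
    also have "\<dots> \<le> \<kappa> * (\<eta>0 / 2 ^ k) / 2" using Suc by simp
    also have "\<dots> = \<kappa> * (\<eta>0 / 2 ^ Suc k)" by simp
    finally show ?case .
  qed
  define A where "A = (\<lambda>k. exp (a * x k))"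
  have A: "max D (max X5 1) * 4 ^ k \<le> A k" for k
  proof (induction k)
    case 0 then show ?case using X6[of x0] x0 by (simp add: A_def x_0)
  next
    case (Suc k)
    have "X5 \<le> max D (max X5 1) * 1" by simp
    also have "\<dots> \<le> max D (max X5 1) * 4 ^ k" by (intro mult_left_mono) auto
    also note Suc
    finally have "4 * A k \<le> exp (a * A k)" by (rule X5)
    also have "A k = x (Suc k)" by (simp add: A_def xS)
    also have "exp (a * x (Suc k)) = A (Suc k)" by (simp add: A_def)
    finally show ?case using Suc by (simp add: A_def xS)
  qed
  have A1: "1 \<le> A k" for k using step[of k] x0 a by (simp add: A_def)
  have AD: "D * 4 ^ k \<le> A k" for k
    using A[of k] by (meson max.cobounded1 mult_right_mono order_trans zero_le_numeral zero_le_power)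
  have \<phi>A: "A k * A k \<le> \<phi> y" if y: "x k \<le> y" for k y
  proof -
    have "A k * A k = exp (\<rho>0 / 2 * x k)" by (simp add: A_def a_def flip: exp_add)
    also have "\<dots> \<le> exp (\<rho>0 / 2 * y)" using y \<rho>0_pos by simp
    also have "\<dots> \<le> \<phi> y" using y step[of k] x0 by (intro X1) simp
    finally show ?thesis .
  qed
  show ?thesis
  proof (intro exI[of _ x] allI conjI impI)
    fix k
    show "X \<le> x k" "real k \<le> x k" using step[of k] x0 by auto
    fix y assume y: "x k \<le> y"
    have "\<epsilon> y \<le> \<epsilon> (x k)" using y step[of k] x0 by (intro X2) auto
    then show "\<epsilon> y \<le> \<kappa> * (\<eta>0 / 2 ^ k)" using eps[of k] by linarith
    have p4: "(4::real) ^ k = 2 ^ k * 2 ^ k" by (simp flip: power_mult_distrib)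
    have "3 / (c * \<eta>0) * 4 ^ k \<le> D * 4 ^ k" by (intro mult_right_mono) (auto simp: D_def)
    then have "3 / (c * \<eta>0) * 4 ^ k \<le> A k" using AD[of k] by linarith
    then have "3 * 4 ^ k \<le> c * \<eta>0 * A k" using c \<eta>0 by (simp add: field_simps)
    moreover have "(2::real) ^ k \<le> 4 ^ k" by (intro power_mono) auto
    ultimately have "3 * 2 ^ k \<le> c * \<eta>0 * A k" by linarith
    then have 3: "3 \<le> c * (\<eta>0 / 2 ^ k) * A k" by (simp add: field_simps)
    have "x (Suc k) + 2 \<le> 3 * A k" using A1[of k] by (simp add: xS A_def)
    also have "\<dots> \<le> c * (\<eta>0 / 2 ^ k) * A k * A k" using 3 A1[of k] by (intro mult_right_mono) auto
    also have "\<dots> = c * (\<eta>0 / 2 ^ k) * (A k * A k)" by simp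
    also have "\<dots> \<le> c * (\<eta>0 / 2 ^ k) * \<phi> y" using \<phi>A[OF y] c \<eta>0 by (intro mult_left_mono) auto
    finally show "x (Suc k) + 2 \<le> c * (\<eta>0 / 2 ^ k) * \<phi> y" .
    have "T / (c * \<eta>0\<^sup>2) * 4 ^ k \<le> D * 4 ^ k" by (intro mult_right_mono) (auto simp: D_def)
    then have "T / (c * \<eta>0\<^sup>2) * 4 ^ k \<le> A k" using AD[of k] by linarith
    also have "\<dots> \<le> A k * A k" using A1[of k] by (simp add: mult_le_cancel_left1)
    also have "\<dots> \<le> \<phi> y" by (rule \<phi>A[OF y])
    finally have "T / (c * \<eta>0\<^sup>2) * 4 ^ k \<le> \<phi> y" .
    then have "T * 4 ^ k \<le> c * \<eta>0\<^sup>2 * \<phi> y" using c \<eta>0 by (simp add: field_simps)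
    then have "T \<le> c * \<eta>0\<^sup>2 * \<phi> y / 4 ^ k" by (simp add: field_simps)
    also have "\<dots> = c * \<phi> y * (\<eta>0 / 2 ^ k)\<^sup>2" by (simp add: power_divide p4 power2_eq_square)
    finally show "T \<le> c * \<phi> y * (\<eta>0 / 2 ^ k)\<^sup>2" .
  qed
qed

lemma closed_far: "closed {w. far \<eta> w}"
proof -
  have "{w. far \<eta> w} = (\<Inter>j\<in>{1..m}. \<Inter>l::int. {w. \<eta> \<le> \<bar>Im w - \<theta> j - 2 * pi * of_int l\<bar>})"
    by (auto simp: far_def)
  also have "closed \<dots>" by (intro closed_INT ballI closed_Collect_le continuous_intros)
  finally show ?thesis .
qed

lemma far_mono_dist:
  assumes "far \<eta>' w" "dist w v \<le> \<eta>' - \<eta>" shows "far \<eta> v"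
  unfolding far_def
proof (intro ballI allI)
  fix j l assume "j \<in> {1..m}"
  then have "\<eta>' \<le> \<bar>Im w - \<theta> j - 2 * pi * of_int l\<bar>" using assms(1) by (auto simp: far_def)
  moreover have "\<bar>Im w - Im v\<bar> \<le> \<eta>' - \<eta>" by (rule abs_Im_diff_le[OF assms(2)])
  ultimately show "\<eta> \<le> \<bar>Im v - \<theta> j - 2 * pi * of_int l\<bar>" by linarith
qed

text \<open>
The points that are not \<open>far\<close> lie in \<open>m\<close> periodic families of horizontal strips.
\<close>

lemma area_far_ge:
  assumes R: "R \<ge> 1" and \<eta>: "0 < \<eta>" "\<eta> \<le> 1"
  shows "(pi - 12 * real m * \<eta>) * R\<^sup>2 \<le> measure lebesgue (ball c R \<inter> {w. far \<eta> w})"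
proof -
  define S where "S = (\<lambda>j. {w \<in> ball c R. \<exists>l::int. \<bar>Im w - \<theta> j - 2 * pi * of_int l\<bar> < \<eta>})"
  have Sm: "S j \<in> lmeasurable" for j
  proof -
    have "S j = ball c R \<inter> (\<Union>l::int. {w. \<bar>Im w - \<theta> j - 2 * pi * of_int l\<bar> < \<eta>})" by (auto simp: S_def)
    also have "open \<dots>" by (intro open_Int open_ball open_UN ballI open_Collect_less continuous_intros)
    finally have "open (S j)" .
    moreover have "bounded (S j)" by (rule bounded_subset[OF bounded_ball[of c R]]) (auto simp: S_def)
    ultimately show ?thesis by (rule lmeasurable_open[rotated])
  qed
  have Fm: "ball c R \<inter> {w. far \<eta> w} \<in> lmeasurable"
    by (intro bounded_set_imp_lmeasurable bounded_Int disjI1 bounded_ball)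
       (use closed_far[of \<eta>] in \<open>auto intro!: sets.Int\<close>)
  have Um: "(\<Union>j\<in>{1..m}. S j) \<in> lmeasurable" by (intro fmeasurable.finite_UN Sm) simp
  have "pi * R\<^sup>2 = measure lebesgue (ball c R)"
    using R by (simp add: content_ball unit_ball_vol_2)
  also have "\<dots> \<le> measure lebesgue ((ball c R \<inter> {w. far \<eta> w}) \<union> (\<Union>j\<in>{1..m}. S j))"
  proof (rule measure_mono_fmeasurable[OF _ _ fmeasurable.Un[OF Fm Um]])
    show "ball c R \<subseteq> (ball c R \<inter> {w. far \<eta> w}) \<union> (\<Union>j\<in>{1..m}. S j)"
    proof
      fix w assume w: "w \<in> ball c R"
      show "w \<in> (ball c R \<inter> {w. far \<eta> w}) \<union> (\<Union>j\<in>{1..m}. S j)"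
      proof (cases "far \<eta> w")
        case False
        then obtain j l where "j \<in> {1..m}" "\<bar>Im w - \<theta> j - 2 * pi * of_int l\<bar> < \<eta>"
          unfolding far_def not_le[symmetric] by blast
        then show ?thesis using w unfolding S_def by blast
      qed (use w in blast)
    qed
  qed simp
  also have "\<dots> \<le> measure lebesgue (ball c R \<inter> {w. far \<eta> w}) + measure lebesgue (\<Union>j\<in>{1..m}. S j)"
    by (rule measure_Un_le) (use Fm Um in auto)
  also have "measure lebesgue (\<Union>j\<in>{1..m}. S j) \<le> (\<Sum>j\<in>{1..m}. measure lebesgue (S j))"
    by (rule measure_UNION_le) (use Sm in auto)
  also have "\<dots> \<le> (\<Sum>j\<in>{1..m}. 12 * \<eta> * R\<^sup>2)"
    unfolding S_def by (intro sum_mono area_horizontal_strips_le R \<eta>)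
  also have "\<dots> = 12 * real m * \<eta> * R\<^sup>2" by simp
  finally show ?thesis by (simp add: algebra_simps)
qed

end

lemma continuous_on_iterate:
  fixes f :: "complex \<Rightarrow> complex"
  assumes "f holomorphic_on UNIV" shows "continuous_on UNIV (f ^^ i)"
proof (induction i)
  case (Suc i)
  have "continuous_on (range (f ^^ i)) f"
    by (rule holomorphic_on_imp_continuous_on[OF holomorphic_on_subset[OF assms]]) simp
  from continuous_on_compose[OF Suc this] show ?case by simp
qed (simp add: id_def)

text \<open>
A closed set is a countable union of compact sets, and so is its continuous image.
\<close>

lemma exp_image_closed_borel:
  fixes A :: "complex set"
  assumes "closed A" shows "exp ` A \<in> sets borel"
proof -
  have "A = (\<Union>n::nat. A \<inter> cball 0 (real n))"
    using real_arch_simple by (auto simp: dist_norm)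
  then have "exp ` A = (\<Union>n::nat. exp ` (A \<inter> cball 0 (real n)))" by (metis image_UN)
  moreover have "closed (exp ` (A \<inter> cball 0 (real n)))" for n
    by (intro compact_imp_closed compact_continuous_image continuous_intros closed_Int_compact assms compact_cball)
  ultimately show ?thesis by (simp add: sets.countable_UN)
qed

section \<open>Density of the points that stay in the good region\<close>

text \<open>
The constants and scales of the construction. At time \<open>k\<close> an orbit has to have real part at least \<open>x k\<close> and
distance at least \<open>\<eta>0 / 2\<^sup>k\<close> from the exceptional lines; then the next image is far enough to the right and discs
of radius \<open>\<sigma> (\<eta>0 / 2\<^sup>k)\<^sup>2\<close> expand by a large factor. The bound on \<open>\<eta>0\<close> makes the total loss of area at
most one half.
\<close>

locale staged_growth = regular_growth +
  fixes c C' \<eta>0 \<sigma> :: real and x :: "nat \<Rightarrow> real"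
  assumes c_pos: "c > 0" and C'_pos: "C' > 0"
    and \<eta>0: "0 < \<eta>0" "\<eta>0 \<le> 1 / (32 * (real m + 1))"
    and \<sigma>: "\<sigma> = min (1 / 8) (c / C')"
    and log_exists: "\<And>k w. x k + 1 \<le> Re w \<Longrightarrow> far (\<eta>0 / 2 ^ k) w \<Longrightarrow> \<exists>L. good_log c C' (\<eta>0 / 2 ^ k) w L"
    and x_ge: "\<And>k. real k \<le> x k"
    and x_next: "\<And>k y. x k \<le> y \<Longrightarrow> x (Suc k) + 2 \<le> c * (\<eta>0 / 2 ^ k) * \<phi> y"
    and small_values: "\<And>k y. x k \<le> y \<Longrightarrow> \<exists>w. \<bar>Re w - y\<bar> < 2 \<and> norm (E w) \<le> 1"
    and \<phi>_big: "\<And>k y. x k \<le> y \<Longrightarrow> 20 / \<sigma> \<le> c * \<phi> y * (\<eta>0 / 2 ^ k)\<^sup>2"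
begin

definition \<eta> :: "nat \<Rightarrow> real" where "\<eta> k = \<eta>0 / 2 ^ k"

definition radius :: "nat \<Rightarrow> real" where "radius k = \<sigma> * (\<eta> k)\<^sup>2"

lemma \<eta>_Suc: "\<eta> (Suc k) = \<eta> k / 2" by (simp add: \<eta>_def)

lemma \<eta>_pos: "\<eta> k > 0" using \<eta>0 by (simp add: \<eta>_def)

lemma \<eta>_le: "\<eta> k \<le> 1 / 32"
proof -
  have "\<eta> k \<le> \<eta>0 / 1" unfolding \<eta>_def using \<eta>0 by (intro divide_left_mono) auto
  also have "\<eta>0 \<le> 1 / (32 * (real m + 1))" by (rule \<eta>0(2))
  also have "\<dots> \<le> 1 / 32" by (simp add: field_simps)
  finally show ?thesis by simp
qed

lemma \<sigma>_pos: "\<sigma> > 0" and \<sigma>_le: "\<sigma> \<le> 1 / 8" "C' * \<sigma> \<le> c"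
proof -
  show "\<sigma> > 0" using c_pos C'_pos by (simp add: \<sigma>)
  show "\<sigma> \<le> 1 / 8" unfolding \<sigma> by (rule min.cobounded1)
  have "C' * \<sigma> \<le> C' * (c / C')" unfolding \<sigma> using C'_pos by (intro mult_left_mono) auto
  then show "C' * \<sigma> \<le> c" using C'_pos by simp
qed

lemma radius_pos: "radius k > 0" using \<sigma>_pos \<eta>_pos[of k] by (simp add: radius_def)

lemma radius_le: "radius k \<le> \<eta> k / 8" "radius k \<le> 1 / 8" "radius (Suc k) \<le> 2 * radius k"
proof -
  have "radius k \<le> 1 / 8 * (\<eta> k)\<^sup>2" unfolding radius_def using \<sigma>_le by (intro mult_right_mono) auto
  also have "(\<eta> k)\<^sup>2 \<le> 1 * \<eta> k" unfolding power2_eq_square using \<eta>_le[of k] \<eta>_pos[of k] by (intro mult_right_mono) auto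
  finally show 1: "radius k \<le> \<eta> k / 8" by simp
  then show "radius k \<le> 1 / 8" using \<eta>_le[of k] by simp
  have "radius (Suc k) = radius k / 4" by (simp add: radius_def \<eta>_Suc power_divide)
  then show "radius (Suc k) \<le> 2 * radius k" using radius_pos[of k] by simp
qed

text \<open>
Two nested sets are used: orbits have to consist of \<open>good_points k\<close>, and the density estimates are proved for
discs centred at the smaller set \<open>core_points k\<close>, so that these discs consist of good points.
\<close>

definition good_points :: "nat \<Rightarrow> complex set" where "good_points k = {w. x k + 1 \<le> Re w \<and> far (\<eta> k) w}"

definition core_points :: "nat \<Rightarrow> complex set" where "core_points k = {w. x k + 2 \<le> Re w \<and> far (2 * \<eta> k) w}"

lemma closed_good_points: "closed (good_points k)" and closed_core_points: "closed (core_points k)"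
proof -
  have "good_points k = {w. x k + 1 \<le> Re w} \<inter> {w. far (\<eta> k) w}" unfolding good_points_def by blast
  then show "closed (good_points k)" using closed_halfspace_Re_ge closed_far by (simp add: closed_Int)
  have "core_points k = {w. x k + 2 \<le> Re w} \<inter> {w. far (2 * \<eta> k) w}" unfolding core_points_def by blast
  then show "closed (core_points k)" using closed_halfspace_Re_ge closed_far by (simp add: closed_Int)
qed

lemma core_points_ball: assumes "w \<in> core_points k" shows "ball w (radius k) \<subseteq> good_points k" "w \<in> good_points k"
proof -
  show sub: "ball w (radius k) \<subseteq> good_points k"
  proof
    fix v assume v: "v \<in> ball w (radius k)"
    then have d: "dist w v \<le> 2 * \<eta> k - \<eta> k" "dist w v \<le> 1" using radius_le[of k] \<eta>_pos[of k] by auto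
    have w: "x k + 2 \<le> Re w" "far (2 * \<eta> k) w" using assms by (simp_all add: core_points_def)
    have "far (\<eta> k) v" by (rule far_mono_dist[OF w(2) d(1)])
    moreover have "x k + 1 \<le> Re v" using abs_Re_diff_le[OF d(2)] w(1) by linarith
    ultimately show "v \<in> good_points k" by (simp add: good_points_def)
  qed
  show "w \<in> good_points k" using sub radius_pos[of k] by auto
qed

text \<open>
The radius is of order \<open>\<eta>\<^sup>2\<close>, so the derivative varies by a relative amount of at most \<open>\<eta>\<close> on the disc, and this is summable over \<open>k\<close>. The
number 20 leaves room for an image disc of radius 10, which contains a full vertical period.
\<close>

lemma good_points_log:
  assumes w: "w \<in> good_points k"
  shows "\<exists>L d. L holomorphic_on ball w (radius k) \<and> (\<forall>v\<in>ball w (radius k). exp (L v) = E v \<and> x (Suc k) + 2 \<le> Re (L v) \<and>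
      norm (deriv L v - d) \<le> \<eta> k * norm d) \<and> 20 \<le> norm d * radius k"
proof -
  have xw: "x k \<le> Re w" using w by (simp add: good_points_def)
  obtain L where L: "good_log c C' (\<eta> k) w L" using log_exists[of k w] w by (auto simp: good_points_def \<eta>_def)
  define d where "d = deriv L w"
  have d: "c * \<phi> (Re w) \<le> norm d" using L by (simp add: good_log_def d_def)
  have sub: "ball w (radius k) \<subseteq> ball w (\<eta> k / 8)" using radius_le by (intro subset_ball) auto
  have 1: "norm (deriv L v - d) \<le> \<eta> k * norm d" if v: "v \<in> ball w (radius k)" for v
  proof -
    have "norm (deriv L v - d) \<le> C' / \<eta> k * \<phi> (Re w) * norm (v - w)"
      using L v sub by (auto simp: good_log_def d_def)
    also have "\<dots> \<le> C' / \<eta> k * \<phi> (Re w) * radius k"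
      using v C'_pos \<eta>_pos[of k] \<phi>_pos[of "Re w"]
      by (intro mult_left_mono) (auto simp: dist_norm norm_minus_commute)
    also have "\<dots> = (C' * \<sigma>) * \<phi> (Re w) * \<eta> k" using \<eta>_pos[of k] by (simp add: radius_def power2_eq_square)
    also have "\<dots> \<le> c * \<phi> (Re w) * \<eta> k" using \<sigma>_le \<phi>_pos[of "Re w"] \<eta>_pos[of k] by (intro mult_right_mono) auto
    also have "\<dots> \<le> norm d * \<eta> k" using d \<eta>_pos[of k] by (intro mult_right_mono) auto
    finally show ?thesis by (simp add: mult.commute)
  qed
  have "20 = (20 / \<sigma>) * \<sigma>" using \<sigma>_pos by simp
  also have "\<dots> \<le> c * \<phi> (Re w) * (\<eta> k)\<^sup>2 * \<sigma>"
    using \<phi>_big[OF xw] \<sigma>_pos unfolding \<eta>_def by (intro mult_right_mono) auto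
  also have "\<dots> \<le> norm d * (\<eta> k)\<^sup>2 * \<sigma>" using d \<sigma>_pos by (intro mult_right_mono) auto
  finally have 2: "20 \<le> norm d * radius k" by (simp add: radius_def mult_ac)
  have 3: "x (Suc k) + 2 \<le> Re (L v)" "exp (L v) = E v" if v: "v \<in> ball w (radius k)" for v
  proof -
    have "x (Suc k) + 2 \<le> c * \<eta> k * \<phi> (Re w)" using x_next[OF xw] by (simp add: \<eta>_def)
    also have "\<dots> \<le> Re (L v)" using L v sub by (auto simp: good_log_def)
    finally show "x (Suc k) + 2 \<le> Re (L v)" .
    show "exp (L v) = E v" using L v sub by (auto simp: good_log_def)
  qed
  have "L holomorphic_on ball w (radius k)" using L sub holomorphic_on_subset by (auto simp: good_log_def)
  with 1 2 3 show ?thesis by blast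
qed

lemma log_covers:
  assumes L: "L holomorphic_on ball w (radius k)" and d: "\<And>v. v \<in> ball w (radius k) \<Longrightarrow> norm (deriv L v - d) \<le> \<eta> k * norm d"
    and big: "20 \<le> norm d * radius k" and t: "0 < t" "t \<le> radius k"
  shows "ball (L w) ((1 - \<eta> k) * norm d * t) \<subseteq> L ` ball w t"
proof (rule nearly_affine_covers_ball)
  have sub: "ball w t \<subseteq> ball w (radius k)" using t by (intro subset_ball)
  show "L holomorphic_on ball w t" by (rule holomorphic_on_subset[OF L sub])
  show "d \<noteq> 0" using big by auto
  show "norm (deriv L v - d) \<le> \<eta> k * norm d" if "v \<in> ball w t" for v using d sub that by blast
qed (use t \<eta>_le[of k] in auto)

text \<open>
Passing to the plane of \<open>z = e\<^sup>w\<close> makes the condition independent of the choice of the logarithm \<open>w\<close>.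
\<close>

definition good_region :: "nat \<Rightarrow> complex set" where "good_region k = exp ` good_points k"

definition survivors :: "nat \<Rightarrow> nat \<Rightarrow> complex set" where
  "survivors k n = {w. \<forall>i\<le>n. (f ^^ i) (exp w) \<in> good_region (k + i)}"

lemma survivors_borel: "survivors k n \<in> sets borel"
proof -
  have cont: "continuous_on UNIV (\<lambda>w. (f ^^ i) (exp w))" for i
  proof -
    have "continuous_on UNIV (exp :: complex \<Rightarrow> complex)" by (intro continuous_intros)
    moreover have "continuous_on (range (exp :: complex \<Rightarrow> complex)) (f ^^ i)"
      by (rule continuous_on_subset[OF continuous_on_iterate[OF f_holo]]) simp
    ultimately have "continuous_on UNIV ((f ^^ i) \<circ> exp)" by (rule continuous_on_compose)
    then show ?thesis by (simp add: o_def)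
  qed
  have "survivors k n = (\<Inter>i\<in>{..n}. (\<lambda>w. (f ^^ i) (exp w)) -` good_region (k + i))"
    by (auto simp: survivors_def)
  moreover have "(\<lambda>w. (f ^^ i) (exp w)) -` good_region (k + i) \<in> sets borel" for i
    using measurable_sets[OF borel_measurable_continuous_onI[OF cont], of "good_region (k + i)" i]
      exp_image_closed_borel[OF closed_good_points] by (simp add: good_region_def)
  ultimately show ?thesis by (auto intro!: sets.finite_INT)
qed

text \<open>
The bookkeeping of one step: with \<open>u = 2\<^bsup>-k\<^esup>\<close>, the density guaranteed at time \<open>k\<close> is \<open>1 - u / 2\<close>, the one at
time \<open>k + 1\<close> is \<open>1 - u / 4\<close>; \<open>\<beta>\<close> is the proportion of the image that is lost and \<open>\<tau>\<close> the distortion.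
\<close>

lemma density_arithmetic:
  fixes \<tau> \<beta> u :: real
  assumes "0 \<le> \<tau>" "\<tau> \<le> 1/4" "0 \<le> \<beta>" "\<beta> \<le> 1" "\<beta> + 4 * \<tau> \<le> u / 4" "0 \<le> u" "u \<le> 1"
  shows "1 - u / 2 \<le> (1 - u / 4) * (1 - \<beta>) * ((1 - \<tau>) / (1 + \<tau>))\<^sup>2"
proof -
  have t: "1 + \<tau> > 0" using assms by simp
  have "(1 - 2 * \<tau>) * (1 + \<tau>) \<le> 1 - \<tau>" using zero_le_square[of \<tau>] by (simp add: algebra_simps)
  then have "1 - 2 * \<tau> \<le> (1 - \<tau>) / (1 + \<tau>)" by (simp only: pos_le_divide_eq[OF t])
  then have "(1 - 2 * \<tau>)\<^sup>2 \<le> ((1 - \<tau>) / (1 + \<tau>))\<^sup>2" using assms by (intro power_mono) auto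
  moreover have "1 - 4 * \<tau> \<le> (1 - 2 * \<tau>)\<^sup>2" using zero_le_square[of \<tau>] by (simp add: power2_eq_square algebra_simps)
  ultimately have "1 - 4 * \<tau> \<le> ((1 - \<tau>) / (1 + \<tau>))\<^sup>2" by linarith
  then have "(1 - \<beta>) * (1 - 4 * \<tau>) \<le> (1 - \<beta>) * ((1 - \<tau>) / (1 + \<tau>))\<^sup>2" using assms by (intro mult_left_mono) auto
  moreover have "1 - (\<beta> + 4 * \<tau>) \<le> (1 - \<beta>) * (1 - 4 * \<tau>)" using mult_nonneg_nonneg[OF assms(3,1)] by (simp add: algebra_simps)
  ultimately have "1 - u / 4 \<le> (1 - \<beta>) * ((1 - \<tau>) / (1 + \<tau>))\<^sup>2" using assms by linarith
  then have "(1 - u / 4) * (1 - u / 4) \<le> (1 - u / 4) * ((1 - \<beta>) * ((1 - \<tau>) / (1 + \<tau>))\<^sup>2)"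
    using assms by (intro mult_left_mono) auto
  moreover have "1 - u / 2 \<le> (1 - u / 4) * (1 - u / 4)" using zero_le_square[of u] by (simp add: algebra_simps)
  ultimately show ?thesis by (simp add: mult.assoc)
qed

text \<open>
In a disc of radius \<open>\<rho> \<ge> 10\<close> far to the right, the centres whose small discs stay inside and which are far from
the exceptional lines fill everything up to a proportion \<open>O(\<eta>)\<close>.
\<close>

lemma area_core_points_in_image:
  assumes \<rho>: "\<rho> \<ge> 10" and re: "\<And>a. a \<in> ball b \<rho> \<Longrightarrow> x (Suc k) + 2 \<le> Re a"
  shows "(1 - (8 * real m + 2) * \<eta> (Suc k)) * (pi * \<rho>\<^sup>2) \<le> measure lebesgue (ball b (\<rho> - radius (Suc k)) \<inter> core_points (Suc k))"
proof -
  define e where "e = \<eta> (Suc k)"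
  define R where "R = \<rho> - radius (Suc k)"
  have e: "0 < e" "e \<le> 1 / 32" using \<eta>_pos \<eta>_le by (auto simp: e_def)
  have se: "0 < radius (Suc k)" "radius (Suc k) \<le> e / 8" "radius (Suc k) \<le> 1 / 8" using radius_pos radius_le by (auto simp: e_def)
  have R: "1 \<le> R" using \<rho> se by (simp add: R_def)
  have "(1 - e) * \<rho> \<le> R"
  proof -
    have "radius (Suc k) \<le> e * \<rho>" using se(2) \<rho> e mult_left_mono[of 10 \<rho> e] by linarith
    then show ?thesis by (simp add: R_def algebra_simps)
  qed
  then have "((1 - e) * \<rho>)\<^sup>2 \<le> R\<^sup>2" using e \<rho> by (intro power_mono) auto
  then have R2: "(1 - e)\<^sup>2 * \<rho>\<^sup>2 \<le> R\<^sup>2" by (simp add: power_mult_distrib)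
  have me: "24 * real m * e \<le> 3 / 4"
  proof -
    have "e \<le> \<eta>0 / 1" unfolding e_def \<eta>_def using \<eta>0 one_le_power[of "2::real" "Suc k"]
      by (intro divide_left_mono) auto
    then have "e \<le> \<eta>0" by simp
    also note \<eta>0(2)
    finally have "e * (32 * (real m + 1)) \<le> 1" by (simp add: field_simps)
    then show ?thesis using e by (simp add: algebra_simps)
  qed
  have mpi: "0 \<le> pi - 24 * real m * e" using me pi_gt3 by linarith
  have "(1 - (8 * real m + 2) * e) * (pi * \<rho>\<^sup>2) \<le> (pi - 24 * real m * e) * ((1 - e)\<^sup>2 * \<rho>\<^sup>2)"
  proof -
    have "1 - 2 * e \<le> (1 - e)\<^sup>2" by (simp add: power2_eq_square algebra_simps)
    moreover have "pi * (1 - 8 * real m * e) \<le> pi - 24 * real m * e"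
    proof -
      have "24 * real m * e = 3 * (8 * real m * e)" by simp
      also have "\<dots> \<le> pi * (8 * real m * e)" using pi_gt3 e by (intro mult_right_mono) auto
      finally show ?thesis by (simp add: algebra_simps)
    qed
    moreover have "0 \<le> pi - 24 * real m * e" "0 \<le> 1 - 2 * e" using me e pi_gt3 by linarith+
    ultimately have "(pi * (1 - 8 * real m * e)) * (1 - 2 * e) \<le> (pi - 24 * real m * e) * (1 - e)\<^sup>2"
      by (intro mult_mono)
    moreover have "pi * (1 - (8 * real m + 2) * e) \<le> (pi * (1 - 8 * real m * e)) * (1 - 2 * e)"
      using e by (simp add: algebra_simps)
    ultimately have "pi * (1 - (8 * real m + 2) * e) \<le> (pi - 24 * real m * e) * (1 - e)\<^sup>2" by linarith
    then have "pi * (1 - (8 * real m + 2) * e) * \<rho>\<^sup>2 \<le> (pi - 24 * real m * e) * (1 - e)\<^sup>2 * \<rho>\<^sup>2"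
      by (intro mult_right_mono) auto
    then show ?thesis by (simp add: mult_ac)
  qed
  also have "\<dots> \<le> (pi - 24 * real m * e) * R\<^sup>2" using R2 mpi by (intro mult_left_mono)
  also have "\<dots> = (pi - 12 * real m * (2 * e)) * R\<^sup>2" by simp
  also have "\<dots> \<le> measure lebesgue (ball b R \<inter> {w. far (2 * e) w})"
    using e by (intro area_far_ge R) auto
  also have "ball b R \<inter> {w. far (2 * e) w} = ball b R \<inter> core_points (Suc k)"
  proof -
    have "ball b R \<subseteq> ball b \<rho>" using se by (intro subset_ball) (simp add: R_def)
    then show ?thesis using re by (auto simp: core_points_def e_def)
  qed
  finally show ?thesis by (simp add: e_def R_def)
qed

text \<open>
By induction on the number of further steps, simultaneously for all times \<open>k\<close> and centres. The image of the disc
\<open>ball w (radius k)\<close> under the branch \<open>L\<close> contains a disc of radius \<open>\<rho>\<close>. Almost all of its points are centres to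
which the induction hypothesis applies, so averaging gives the density of the survivors in it. These are images of
survivors in the original disc, and \<open>L\<close> multiplies area by at most \<open>M\<^sup>2\<close>, where \<open>M / \<rho>\<close> is close to
the reciprocal of the radius.
\<close>

lemma survivor_density:
  "w \<in> core_points k \<Longrightarrow> (1 - (1 / 2 ^ k) / 2) * measure lebesgue (ball (0::complex) (radius k)) \<le> measure lebesgue (survivors k n \<inter> ball w (radius k))"
proof (induction n arbitrary: k w)
  case (0 k w)
  have "exp v \<in> good_region k" if "v \<in> ball w (radius k)" for v using core_points_ball(1)[OF 0] that by (auto simp: good_region_def)
  then have "survivors k 0 \<inter> ball w (radius k) = ball w (radius k)" by (auto simp: survivors_def)
  moreover have "(1 - (1 / 2 ^ k) / 2) * measure lebesgue (ball (0::complex) (radius k)) \<le> 1 * measure lebesgue (ball (0::complex) (radius k))"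
    by (intro mult_right_mono) auto
  ultimately show ?case using radius_pos[of k] by (simp add: content_ball)
next
  case (Suc n k w)
  obtain L d where L: "L holomorphic_on ball w (radius k)" and Lexp: "\<And>v. v \<in> ball w (radius k) \<Longrightarrow> exp (L v) = E v"
    and Lre: "\<And>v. v \<in> ball w (radius k) \<Longrightarrow> x (Suc k) + 2 \<le> Re (L v)"
    and dL: "\<And>v. v \<in> ball w (radius k) \<Longrightarrow> norm (deriv L v - d) \<le> \<eta> k * norm d" and big: "20 \<le> norm d * radius k"
    using good_points_log[OF core_points_ball(2)[OF Suc.prems]] by blast
  define \<rho> where "\<rho> = (1 - \<eta> k) * norm d * radius k"
  have \<eta>k: "0 < \<eta> k" "\<eta> k \<le> 1/32" using \<eta>_pos \<eta>_le by auto
  have cover: "ball (L w) \<rho> \<subseteq> L ` ball w (radius k)" unfolding \<rho>_def by (rule log_covers[OF L dL big radius_pos order_refl])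
  have \<rho>10: "\<rho> \<ge> 10"
  proof -
    \<comment> \<open>from radius 1 on the strips occupy a proportion \<open>O(\<eta>)\<close> of a disc; a radius of 10 is also large compared with the radius of the next discs\<close>
    have "1/2 * 20 \<le> (1 - \<eta> k) * (norm d * radius k)" using big \<eta>k by (intro mult_mono) auto
    then show ?thesis by (simp add: \<rho>_def mult.assoc)
  qed
  have re: "x (Suc k) + 2 \<le> Re a" if "a \<in> ball (L w) \<rho>" for a using cover that Lre by blast
  define K where "K = survivors (Suc k) n"
  define A where "A = ball (L w) (\<rho> - radius (Suc k)) \<inter> core_points (Suc k)"
  define p where "p = 1 - (1 / (2::real) ^ Suc k) / 2"
  define u where "u = 1 / (2::real) ^ k"
  have u: "0 < u" "u \<le> 1" by (simp_all add: u_def)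
  have pu: "p = 1 - u / 4" by (simp add: p_def u_def)
  with u have p: "p \<ge> 0" by linarith
  have Kb: "K \<in> sets borel" unfolding K_def by (rule survivors_borel)
  have Ab: "A \<in> sets borel" unfolding A_def by (intro sets.Int borel_open open_ball borel_closed closed_core_points)
  have AB: "ball a (radius (Suc k)) \<subseteq> ball (L w) \<rho>" if "a \<in> A" for a
    using that unfolding A_def ball_subset_ball_iff by (auto simp: dist_commute)
  have dens: "p * measure lebesgue (ball (0::complex) (radius (Suc k))) \<le> measure lebesgue (K \<inter> ball a (radius (Suc k)))" if "a \<in> A" for a
    using Suc.IH[of a "Suc k"] that unfolding A_def K_def p_def by blast
  have KB: "p * measure lebesgue A \<le> measure lebesgue (K \<inter> ball (L w) \<rho>)"
    by (rule density_average[OF Kb Ab radius_pos p AB dens])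
  define S where "S = survivors k (Suc n) \<inter> ball w (radius k)"
  define M where "M = (1 + \<eta> k) * norm d"
  have d0: "norm d > 0" using big radius_pos[of k] by (smt (verit) mult_nonpos_nonneg)
  have M: "M > 0" using d0 \<eta>k by (simp add: M_def)
  have TS: "K \<inter> ball (L w) \<rho> \<subseteq> L ` S"
  proof
    fix y assume y: "y \<in> K \<inter> ball (L w) \<rho>"
    then obtain v where v: "v \<in> ball w (radius k)" "y = L v" using cover by blast
    have "(f ^^ i) (exp v) \<in> good_region (k + i)" if i: "i \<le> Suc n" for i
    proof (cases i)
      case 0 then show ?thesis using core_points_ball(1)[OF Suc.prems] v by (auto simp: good_region_def)
    next
      case (Suc i')
      have "(f ^^ i') (exp y) \<in> good_region (Suc k + i')" using y i Suc by (simp add: K_def survivors_def)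
      moreover have "exp y = f (exp v)" using Lexp[OF v(1)] v(2) by (simp add: E_def)
      ultimately show ?thesis using Suc by (simp add: funpow_swap1)
    qed
    then show "y \<in> L ` S" using v by (auto simp: S_def survivors_def)
  qed
  have area: "measure lebesgue (K \<inter> ball (L w) \<rho>) \<le> M\<^sup>2 * measure lebesgue S"
  proof (rule area_Lipschitz_image_le[OF _ _ open_ball _ TS M])
    show "S \<in> lmeasurable" unfolding S_def
      by (intro bounded_set_imp_lmeasurable bounded_Int disjI2 bounded_ball) (use survivors_borel[of k "Suc n"] in auto)
    show "K \<inter> ball (L w) \<rho> \<in> lmeasurable"
      by (intro bounded_set_imp_lmeasurable bounded_Int disjI2 bounded_ball) (use Kb in auto)
    show "S \<subseteq> ball w (radius k)" by (simp add: S_def)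
    show "norm (L a - L b) \<le> M * norm (a - b)" if "a \<in> ball w (radius k)" "b \<in> ball w (radius k)" for a b
      unfolding M_def by (rule nearly_affine(1)[OF L dL that])
  qed
  define \<beta> where "\<beta> = (8 * real m + 2) * \<eta> (Suc k)"
  have mass: "measure lebesgue (ball (0::complex) (radius k)) = pi * (radius k)\<^sup>2" using radius_pos[of k] by (simp add: content_ball unit_ball_vol_2)
  have \<rho>M: "\<rho>\<^sup>2 = M\<^sup>2 * (((1 - \<eta> k) / (1 + \<eta> k))\<^sup>2 * (radius k)\<^sup>2)"
  proof -
    have "\<rho> = M * ((1 - \<eta> k) / (1 + \<eta> k) * radius k)" using \<eta>k by (simp add: \<rho>_def M_def)
    then show ?thesis by (simp only: power_mult_distrib)
  qed
  have "(1 - \<beta>) * (pi * \<rho>\<^sup>2) \<le> measure lebesgue A"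
    unfolding \<beta>_def A_def by (rule area_core_points_in_image[OF \<rho>10 re])
  then have "p * ((1 - \<beta>) * (pi * \<rho>\<^sup>2)) \<le> p * measure lebesgue A" using p by (intro mult_left_mono)
  also note KB
  also note area
  finally have "M\<^sup>2 * (p * (1 - \<beta>) * ((1 - \<eta> k) / (1 + \<eta> k))\<^sup>2 * (pi * (radius k)\<^sup>2)) \<le> M\<^sup>2 * measure lebesgue S"
    unfolding \<rho>M by (simp add: mult_ac)
  then have fin: "p * (1 - \<beta>) * ((1 - \<eta> k) / (1 + \<eta> k))\<^sup>2 * (pi * (radius k)\<^sup>2) \<le> measure lebesgue S" using M by simp
  have \<eta>u: "\<eta> k = \<eta>0 * u" by (simp add: \<eta>_def u_def)
  have "\<beta> + 4 * \<eta> k = (4 * real m + 5) * \<eta>0 * u" by (simp add: \<beta>_def \<eta>_Suc \<eta>u algebra_simps)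
  also have "\<dots> \<le> 1 / 4 * u"
  proof (rule mult_right_mono)
    have "(4 * real m + 5) * \<eta>0 \<le> (8 * (real m + 1)) * (1 / (32 * (real m + 1)))"
      using \<eta>0 m_ge by (intro mult_mono) auto
    also have "\<dots> = 1 / 4" by (simp add: field_simps)
    finally show "(4 * real m + 5) * \<eta>0 \<le> 1 / 4" .
  qed (use u in simp)
  finally have b4: "\<beta> + 4 * \<eta> k \<le> u / 4" by simp
  have \<beta>0: "0 \<le> \<beta>" using \<eta>_pos[of "Suc k"] by (simp add: \<beta>_def)
  have "1 - u / 2 \<le> (1 - u / 4) * (1 - \<beta>) * ((1 - \<eta> k) / (1 + \<eta> k))\<^sup>2"
    by (rule density_arithmetic) (use \<eta>k u b4 \<beta>0 in auto)
  then have "(1 - u / 2) * (pi * (radius k)\<^sup>2) \<le> (1 - u / 4) * (1 - \<beta>) * ((1 - \<eta> k) / (1 + \<eta> k))\<^sup>2 * (pi * (radius k)\<^sup>2)"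
    by (intro mult_right_mono) auto
  also have "\<dots> \<le> measure lebesgue S" using fin unfolding pu .
  finally show ?case unfolding mass S_def u_def .
qed

section \<open>The surviving points escape and lie in the Julia set\<close>

lemma core_points_nonempty: "\<exists>w. w \<in> core_points 0"
proof -
  define b where "b = Complex (x 0 + 3) 0"
  have e: "0 < 2 * \<eta> 0" "2 * \<eta> 0 \<le> 1" using \<eta>_pos[of 0] \<eta>_le[of 0] by auto
  have "\<eta>0 * (32 * (real m + 1)) \<le> 1" using \<eta>0(2) by (simp add: field_simps)
  then have "24 * (real m * \<eta>0) \<le> 1" using \<eta>0(1) mult_nonneg_nonneg[of "real m" \<eta>0] by (simp add: algebra_simps)
  then have "0 < pi - 12 * real m * (2 * \<eta> 0)" using pi_gt3 by (simp add: \<eta>_def)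
  also have "\<dots> \<le> measure lebesgue (ball b 1 \<inter> {w. far (2 * \<eta> 0) w})"
    using area_far_ge[OF order_refl e, of b] by simp
  finally obtain w where w: "w \<in> ball b 1" "far (2 * \<eta> 0) w" by (metis (mono_tags) Int_Collect equals0I less_irrefl measure_empty)
  have "dist b w \<le> 1" using w by simp
  from abs_Re_diff_le[OF this] have "x 0 + 2 \<le> Re w" by (simp add: b_def)
  then show ?thesis using w by (auto simp: core_points_def)
qed

definition eternal_survivors :: "complex set" where "eternal_survivors = {w. \<forall>i. (f ^^ i) (exp w) \<in> good_region i}"

lemma eternal_survivors_positive_area:
  assumes w: "w \<in> core_points 0"
  shows "0 < emeasure lebesgue (eternal_survivors \<inter> ball w (radius 0))"
proof -
  define A where "A = (\<lambda>n. survivors 0 n \<inter> ball w (radius 0))"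
  define v where "v = measure lebesgue (ball (0::complex) (radius 0))"
  have v: "v > 0" using radius_pos by (simp add: v_def)
  have eq: "eternal_survivors \<inter> ball w (radius 0) = (\<Inter>n. A n)" by (auto simp: eternal_survivors_def survivors_def A_def)
  have Am: "A n \<in> lmeasurable" for n
    unfolding A_def by (intro bounded_set_imp_lmeasurable bounded_Int disjI2 bounded_ball)
      (use survivors_borel[of 0 n] in auto)
  have dec: "decseq A" unfolding decseq_def A_def survivors_def by force
  have low: "ennreal (v / 2) \<le> emeasure lebesgue (A n)" for n
  proof -
    have "v / 2 \<le> measure lebesgue (A n)" using survivor_density[OF w, of n] by (simp add: v_def A_def)
    then show ?thesis by (simp add: emeasure_eq_measure2[OF Am] ennreal_leI)
  qed
  have "(\<lambda>n. emeasure lebesgue (A n)) \<longlonglongrightarrow> emeasure lebesgue (\<Inter>n. A n)"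
  proof (rule Lim_emeasure_decseq[OF _ dec])
    show "range A \<subseteq> sets lebesgue" using Am by auto
    show "emeasure lebesgue (A n) \<noteq> \<infinity>" for n using Am[of n] by (auto simp: fmeasurable_def)
  qed
  then have "ennreal (v / 2) \<le> emeasure lebesgue (\<Inter>n. A n)"
    by (rule LIMSEQ_le_const) (use low in auto)
  moreover have "0 < ennreal (v / 2)" using v by simp
  ultimately show "0 < emeasure lebesgue (eternal_survivors \<inter> ball w (radius 0))" unfolding eq by (rule less_le_trans[rotated])
qed

lemma exp_eq_shift:
  assumes "exp a = exp (b :: complex)" shows "exp (u + (a - b)) = exp u"
  using assms by (simp add: exp_add exp_diff)

text \<open>
Expansion of \<open>f\<close> in terms of discs in the logarithmic plane. The lift \<open>w'\<close> of the image point need not be the value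
of the branch \<open>L\<close>; the two differ by a multiple of \<open>2 \<pi> i\<close>, the period of the exponential function.
\<close>

lemma image_covers:
  assumes w: "w \<in> good_points k" and w': "exp w' = E w" and t: "0 < t" "t \<le> radius k" and r: "r * radius k \<le> 16 * t"
  shows "exp ` ball w' r \<subseteq> f ` exp ` ball w t"
proof
  obtain L d where L: "L holomorphic_on ball w (radius k)" and Lexp: "\<And>v. v \<in> ball w (radius k) \<Longrightarrow> exp (L v) = E v"
    and dL: "\<And>v. v \<in> ball w (radius k) \<Longrightarrow> norm (deriv L v - d) \<le> \<eta> k * norm d" and big: "20 \<le> norm d * radius k"
    using good_points_log[OF w] by blast
  have "r \<le> (1 - \<eta> k) * norm d * t"
  proof -
    have "16 \<le> (1 - \<eta> k) * (norm d * radius k)"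
      using big \<eta>_le[of k] mult_mono[of "31/32" "1 - \<eta> k" 20 "norm d * radius k"] by simp
    then have "16 * t \<le> (1 - \<eta> k) * (norm d * radius k) * t" using t by (intro mult_right_mono) auto
    with r have "r * radius k \<le> ((1 - \<eta> k) * norm d * t) * radius k" by (simp add: mult_ac)
    then show ?thesis using radius_pos[of k] by simp
  qed
  then have cover: "ball (L w) r \<subseteq> L ` ball w t"
    using log_covers[OF L dL big t] subset_ball by (meson order_trans)
  fix y assume "y \<in> exp ` ball w' r"
  then obtain u where u: "dist w' u < r" "y = exp u" by auto
  have "exp (L w) = exp w'" using Lexp[of w] w' radius_pos[of k] by simp
  then have y: "y = exp (u + (L w - w'))" using u(2) exp_eq_shift by metis
  have "L w - (u + (L w - w')) = w' - u" by simp
  then have "u + (L w - w') \<in> ball (L w) r" using u(1) by (simp only: mem_ball dist_norm)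
  then obtain v where v: "v \<in> ball w t" "u + (L w - w') = L v" using cover by blast
  have "v \<in> ball w (radius k)" using v(1) t by auto
  then have "y = f (exp v)" using y v(2) Lexp by (simp add: E_def)
  then show "y \<in> f ` exp ` ball w t" using v(1) by blast
qed

text \<open>
A disc of radius 10 contains a full period of the vertical strip of width 4, and every such strip contains a small value.
\<close>

lemma small_value_near:
  assumes "x k \<le> Re w"
  shows "\<exists>y \<in> exp ` ball w 10. norm (f y) \<le> 1"
proof -
  obtain u where u: "\<bar>Re u - Re w\<bar> < 2" "norm (E u) \<le> 1" using small_values[OF assms] by blast
  define l where "l = \<lfloor>(Im w - Im u) / (2 * pi)\<rfloor>"
  have l: "of_int l \<le> (Im w - Im u) / (2 * pi)" "(Im w - Im u) / (2 * pi) < of_int l + 1" by (auto simp: l_def)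
  define u' where "u' = u + 2 * pi * of_int l * \<i>"
  have re: "Re u' = Re u" and im: "Im u' = Im u + 2 * pi * of_int l" by (simp_all add: u'_def)
  have "2 * pi * of_int l \<le> Im w - Im u" "Im w - Im u < 2 * pi * of_int l + 2 * pi" using l by (simp_all add: field_simps)
  then have "\<bar>Im w - Im u'\<bar> \<le> 2 * pi" unfolding im by linarith
  moreover have "\<bar>Re w - Re u'\<bar> < 2" using u(1) re by simp
  moreover have "norm (w - u') \<le> \<bar>Re w - Re u'\<bar> + \<bar>Im w - Im u'\<bar>" using cmod_le[of "w - u'"] by simp
  ultimately have "dist w u' < 10" using pi_less_4 by (simp add: dist_norm)
  moreover have "f (exp u') = E u" using E_periodic[of u l] by (simp add: E_def u'_def)
  ultimately show ?thesis using u(2) by (intro bexI[of _ "exp u'"]) auto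
qed

text \<open>
Discs around the orbit at least double their radius until they reach the size \<open>radius k\<close>; one step later they
contain discs of radius 10, hence points whose next image has modulus at most 1.
\<close>

lemma iterates_return:
  assumes surv: "\<And>i. (f ^^ i) z \<in> good_region i" and U: "open U" "z \<in> U"
  shows "\<exists>n0. \<forall>n\<ge>n0. \<exists>u\<in>U. norm ((f ^^ n) u) \<le> 1"
proof -
  have "\<forall>i. \<exists>v. v \<in> good_points i \<and> exp v = (f ^^ i) z" using surv by (force simp: good_region_def)
  then obtain v where v: "\<And>i. v i \<in> good_points i" "\<And>i. exp (v i) = (f ^^ i) z" by metis
  have vE: "exp (v (Suc i)) = E (v i)" for i using v(2)[of i] v(2)[of "Suc i"] by (simp add: E_def)
  have "open (exp -` U)" using U(1) by (intro open_vimage continuous_intros)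
  moreover have "v 0 \<in> exp -` U" using v(2)[of 0] U by simp
  ultimately obtain t1 where t1: "t1 > 0" "ball (v 0) t1 \<subseteq> exp -` U" by (meson openE)
  define t0 where "t0 = min t1 (radius 0)"
  have t0: "t0 > 0" "ball (v 0) t0 \<subseteq> exp -` U" using t1 radius_pos[of 0] by (auto simp: t0_def)
  define t where "t = (\<lambda>k. min (2 ^ k * t0) (radius k))"
  have tp: "0 < t k" "t k \<le> radius k" for k using t0 radius_pos[of k] by (auto simp: t_def)
  have grow: "exp ` ball (v k) (t k) \<subseteq> (f ^^ k) ` U" for k
  proof (induction k)
    case 0
    have "ball (v 0) (t 0) \<subseteq> ball (v 0) t0" by (intro subset_ball) (simp add: t_def)
    then show ?case using t0(2) by auto
  next
    case (Suc k)
    have "t (Suc k) \<le> 2 * t k"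
      using radius_le(3)[of k] by (auto simp: t_def min_def)
    moreover have "2 * t k * radius k \<le> 2 * t k * 8" using tp[of k] radius_le(2)[of k] by (intro mult_left_mono) auto
    moreover have "exp ` ball (v (Suc k)) (2 * t k) \<subseteq> f ` exp ` ball (v k) (t k)"
      by (rule image_covers[OF v(1) vE tp]) (use calculation in simp)
    ultimately have "exp ` ball (v (Suc k)) (t (Suc k)) \<subseteq> f ` exp ` ball (v k) (t k)"
      using subset_ball by (meson image_mono order_trans)
    also have "\<dots> \<subseteq> f ` (f ^^ k) ` U" using Suc by blast
    finally show ?case by (simp add: image_comp)
  qed
  obtain k0 where k0: "1 / t0 < 2 ^ k0" using real_arch_pow[of 2 "1 / t0"] by auto
  have full: "t k = radius k" if "k \<ge> k0" for k
  proof -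
    have "1 / t0 < 2 ^ k" by (rule less_le_trans[OF k0]) (rule power_increasing[OF that], simp)
    then have "1 < 2 ^ k * t0" using t0 by (simp add: field_simps)
    then show ?thesis using radius_le(2)[of k] by (simp add: t_def)
  qed
  have ret: "\<exists>u\<in>U. norm ((f ^^ Suc (Suc k)) u) \<le> 1" if k: "k \<ge> k0" for k
  proof -
    have "x (Suc k) \<le> Re (v (Suc k))" using v(1)[of "Suc k"] by (simp add: good_points_def)
    then obtain y where y: "y \<in> exp ` ball (v (Suc k)) 10" "norm (f y) \<le> 1" using small_value_near by blast
    have "exp ` ball (v (Suc k)) 10 \<subseteq> f ` exp ` ball (v k) (radius k)"
      by (rule image_covers[OF v(1) vE radius_pos order_refl]) (use radius_pos[of k] in simp)
    also have "\<dots> \<subseteq> f ` (f ^^ k) ` U" using grow[of k] full[OF k] by auto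
    finally obtain u where "u \<in> U" "y = f ((f ^^ k) u)" using y(1) by auto
    then show ?thesis using y(2) by auto
  qed
  show ?thesis
  proof (intro exI[of _ "k0 + 2"] allI impI)
    fix n assume n: "k0 + 2 \<le> n"
    then have "n = Suc (Suc (n - 2))" "k0 \<le> n - 2" by auto
    then show "\<exists>u\<in>U. norm ((f ^^ n) u) \<le> 1" using ret[of "n - 2"] by metis
  qed
qed

lemma norm_iterate_ge:
  assumes "(f ^^ i) z \<in> good_region i" shows "real i \<le> norm ((f ^^ i) z)"
proof -
  obtain v where v: "v \<in> good_points i" "(f ^^ i) z = exp v" using assms by (auto simp: good_region_def)
  have "real i \<le> Re v" using v(1) x_ge[of i] by (simp add: good_points_def)
  also have "\<dots> \<le> exp (Re v)" using exp_ge_add_one_self[of "Re v"] by linarith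
  finally show ?thesis using v(2) by simp
qed

text \<open>
A locally uniform finite limit is excluded since the orbit escapes, the limit \<open>\<infinity>\<close> since \<open>iterates_return\<close> produces
small values in each neighbourhood at all large times.
\<close>

lemma eternal_survivors_in_escaping_Julia:
  assumes w: "w \<in> eternal_survivors" shows "exp w \<in> escaping_set f \<inter> Julia_set f"
proof -
  define z where "z = exp w"
  have surv: "(f ^^ i) z \<in> good_region i" for i using w by (simp add: eternal_survivors_def z_def)
  note big = norm_iterate_ge[OF surv]
  have "filterlim (\<lambda>n. norm ((f ^^ n) z)) at_top sequentially"
    by (rule filterlim_at_top_mono[OF filterlim_real_sequentially]) (use big in auto)
  then have esc: "z \<in> escaping_set f"
    by (simp add: escaping_set_def filterlim_at_infinity_conv_norm_at_top)
  have "z \<notin> Fatou_set f"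
  proof
    assume "z \<in> Fatou_set f"
    then obtain U where U: "open U" "z \<in> U" and nf: "normal_family_on (range (\<lambda>n :: nat. f ^^ n)) U"
      by (auto simp: Fatou_set_def)
    obtain r where r: "strict_mono r" and lim: "(\<exists>l. \<forall>K. compact K \<and> K \<subseteq> U \<longrightarrow> uniform_limit K (\<lambda>n. f ^^ (r n)) l sequentially) \<or>
            (\<forall>K. compact K \<and> K \<subseteq> U \<longrightarrow> (\<forall>B :: real. \<forall>\<^sub>F n in sequentially. \<forall>z\<in>K. norm ((f ^^ (r n)) z) > B))"
      using nf[unfolded normal_family_on_def, rule_format, of "\<lambda>n. f ^^ n"] by blast
    have rn: "n \<le> r n" for n using r by (rule strict_mono_imp_increasing)
    show False
    proof (cases "\<exists>l. \<forall>K. compact K \<and> K \<subseteq> U \<longrightarrow> uniform_limit K (\<lambda>n. f ^^ (r n)) l sequentially")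
      case True
      then obtain l where l: "\<forall>K. compact K \<and> K \<subseteq> U \<longrightarrow> uniform_limit K (\<lambda>n. f ^^ (r n)) l sequentially" by blast
      have "compact {z} \<and> {z} \<subseteq> U" using U(2) by simp
      then have "uniform_limit {z} (\<lambda>n. f ^^ (r n)) l sequentially" using l by blast
      then have "(\<lambda>n. (f ^^ (r n)) z) \<longlonglongrightarrow> l z" by (rule tendsto_uniform_limitI) simp
      then have "(\<lambda>n. norm ((f ^^ (r n)) z)) \<longlonglongrightarrow> norm (l z)" by (rule tendsto_norm)
      then have "\<forall>\<^sub>F n in sequentially. norm ((f ^^ (r n)) z) < norm (l z) + 1"
        by (rule order_tendstoD) simp
      then obtain n0 where n0: "\<And>n. n \<ge> n0 \<Longrightarrow> norm ((f ^^ (r n)) z) < norm (l z) + 1"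
        unfolding eventually_sequentially by blast
      define n where "n = max n0 (nat \<lceil>norm (l z) + 1\<rceil>)"
      have "norm (l z) + 1 \<le> real n" unfolding n_def by linarith
      also have "\<dots> \<le> real (r n)" using rn by simp
      also have "\<dots> \<le> norm ((f ^^ (r n)) z)" by (rule big)
      finally show False using n0[of n] by (simp add: n_def)
    next
      case False
      then have inf: "\<And>K B. compact K \<Longrightarrow> K \<subseteq> U \<Longrightarrow> \<forall>\<^sub>F n in sequentially. \<forall>z\<in>K. norm ((f ^^ (r n)) z) > B"
        using lim by blast
      obtain d where d: "d > 0" "cball z d \<subseteq> U" using U open_contains_cball by blast
      obtain n1 where n1: "\<And>n u. n \<ge> n1 \<Longrightarrow> u \<in> cball z d \<Longrightarrow> norm ((f ^^ (r n)) u) > 1"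
        using inf[OF compact_cball d(2), of 1] unfolding eventually_sequentially by blast
      obtain n0 where n0: "\<And>n. n \<ge> n0 \<Longrightarrow> \<exists>u\<in>ball z d. norm ((f ^^ n) u) \<le> 1"
        using iterates_return[OF surv open_ball, of z d] d by auto
      define n where "n = max n0 n1"
      have "n0 \<le> r n" using rn[of n] by (simp add: n_def)
      then obtain u where "u \<in> ball z d" "norm ((f ^^ (r n)) u) \<le> 1" using n0 by blast
      then show False using n1[of n u] by (simp add: n_def)
    qed
  qed
  with esc show ?thesis by (simp add: Julia_set_def z_def)
qed

end

text \<open>
Measurability has to be shown since a set that is not measurable has the value \<open>0\<close> under \<open>emeasure\<close>.
\<close>

lemma escaping_Julia_borel:
  assumes "f holomorphic_on UNIV" shows "escaping_set f \<inter> Julia_set f \<in> sets borel"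
proof -
  note cont = continuous_on_iterate[OF assms]
  have "open (Fatou_set f)"
    unfolding open_subopen[of "Fatou_set f"] by (auto simp: Fatou_set_def)
  then have J: "Julia_set f \<in> sets borel" unfolding Julia_set_def by (intro borel_comp borel_open)
  have "escaping_set f = (\<Inter>B::nat. \<Union>N::nat. \<Inter>n\<in>{N..}. {z. norm ((f ^^ n) z) > real B})"
  proof -
    have *: "z \<in> escaping_set f \<longleftrightarrow> (\<forall>B::nat. \<exists>N. \<forall>n\<ge>N. norm ((f ^^ n) z) > real B)" for z
    proof -
      have "z \<in> escaping_set f \<longleftrightarrow> (\<forall>B. \<forall>\<^sub>F n in sequentially. norm ((f ^^ n) z) > B)"
        by (simp add: escaping_set_def filterlim_at_infinity_conv_norm_at_top filterlim_at_top_dense)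
      also have "\<dots> \<longleftrightarrow> (\<forall>B::nat. \<forall>\<^sub>F n in sequentially. norm ((f ^^ n) z) > real B)"
      proof safe
        fix B :: real assume *: "\<forall>B::nat. \<forall>\<^sub>F n in sequentially. norm ((f ^^ n) z) > real B"
        obtain b :: nat where "B \<le> real b" using real_arch_simple by blast
        with *[rule_format, of b] show "\<forall>\<^sub>F n in sequentially. norm ((f ^^ n) z) > B"
          by (auto elim: eventually_mono)
      qed auto
      finally show ?thesis by (simp add: eventually_sequentially)
    qed
    show ?thesis by (rule set_eqI) (simp only: * INT_iff UN_iff mem_Collect_eq Ball_def Bex_def atLeast_iff UNIV_I simp_thms)
  qed
  moreover have "{z. norm ((f ^^ n) z) > real B} \<in> sets borel" for n B
    by (intro borel_open open_Collect_less continuous_intros cont)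
  ultimately have "escaping_set f \<in> sets borel" by (auto intro!: sets.countable_INT sets.countable_UN sets.countable_INT')
  with J show ?thesis by (rule sets.Int[rotated])
qed

section \<open>Positive area\<close>

theorem theorem1p1:
  fixes m N :: nat
    and \<theta> :: "nat \<Rightarrow> real"
    and h :: "real \<Rightarrow> real"
    and f :: "complex \<Rightarrow> complex"
    and \<rho> :: "real \<Rightarrow> real"
  assumes "1 \<le> m" and "1 \<le> N"
    and "\<forall>j\<in>{1..m}. \<theta> j < \<theta> (j + 1)"
    and "\<theta> (m + 1) = \<theta> 1 + 2 * pi"
    and "continuous_on UNIV h"
    and "\<forall>j\<in>{1..m}. \<forall>t. \<theta> j < t \<and> t < \<theta> (j + 1) \<longrightarrow> h t > 0"
    and "f holomorphic_on UNIV"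
    and "proximate_order \<rho>"
    and "\<exists>C. \<forall>\<^sub>F r in at_top. \<forall>t\<in>{\<theta> 1..\<theta> (m + 1)}.
           (\<forall>j\<in>{1..m + 1}. \<bar>t - \<theta> j\<bar> > iter_log_eps N r) \<longrightarrow>
             f (of_real r * exp (\<i> * of_real t)) \<noteq> 0 \<and>
             \<bar>ln (norm (f (of_real r * exp (\<i> * of_real t)))) - h t * r powr \<rho> r\<bar>
               \<le> C * (r powr \<rho> r * iter_log_eps N r)"
  shows "emeasure lebesgue (escaping_set f \<inter> Julia_set f) > 0"
proof -
  note fh = assms(7)
  obtain \<rho>0 \<psi>' where \<rho>0: "\<rho>0 > 0" "(\<rho> \<longlongrightarrow> \<rho>0) at_top"
    and \<psi>': "\<forall>\<^sub>F x in at_top. ((\<lambda>x. x * \<rho> (exp x)) has_real_derivative \<psi>' x) (at x)" "(\<psi>' \<longlongrightarrow> \<rho>0) at_top"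
    using proximate_order_log_derivative[OF assms(8)] by blast
  obtain C where C: "\<forall>\<^sub>F r in at_top. \<forall>t\<in>{\<theta> 1..\<theta> (m + 1)}.
           (\<forall>j\<in>{1..m + 1}. \<bar>t - \<theta> j\<bar> > iter_log_eps N r) \<longrightarrow>
             f (of_real r * exp (\<i> * of_real t)) \<noteq> 0 \<and>
             \<bar>ln (norm (f (of_real r * exp (\<i> * of_real t)))) - h t * r powr \<rho> r\<bar>
               \<le> C * (r powr \<rho> r * iter_log_eps N r)"
    using assms(9) by blast
  obtain N' where N': "N = Suc N'" using assms(2) by (cases N) auto
  define \<phi> where "\<phi> = (\<lambda>x. exp (x * \<rho> (exp x)))"
  \<comment> \<open>substituting the exponential removes one logarithm\<close>
  define \<epsilon> where "\<epsilon> = (\<lambda>x. 1 / ((ln :: real \<Rightarrow> real) ^^ N') x)"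
  have eps_eq: "iter_log_eps N (exp x) = \<epsilon> x" for x
    unfolding iter_log_eps_def \<epsilon>_def N' funpow_Suc_right by simp
  have phi_eq: "exp x powr \<rho> (exp x) = \<phi> x" for x
    by (simp add: \<phi>_def powr_def mult.commute)
  have ln_pos: "\<forall>\<^sub>F x in at_top. 0 < ((ln :: real \<Rightarrow> real) ^^ N') x" by (rule eventually_iter_ln_gt)
  interpret regular_growth m \<theta> h \<phi> \<epsilon> f \<rho>0 "max C 0"
  proof unfold_locales
    show "1 \<le> m" by (rule assms(1))
    show "\<theta> j < \<theta> (j + 1)" if "j \<in> {1..m}" for j using assms(3) that by blast
    show "\<theta> (m + 1) = \<theta> 1 + 2 * pi" by (rule assms(4))
    show "continuous_on UNIV h" by (rule assms(5))
    show "0 < h t" if "j \<in> {1..m}" "\<theta> j < t" "t < \<theta> (j + 1)" for j t using assms(6) that by blast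
    show "f holomorphic_on UNIV" by (rule fh)
    show "0 < \<rho>0" by (rule \<rho>0)
    show "0 \<le> max C 0" by simp
    show "0 < \<phi> x" for x by (simp add: \<phi>_def)
    show "\<forall>\<^sub>F x in at_top. \<forall>t\<in>{-A..A}. \<bar>\<phi> (x + t) - \<phi> x * exp (\<rho>0 * t)\<bar> \<le> e * \<bar>t\<bar> * \<phi> x"
      if "0 < e" "0 < A" for e A
      unfolding \<phi>_def by (rule exp_increment_approx[OF \<psi>' \<rho>0(1) that])
    show "\<forall>\<^sub>F x in at_top. exp (\<rho>0 / 2 * x) \<le> \<phi> x"
    proof -
      have "\<forall>\<^sub>F r in at_top. \<rho>0 / 2 < \<rho> r" by (rule order_tendstoD(1)[OF \<rho>0(2)]) (use \<rho>0(1) in simp)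
      then have "\<forall>\<^sub>F x in at_top. \<rho>0 / 2 < \<rho> (exp x)" by (rule eventually_compose_filterlim[OF _ exp_at_top])
      with eventually_ge_at_top[of 0] show ?thesis
      proof eventually_elim
        case (elim x)
        then have "\<rho>0 / 2 * x \<le> \<rho> (exp x) * x" by (intro mult_right_mono) auto
        then show ?case by (simp add: \<phi>_def mult.commute)
      qed
    qed
    show "\<forall>\<^sub>F x in at_top. 0 < \<epsilon> x" using ln_pos by eventually_elim (simp add: \<epsilon>_def)
    show "(\<epsilon> \<longlongrightarrow> 0) at_top"
      unfolding \<epsilon>_def by (rule real_tendsto_divide_at_top[OF tendsto_const filterlim_iter_ln])
    show "\<exists>X. \<forall>x\<ge>X. \<forall>y\<ge>x. \<epsilon> y \<le> \<epsilon> x"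
    proof -
      obtain X where X: "\<And>x y. X \<le> x \<Longrightarrow> x \<le> y \<Longrightarrow> 0 < ((ln :: real \<Rightarrow> real) ^^ N') x \<and> (ln ^^ N') x \<le> (ln ^^ N') y"
        using iter_ln_mono[of N'] by blast
      have "\<epsilon> y \<le> \<epsilon> x" if "X \<le> x" "x \<le> y" for x y
        unfolding \<epsilon>_def using X[OF that] by (intro divide_left_mono mult_pos_pos) auto
      then show ?thesis by blast
    qed
    show "\<forall>\<^sub>F x in at_top. \<epsilon> (exp (a * x)) \<le> \<epsilon> x / 2" if "0 < a" for a
      using iter_ln_exp_ge[OF that, of N'] ln_pos
    proof eventually_elim
      case (elim x)
      have "1 / (ln ^^ N') (exp (a * x)) \<le> 1 / (2 * (ln ^^ N') x)"
        using elim by (intro divide_left_mono mult_pos_pos) auto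
      then show ?case by (simp add: \<epsilon>_def)
    qed
    have "\<forall>\<^sub>F x in at_top. \<forall>t\<in>{\<theta> 1..\<theta> (m + 1)}.
           (\<forall>j\<in>{1..m + 1}. \<bar>t - \<theta> j\<bar> > iter_log_eps N (exp x)) \<longrightarrow>
             f (of_real (exp x) * exp (\<i> * of_real t)) \<noteq> 0 \<and>
             \<bar>ln (norm (f (of_real (exp x) * exp (\<i> * of_real t)))) - h t * exp x powr \<rho> (exp x)\<bar>
               \<le> C * (exp x powr \<rho> (exp x) * iter_log_eps N (exp x))"
      by (rule eventually_compose_filterlim[OF C exp_at_top])
    moreover have "\<forall>\<^sub>F x in at_top. 0 < \<epsilon> x" using ln_pos by eventually_elim (simp add: \<epsilon>_def)
    ultimately show "\<forall>\<^sub>F x in at_top. \<forall>t\<in>{\<theta> 1..\<theta> (m + 1)}. (\<forall>j\<in>{1..m + 1}. \<epsilon> x < \<bar>t - \<theta> j\<bar>) \<longrightarrow>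
        f (exp (Complex x t)) \<noteq> 0 \<and>
        \<bar>ln (norm (f (exp (Complex x t)))) - h t * \<phi> x\<bar> \<le> max C 0 * (\<phi> x * \<epsilon> x)"
    proof eventually_elim
      case (elim x)
      have e: "of_real (exp x) * exp (\<i> * of_real t) = exp (Complex x t)" for t
        by (simp add: Complex_eq exp_add exp_of_real)
      have "C * (\<phi> x * \<epsilon> x) \<le> max C 0 * (\<phi> x * \<epsilon> x)"
        using elim(2) by (intro mult_right_mono) (auto simp: \<phi>_def)
      with elim(1) show ?case unfolding eps_eq phi_eq e by (meson order_trans)
    qed
  qed
  obtain c C' \<kappa> X1 where c: "c > 0" "C' > 0" "\<kappa> > 0" and
    X1: "\<And>w0 \<eta>. X1 \<le> Re w0 \<Longrightarrow> 0 < \<eta> \<Longrightarrow> \<eta> \<le> 1 \<Longrightarrow> (\<forall>x\<ge>Re w0 - 1. \<epsilon> x \<le> \<kappa> * \<eta>) \<Longrightarrow>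
     far \<eta> w0 \<Longrightarrow> \<exists>L. good_log c C' \<eta> w0 L"
    using good_log_exists by metis
  obtain X2 where X2: "\<And>x. X2 \<le> x \<Longrightarrow> \<exists>w. \<bar>Re w - x\<bar> < 2 \<and> norm (E w) \<le> 1"
    using small_values_in_annuli by blast
  \<comment> \<open>the losses \<open>(8 m + 2) \<eta>\<^sub>k\<^sub>+\<^sub>1\<close> and \<open>4 \<eta>\<^sub>k\<close> of one step then add up to at most a quarter of \<open>2\<^bsup>-k\<^esup>\<close>\<close>
  define \<eta>0 where "\<eta>0 = 1 / (32 * (real m + 1))"
  define \<sigma> where "\<sigma> = min (1 / 8) (c / C')"
  have \<eta>0: "0 < \<eta>0" "\<eta>0 \<le> 1" by (simp_all add: \<eta>0_def field_simps)
  obtain x :: "nat \<Rightarrow> real" where x: "\<And>k. max X1 X2 \<le> x k" "\<And>k. real k \<le> x k"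
    "\<And>k y. x k \<le> y \<Longrightarrow> \<epsilon> y \<le> \<kappa> * (\<eta>0 / 2 ^ k)"
    "\<And>k y. x k \<le> y \<Longrightarrow> x (Suc k) + 2 \<le> c * (\<eta>0 / 2 ^ k) * \<phi> y"
    "\<And>k y. x k \<le> y \<Longrightarrow> 20 / \<sigma> \<le> c * \<phi> y * (\<eta>0 / 2 ^ k)\<^sup>2"
    using stages[OF c(1,3) \<eta>0, of "max X1 X2" "20 / \<sigma>"] by blast
  interpret staged_growth m \<theta> h \<phi> \<epsilon> f \<rho>0 "max C 0" c C' \<eta>0 \<sigma> x
  proof unfold_locales
    show "0 < c" "0 < C'" "0 < \<eta>0" using c \<eta>0 by auto
    show "\<eta>0 \<le> 1 / (32 * (real m + 1))" by (simp add: \<eta>0_def)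
    show "\<sigma> = min (1 / 8) (c / C')" by (simp add: \<sigma>_def)
    show "\<exists>L. good_log c C' (\<eta>0 / 2 ^ k) w L" if "x k + 1 \<le> Re w" "far (\<eta>0 / 2 ^ k) w" for k w
    proof (rule X1[OF _ _ _ _ that(2)])
      show "X1 \<le> Re w" using x(1)[of k] that(1) by simp
      show "0 < \<eta>0 / 2 ^ k" using \<eta>0 by simp
      have "\<eta>0 / 2 ^ k \<le> \<eta>0 / 1" using \<eta>0 by (intro divide_left_mono) auto
      also have "\<dots> \<le> 1" using \<eta>0 by simp
      finally show "\<eta>0 / 2 ^ k \<le> 1" .
      show "\<forall>y\<ge>Re w - 1. \<epsilon> y \<le> \<kappa> * (\<eta>0 / 2 ^ k)" using that(1) by (intro allI impI x(3)) simp
    qed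
    show "real k \<le> x k" for k by (rule x(2))
    show "x (Suc k) + 2 \<le> c * (\<eta>0 / 2 ^ k) * \<phi> y" if "x k \<le> y" for k y by (rule x(4)[OF that])
    show "\<exists>w. \<bar>Re w - y\<bar> < 2 \<and> norm (E w) \<le> 1" if "x k \<le> y" for k y
      using X2[of y] x(1)[of k] that by simp
    show "20 / \<sigma> \<le> c * \<phi> y * (\<eta>0 / 2 ^ k)\<^sup>2" if "x k \<le> y" for k y by (rule x(5)[OF that])
  qed
  obtain w where w: "w \<in> core_points 0" using core_points_nonempty by blast
  define S where "S = eternal_survivors \<inter> ball w (radius 0)"
  have Spos: "0 < emeasure lebesgue S"
    using eternal_survivors_positive_area[OF w] by (simp add: S_def)
  have sub: "exp ` S \<subseteq> escaping_set f \<inter> Julia_set f"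
    using eternal_survivors_in_escaping_Julia by (auto simp: S_def)
  have meas: "escaping_set f \<inter> Julia_set f \<in> sets lebesgue"
    using escaping_Julia_borel[OF fh] by simp
  show ?thesis
  proof (rule ccontr)
    assume "\<not> 0 < emeasure lebesgue (escaping_set f \<inter> Julia_set f)"
    then have "escaping_set f \<inter> Julia_set f \<in> null_sets lebesgue" using meas by (simp add: null_sets_def)
    then have "negligible (escaping_set f \<inter> Julia_set f)" by (simp add: negligible_iff_null_sets)
    then have neg: "negligible (exp ` S)" by (rule negligible_subset[OF _ sub])
    \<comment> \<open>a branch of the logarithm on the image of the small disc around w; it maps null sets to null sets\<close>
    define g where "g = (\<lambda>z. w + Ln (z * exp (- w)))"
    have small: "\<bar>Im (v - w)\<bar> < 1" if "v \<in> S" for v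
    proof -
      have "dist w v < 1" using that radius_le(2)[of 0] by (simp add: S_def)
      then show ?thesis using abs_Im_le_cmod[of "v - w"] by (simp add: dist_norm norm_minus_commute)
    qed
    have gv: "g (exp v) = v" if "v \<in> S" for v
    proof -
      have "exp v * exp (- w) = exp (v - w)" by (simp add: exp_diff exp_minus divide_inverse)
      moreover have "Ln (exp (v - w)) = v - w" using small[OF that] pi_gt3 by (intro Ln_exp) auto
      ultimately show ?thesis by (simp add: g_def)
    qed
    have "g differentiable_on exp ` S"
    proof (rule differentiable_at_imp_differentiable_on)
      fix z assume "z \<in> exp ` S"
      then obtain v where v: "v \<in> S" "z = exp v" by blast
      have "exp v * exp (- w) = exp (v - w)" by (simp add: exp_diff exp_minus divide_inverse)
      moreover have "exp (v - w) \<notin> \<real>\<^sub>\<le>\<^sub>0"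
      proof -
        have "cos (Im (v - w)) > 0" using small[OF v(1)] pi_gt3 by (intro cos_gt_zero_pi) auto
        then have "Re (exp (v - w)) > 0" by (simp add: Re_exp)
        then show ?thesis by (auto simp: complex_nonpos_Reals_iff)
      qed
      ultimately have "z * exp (- w) \<notin> \<real>\<^sub>\<le>\<^sub>0" using v(2) by simp
      then have "(Ln has_field_derivative inverse (z * exp (- w))) (at (z * exp (- w)))"
        by (rule has_field_derivative_Ln)
      moreover have "((\<lambda>z. z * exp (- w)) has_field_derivative exp (- w)) (at z)"
        by (auto intro!: derivative_eq_intros)
      ultimately have "((\<lambda>z. Ln (z * exp (- w))) has_field_derivative inverse (z * exp (- w)) * exp (- w)) (at z)"
        by (rule DERIV_chain2)
      from DERIV_add[OF DERIV_const this] have "g field_differentiable at z"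
        unfolding g_def field_differentiable_def by blast
      then show "g differentiable at z" by (rule field_differentiable_imp_differentiable)
    qed
    then have "negligible (g ` exp ` S)"
      by (rule negligible_differentiable_image_negligible[OF order_refl neg])
    moreover have "g ` exp ` S = S" using gv by (force simp: image_image)
    ultimately have "S \<in> null_sets lebesgue" by (simp add: negligible_iff_null_sets)
    then show False using Spos by (simp add: null_sets_def)
  qed
qed

end
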